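(* Let $n$ be a positive integer, and let $\mathsf D$ be the vector field on $\mathsf T=\mathsf T_n$ given either by Option 1 or by Option 2, $\mathsf H$ the radial vector field, $\mathfrak G$ the AMSY-Lie algebra (all as defined in the context), and $\delta_2^n$ the Kronecker delta. Then $\mathsf D$ is a quasi-homogeneous vector field of degree $2$ in $\mathfrak G$ and $$\Big[\mathsf D,(1+\delta_2^n)\frac{\partial}{\partial t_2}\Big]=\mathsf H .$$
   Context: **The moduli space $\mathsf T$.** Fix $n\ge 1$. Put $m=\frac{n+1}2$ if $n$ is odd, $m=\frac n2$ if $n$ is even; $d=\frac{(n+1)(n+3)}4+1$ if $n$ is odd, $d=\frac{n(n+2)}4+1$ if $n$ is even. $\mathsf T=\mathsf T_n$ is the moduli space of pairs $(X,[\alpha_1,\dots,\alpha_{n+1}])$, where $X$ is a mirror $n$-fold of the Dwork family (desingularized quotient of $t_{n+2}x_0^{n+2}+x_1^{n+2}+\dots+x_{n+1}^{n+2}-(n+2)t_1x_0\cdots x_{n+1}=0$ by the group of $(\zeta_0,\dots,\zeta_{n+1})$ with $\zeta_i^{n+2}=1$, $\prod\zeta_i=1$) and $\alpha_1,\dots,\alpha_{n+1}$ is a basis of $H^n_{\rm dR}(X)$ with $\alpha_i\in F^{n+1-i}\setminus F^{n+2-i}$ (Hodge filtration) and intersection matrix $(\langle\alpha_i,\alpha_j\rangle)=\Phi$, where $\Phi=\begin{pmatrix}0&J_m\\-J_m&0\end{pmatrix}$ for $n$ odd, $\Phi=J_{n+1}$ for $n$ even, $J_k$ being the $k\times k$ matrix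 with $1$'s on the antidiagonal and $0$ elsewhere. It has the following explicit description. Let $B$ be the $(n+1)\times(n+1)$ matrix of $1$-forms in $t_1,t_{n+2}$ (Gauss-Manin matrix in a basis $\omega=(\omega_1,\dots,\omega_{n+1})^{\rm tr}$) with entries: $B[i,i]=-\frac{i}{(n+2)t_{n+2}}dt_{n+2}$ and $B[i,i+1]=dt_1-\frac{t_1}{(n+2)t_{n+2}}dt_{n+2}$ for $1\le i\le n$; $B[n+1,j]=\frac{-S_2(n+2,j)t_1^j}{t_1^{n+2}-t_{n+2}}dt_1+\frac{S_2(n+2,j)t_1^{j+1}}{(n+2)t_{n+2}(t_1^{n+2}-t_{n+2})}dt_{n+2}$ for $1\le j\le n$; $B[n+1,n+1]=\frac{-S_2(n+2,n+1)t_1^{n+1}}{t_1^{n+2}-t_{n+2}}dt_1+\frac{\frac{n(n+1)}2t_1^{n+2}+(n+1)t_{n+2}}{(n+2)t_{n+2}(t_1^{n+2}-t_{n+2})}dt_{n+2}$; all other entries $0$. Here $S_2$ denotes Stirling numbers of the second kind. Let $\Omega=(\langle\omega_i,\omega_j\rangle)$ be the $(-1)^n$-symmetric matrix determined by $\Omega_{ij}=0$ for $i+j\le n+1$, $\Omega_{1,n+1}=(-(n+2))^n\frac{c_n}{t_1^{n+2}-t_{n+2}}$ ($c_n$ a fixed nonzero constant), $\Omega_{j,n+2-j}=(-1)^{j-1}\Omega_{1,n+1}$, and $d\Omega=B\Omega+\Omega B^{\rm tr}$. Points of $\mathsf T$ are given by $(t_1,t_{n+2})$ with $t_{n+2}(t_1^{n+2}-t_{n+2})\ne0$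 and an invertible lower triangular matrix $S=(s_{ij})$ with $s_{11}=1$ and $S\Omega S^{\rm tr}=\Phi$; then $\alpha=S\omega$. Independent coordinates: the entries $s_{ij}$, $i\ge j$, $(i,j)\neq(1,1)$, with $i+j\le n+2$ ($n$ odd) or $i+j<n+2$ ($n$ even), read from left to right and top to bottom, are named $t_2,t_3,\dots$ in order, skipping the index $n+2$ (already used). So $t_2=s_{21}$. Let $I=\{1,\dots,d\}$ if $n\ne2$, $I=\{1,2,4\}$ if $n=2$; $(t_j)_{j\in I}$ is the chart. For $n$ even let in addition $u=s_{\frac{n+2}2\frac{n+2}2}$, so $u^2=\frac{(-1)^{n/2}}{c_n(n+2)^n}(t_1^{n+2}-t_{n+2})$ ($u$ is called $t_{d+1}$, and $t_3$ when $n=2$). All other entries of $S$ are regular functions of these, and $\mathcal O_{\mathsf T}=\mathbb C\big[t_j\,(j\in I),\,u,\,\frac1{t_{n+2}(t_{n+2}-t_1^{n+2})\check t}\big]$ ($u$ present only for $n$ even, subject to its quadratic relation), where $\check t$ is the product of the $m-1$ coordinates $t_j$ lying on the main diagonal of $S$. Vector fields on $\mathsf T$ are $\mathbb C$-derivations of $\mathcal O_{\mathsf T}$, written $\sum_{j\in I}E^j\frac{\partial}{\partial t_j}$ ($\frac{\partial}{\partial t_j}$ extends uniquely to $u$); $[\cdot,\cdot]$ is the Lie bracket of vector fields, $[V,W]=VW-WV$. **Vector fields.** For a vector field $E$ its Gauss-Manin matrix $A_E$ (i.e. $\nabla_E\alpha=A_E\alpha$) is determined by $E(S)=A_ES-S\,B(E)$,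 with $E(S)$ taken entrywise; $E$ is determined by $A_E$. - The modular vector field $\mathsf R$ is the unique vector field for which there are regular functions $\mathsf Y_1,\dots,\mathsf Y_{n-2}$ such that $A_{\mathsf R}=\mathsf Y$, where $\mathsf Y$ has superdiagonal $(1,\mathsf Y_1,\dots,\mathsf Y_{n-2},-1)$ (for $n=2$: $(1,-1)$; for $n=1$: $(1)$) and zeros elsewhere, and $\mathsf Y\Phi+\Phi\mathsf Y^{\rm tr}=0$. - For $\mathfrak g$ upper triangular with $\mathfrak g^{\rm tr}\Phi+\Phi\mathfrak g=0$, $\mathsf R_{\mathfrak g}$ is the unique vector field with $A_{\mathsf R_{\mathfrak g}}=\mathfrak g^{\rm tr}$. With $E_{ij}$ the matrix units put $\mathfrak g_{11}=E_{11}-E_{n+1,n+1}$ and, for $n\ge3$, $\mathfrak g_{22}=E_{22}-E_{nn}$. - $\mathsf H:=-\mathsf R_{\mathfrak g_{11}}$ if $n=1$, $\mathsf H:=-2\mathsf R_{\mathfrak g_{11}}$ if $n=2$, $\mathsf H:=\mathsf R_{\mathfrak g_{22}}-\mathsf R_{\mathfrak g_{11}}$ if $n\ge3$. One has $\mathsf H=\sum_{j\in I}w_jt_j\frac{\partial}{\partial t_j}$ with non-negative integers $w_j$: for $n=1$, $(w_1,w_2,w_3)=(1,2,3)$; for $n=2$, $(w_1,w_2,w_4)=(2,2,8)$; for $n\ge3$, $w_1=1$, $w_{n+2}=n+2$, and if $t_j=s_{ik}$ then $w_j=k+1$ for $i\in\{2,n+1\}$, $w_j=k$ for $3\le i\le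 n-1$, $w_j=k-1$ for $i=n$. - The AMSY-Lie algebra $\mathfrak G$ is the $\mathcal O_{\mathsf T}$-submodule of the module of vector fields on $\mathsf T$ generated by $\mathsf R$ and all $\mathsf R_{\mathfrak g}$, where $\mathfrak g$ runs over the upper triangular complex $(n+1)\times(n+1)$ matrices with $\mathfrak g^{\rm tr}\Phi+\Phi\mathfrak g=0$. **Weights.** $\deg t_j=w_j$, and for $n$ even $\deg u=\frac{n+2}2$ if $n\ge4$, $\deg u=4$ if $n=2$. This makes $\mathcal O_{\mathsf T}$ $\mathbb Z$-graded. A vector field $E=\sum_{j\in I}E^j\frac{\partial}{\partial t_j}$ is quasi-homogeneous of degree $e$ if each $E^j$ is homogeneous of weight $w_j+e$ (zero being allowed). **The vector field $\mathsf D$.** Option 1: $\mathsf D:=\mathsf R$, but for odd $n\ge3$ the coordinate $t_d$ of the chart is replaced by $\tilde t_d:=t_7+t_2t_4$ if $n=3$ (here $d=7$), $\tilde t_d:=t_d+t_2t_{d-2}$ if $n\ge5$; $\tilde t_d$ has weight $w_d=2$ and is again denoted $t_d$, and all partial derivatives $\frac{\partial}{\partial t_j}$ (in particular $\frac{\partial}{\partial t_2}$) are with respect to the new chart. Option 2: the original chart is kept and $\mathsf D:=\mathsf R+t_2\big([\mathsf R,(1+\delta_2^n)\frac{\partial}{\partial t_2}]-\mathsf H\big)$. *)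

theory Defs
  imports
    Complex_Main
    "HOL-Library.Function_Algebras"
    "HOL-Combinatorics.Stirling"
    "Jordan_Normal_Form.Matrix"
begin

section \<open>Matrices\<close>

text \<open>The library's matrices are indexed from 0. Entries that depend on the position are
  written with indices starting at 1, through the following two functions.\<close>

definition mat1 :: "nat \<Rightarrow> (nat \<Rightarrow> nat \<Rightarrow> 'a) \<Rightarrow> 'a mat" where
  "mat1 N f = mat N N (\<lambda>(i, j). f (i + 1) (j + 1))"

definition entry :: "'a mat \<Rightarrow> nat \<Rightarrow> nat \<Rightarrow> 'a" where
  "entry M i j = M $$ (i - 1, j - 1)"

definition antidiag :: "nat \<Rightarrow> complex mat" where
  "antidiag k = mat1 k (\<lambda>i j. if i + j = k + 1 then 1 else 0)"

definition Phi :: "nat \<Rightarrow> complex mat" where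
  "Phi n = (if odd n
     then let m = (n + 1) div 2
          in four_block_mat (0\<^sub>m m m) (antidiag m) (- antidiag m) (0\<^sub>m m m)
     else antidiag (n + 1))"

definition matrix_unit :: "nat \<Rightarrow> nat \<Rightarrow> nat \<Rightarrow> complex mat" where
  "matrix_unit n k l = mat1 (n + 1) (\<lambda>i j. if i = k \<and> j = l then 1 else 0)"

section \<open>Gauss-Manin matrix and intersection form of the basis \<open>\<omega>\<close>\<close>

text \<open>The matrix of 1-forms is \<open>B = B1 dt\<^sub>1 + B2 dt\<^bsub>n+2\<^esub>\<close>, evaluated
  at \<open>t\<^sub>1 = a\<close>, \<open>t\<^bsub>n+2\<^esub> = b\<close>.\<close>

definition B1 :: "nat \<Rightarrow> complex \<Rightarrow> complex \<Rightarrow> complex mat" where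
  "B1 n a b = mat1 (n + 1) (\<lambda>i j.
     if i \<le> n then (if j = i + 1 then 1 else 0)
     else - of_nat (Stirling (n + 2) j) * a ^ j / (a ^ (n + 2) - b))"

definition B2 :: "nat \<Rightarrow> complex \<Rightarrow> complex \<Rightarrow> complex mat" where
  "B2 n a b = mat1 (n + 1) (\<lambda>i j.
     if i \<le> n then
       (if j = i then - of_nat i / (of_nat (n + 2) * b)
        else if j = i + 1 then - a / (of_nat (n + 2) * b)
        else 0)
     else if j \<le> n then
       of_nat (Stirling (n + 2) j) * a ^ (j + 1) / (of_nat (n + 2) * b * (a ^ (n + 2) - b))
     else
       (of_nat (n * (n + 1)) / 2 * a ^ (n + 2) + of_nat (n + 1) * b)
         / (of_nat (n + 2) * b * (a ^ (n + 2) - b)))"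

text \<open>The matrix \<open>\<Omega> = (\<langle>\<omega>\<^sub>i, \<omega>\<^sub>j\<rangle>)\<close> as a function of \<open>(t\<^sub>1, t\<^bsub>n+2\<^esub>)\<close>. The last two
  clauses are the \<open>dt\<^sub>1\<close>- and \<open>dt\<^bsub>n+2\<^esub>\<close>-components of \<open>d\<Omega> = B \<Omega> + \<Omega> B\<^sup>t\<^sup>r\<close>. These conditions
  determine \<open>\<Omega>\<close> on \<open>b (a\<^sup>n\<^sup>+\<^sup>2 - b) \<noteq> 0\<close>.\<close>

definition intersection_matrix ::
  "nat \<Rightarrow> complex \<Rightarrow> (complex \<Rightarrow> complex \<Rightarrow> complex mat) \<Rightarrow> bool" where
  "intersection_matrix n c \<Omega> \<longleftrightarrow> (\<forall>a b. b * (a ^ (n + 2) - b) \<noteq> 0 \<longrightarrow>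
     \<Omega> a b \<in> carrier_mat (n + 1) (n + 1) \<and>
     transpose_mat (\<Omega> a b) = (- 1) ^ n \<cdot>\<^sub>m \<Omega> a b \<and>
     (\<forall>i\<in>{1..n+1}. \<forall>j\<in>{1..n+1}. i + j \<le> n + 1 \<longrightarrow> entry (\<Omega> a b) i j = 0) \<and>
     entry (\<Omega> a b) 1 (n + 1) = (- of_nat (n + 2)) ^ n * (c / (a ^ (n + 2) - b)) \<and>
     (\<forall>j\<in>{1..n+1}. entry (\<Omega> a b) j (n + 2 - j) = (- 1) ^ (j - 1) * entry (\<Omega> a b) 1 (n + 1)) \<and>
     (\<forall>i\<in>{1..n+1}. \<forall>j\<in>{1..n+1}.
        ((\<lambda>z. entry (\<Omega> z b) i j) has_field_derivative
           entry (B1 n a b * \<Omega> a b + \<Omega> a b * transpose_mat (B1 n a b)) i j) (at a) \<and>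
        ((\<lambda>z. entry (\<Omega> a z) i j) has_field_derivative
           entry (B2 n a b * \<Omega> a b + \<Omega> a b * transpose_mat (B2 n a b)) i j) (at b)))"

section \<open>The moduli space and its regular functions\<close>

text \<open>A point is the triple \<open>(t\<^sub>1, t\<^bsub>n+2\<^esub>, S)\<close>.\<close>

type_synonym point = "complex \<times> complex \<times> complex mat"
type_synonym func = "point \<Rightarrow> complex"

definition moduli :: "nat \<Rightarrow> (complex \<Rightarrow> complex \<Rightarrow> complex mat) \<Rightarrow> point set" where
  "moduli n \<Omega> = {(a, b, S).
     b * (a ^ (n + 2) - b) \<noteq> 0 \<and>
     S \<in> carrier_mat (n + 1) (n + 1) \<and> invertible_mat S \<and>
     upper_triangular (transpose_mat S) \<and> entry S 1 1 = 1 \<and>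
     S * \<Omega> a b * transpose_mat S = Phi n}"

text \<open>Functions on the moduli space are represented by functions on all of \<open>point\<close> that vanish
  outside of it, so that equality of functions on the moduli space is equality in HOL. Sums and
  products are the pointwise ones of \<open>Function_Algebras\<close>; the unit of the ring of regular
  functions is \<open>cst n \<Omega> 1\<close>.\<close>

definition on_moduli :: "nat \<Rightarrow> (complex \<Rightarrow> complex \<Rightarrow> complex mat) \<Rightarrow> func \<Rightarrow> func" where
  "on_moduli n \<Omega> f = (\<lambda>p. if p \<in> moduli n \<Omega> then f p else 0)"

definition cst :: "nat \<Rightarrow> (complex \<Rightarrow> complex \<Rightarrow> complex mat) \<Rightarrow> complex \<Rightarrow> func" where
  "cst n \<Omega> z = on_moduli n \<Omega> (\<lambda>_. z)"

definition Smat :: "nat \<Rightarrow> (complex \<Rightarrow> complex \<Rightarrow> complex mat) \<Rightarrow> func mat" where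
  "Smat n \<Omega> = mat1 (n + 1) (\<lambda>i j. on_moduli n \<Omega> (\<lambda>(a, b, S). entry S i j))"

definition d_index :: "nat \<Rightarrow> nat" where
  "d_index n = (if odd n then (n + 1) * (n + 3) div 4 + 1 else n * (n + 2) div 4 + 1)"

definition I_index :: "nat \<Rightarrow> nat set" where
  "I_index n = (if n = 2 then {1, 2, 4} else {1..d_index n})"

text \<open>The positions of the independent entries of \<open>S\<close>, row by row.\<close>

definition positions :: "nat \<Rightarrow> (nat \<times> nat) list" where
  "positions n = [(i, j). i \<leftarrow> [1..<n + 2], j \<leftarrow> [1..<i + 1],
     (i, j) \<noteq> (1, 1) \<and> (if odd n then i + j \<le> n + 2 else i + j < n + 2)]"

text \<open>Position of \<open>t\<^sub>j\<close> in \<open>S\<close>, for \<open>j \<in> I - {1, n + 2}\<close>; the index \<open>n + 2\<close> is skipped in the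
  numbering.\<close>

definition t_pos :: "nat \<Rightarrow> nat \<Rightarrow> nat \<times> nat" where
  "t_pos n j = positions n ! (if j < n + 2 then j - 2 else j - 3)"

definition t_coord :: "nat \<Rightarrow> (complex \<Rightarrow> complex \<Rightarrow> complex mat) \<Rightarrow> nat \<Rightarrow> func" where
  "t_coord n \<Omega> j = on_moduli n \<Omega> (\<lambda>(a, b, S).
     if j = 1 then a else if j = n + 2 then b else entry S (fst (t_pos n j)) (snd (t_pos n j)))"

text \<open>Only used for even \<open>n\<close>.\<close>

definition u_coord :: "nat \<Rightarrow> (complex \<Rightarrow> complex \<Rightarrow> complex mat) \<Rightarrow> func" where
  "u_coord n \<Omega> = on_moduli n \<Omega> (\<lambda>(a, b, S). entry S ((n + 2) div 2) ((n + 2) div 2))"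

definition diag_index :: "nat \<Rightarrow> nat set" where
  "diag_index n = {j \<in> I_index n - {1, n + 2}. fst (t_pos n j) = snd (t_pos n j)}"

text \<open>The function \<open>1 / (t\<^bsub>n+2\<^esub> (t\<^bsub>n+2\<^esub> - t\<^sub>1\<^sup>n\<^sup>+\<^sup>2) \<check>t)\<close>.\<close>

definition inv_disc :: "nat \<Rightarrow> (complex \<Rightarrow> complex \<Rightarrow> complex mat) \<Rightarrow> func" where
  "inv_disc n \<Omega> = on_moduli n \<Omega> (\<lambda>p.
     1 / (t_coord n \<Omega> (n + 2) p * (t_coord n \<Omega> (n + 2) p - t_coord n \<Omega> 1 p ^ (n + 2))
          * (\<Prod>j\<in>diag_index n. t_coord n \<Omega> j p)))"

inductive_set regular :: "nat \<Rightarrow> (complex \<Rightarrow> complex \<Rightarrow> complex mat) \<Rightarrow> func set"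
  for n \<Omega> where
  const: "cst n \<Omega> z \<in> regular n \<Omega>"
| coord: "j \<in> I_index n \<Longrightarrow> t_coord n \<Omega> j \<in> regular n \<Omega>"
| root: "even n \<Longrightarrow> u_coord n \<Omega> \<in> regular n \<Omega>"
| inv: "inv_disc n \<Omega> \<in> regular n \<Omega>"
| add: "f \<in> regular n \<Omega> \<Longrightarrow> g \<in> regular n \<Omega> \<Longrightarrow> f + g \<in> regular n \<Omega>"
| mult: "f \<in> regular n \<Omega> \<Longrightarrow> g \<in> regular n \<Omega> \<Longrightarrow> f * g \<in> regular n \<Omega>"

section \<open>Vector fields\<close>

text \<open>A vector field is a \<open>\<complex>\<close>-derivation of the ring of regular functions, extended by 0 to all
  of \<open>func\<close> (again so that equality of vector fields is equality in HOL).\<close>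

type_synonym vfield = "func \<Rightarrow> func"

definition vector_field :: "nat \<Rightarrow> (complex \<Rightarrow> complex \<Rightarrow> complex mat) \<Rightarrow> vfield \<Rightarrow> bool" where
  "vector_field n \<Omega> V \<longleftrightarrow>
     (\<forall>f\<in>regular n \<Omega>. V f \<in> regular n \<Omega>) \<and>
     (\<forall>f. f \<notin> regular n \<Omega> \<longrightarrow> V f = 0) \<and>
     (\<forall>f\<in>regular n \<Omega>. \<forall>g\<in>regular n \<Omega>. V (f + g) = V f + V g) \<and>
     (\<forall>z. \<forall>f\<in>regular n \<Omega>. V (cst n \<Omega> z * f) = cst n \<Omega> z * V f) \<and>
     (\<forall>f\<in>regular n \<Omega>. \<forall>g\<in>regular n \<Omega>. V (f * g) = V f * g + f * V g)"

text \<open>Sums and differences of vector fields are the pointwise ones of \<open>Function_Algebras\<close>.\<close>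

definition scale_vf :: "func \<Rightarrow> vfield \<Rightarrow> vfield" where
  "scale_vf h V = (\<lambda>f. h * V f)"

definition bracket :: "vfield \<Rightarrow> vfield \<Rightarrow> vfield" where
  "bracket V W = (\<lambda>f. V (W f) - W (V f))"

definition partial_deriv ::
  "nat \<Rightarrow> (complex \<Rightarrow> complex \<Rightarrow> complex mat) \<Rightarrow> (nat \<Rightarrow> func) \<Rightarrow> nat \<Rightarrow> vfield" where
  "partial_deriv n \<Omega> x j = (THE V. vector_field n \<Omega> V \<and>
     (\<forall>i\<in>I_index n. V (x i) = cst n \<Omega> (if i = j then 1 else 0)))"

text \<open>The contraction \<open>B(E)\<close>.\<close>

definition B_at :: "nat \<Rightarrow> (complex \<Rightarrow> complex \<Rightarrow> complex mat) \<Rightarrow> vfield \<Rightarrow> func mat" where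
  "B_at n \<Omega> E = mat1 (n + 1) (\<lambda>i j.
     on_moduli n \<Omega> (\<lambda>(a, b, S). entry (B1 n a b) i j) * E (t_coord n \<Omega> 1) +
     on_moduli n \<Omega> (\<lambda>(a, b, S). entry (B2 n a b) i j) * E (t_coord n \<Omega> (n + 2)))"

definition has_GM_matrix ::
  "nat \<Rightarrow> (complex \<Rightarrow> complex \<Rightarrow> complex mat) \<Rightarrow> vfield \<Rightarrow> func mat \<Rightarrow> bool" where
  "has_GM_matrix n \<Omega> E A \<longleftrightarrow>
     A \<in> carrier_mat (n + 1) (n + 1) \<and> elements_mat A \<subseteq> regular n \<Omega> \<and>
     map_mat E (Smat n \<Omega>) = A * Smat n \<Omega> - Smat n \<Omega> * B_at n \<Omega> E"

definition Y_matrix ::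
  "nat \<Rightarrow> (complex \<Rightarrow> complex \<Rightarrow> complex mat) \<Rightarrow> (nat \<Rightarrow> func) \<Rightarrow> func mat" where
  "Y_matrix n \<Omega> y = mat1 (n + 1) (\<lambda>i j.
     if j = i + 1 then
       (if i = 1 then cst n \<Omega> 1 else if i = n then cst n \<Omega> (- 1) else y (i - 1))
     else 0)"

definition modular_vf :: "nat \<Rightarrow> (complex \<Rightarrow> complex \<Rightarrow> complex mat) \<Rightarrow> vfield" where
  "modular_vf n \<Omega> = (THE R. vector_field n \<Omega> R \<and>
     (\<exists>y. (\<forall>k\<in>{1..n-2}. y k \<in> regular n \<Omega>) \<and>
        has_GM_matrix n \<Omega> R (Y_matrix n \<Omega> y) \<and>
        Y_matrix n \<Omega> y * map_mat (cst n \<Omega>) (Phi n)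
          + map_mat (cst n \<Omega>) (Phi n) * transpose_mat (Y_matrix n \<Omega> y) = 0\<^sub>m (n + 1) (n + 1)))"

definition lie_alg :: "nat \<Rightarrow> complex mat set" where
  "lie_alg n = {g \<in> carrier_mat (n + 1) (n + 1). upper_triangular g \<and>
     transpose_mat g * Phi n + Phi n * g = 0\<^sub>m (n + 1) (n + 1)}"

definition R_lie :: "nat \<Rightarrow> (complex \<Rightarrow> complex \<Rightarrow> complex mat) \<Rightarrow> complex mat \<Rightarrow> vfield" where
  "R_lie n \<Omega> g = (THE E. vector_field n \<Omega> E \<and>
     has_GM_matrix n \<Omega> E (map_mat (cst n \<Omega>) (transpose_mat g)))"

definition g11 :: "nat \<Rightarrow> complex mat" where
  "g11 n = matrix_unit n 1 1 - matrix_unit n (n + 1) (n + 1)"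

definition g22 :: "nat \<Rightarrow> complex mat" where
  "g22 n = matrix_unit n 2 2 - matrix_unit n n n"

definition radial_vf :: "nat \<Rightarrow> (complex \<Rightarrow> complex \<Rightarrow> complex mat) \<Rightarrow> vfield" where
  "radial_vf n \<Omega> =
     (if n = 1 then - R_lie n \<Omega> (g11 n)
      else if n = 2 then scale_vf (cst n \<Omega> (- 2)) (R_lie n \<Omega> (g11 n))
      else R_lie n \<Omega> (g22 n) - R_lie n \<Omega> (g11 n))"

inductive_set AMSY :: "nat \<Rightarrow> (complex \<Rightarrow> complex \<Rightarrow> complex mat) \<Rightarrow> vfield set"
  for n \<Omega> where
  zero: "0 \<in> AMSY n \<Omega>"
| modular: "modular_vf n \<Omega> \<in> AMSY n \<Omega>"
| lie: "g \<in> lie_alg n \<Longrightarrow> R_lie n \<Omega> g \<in> AMSY n \<Omega>"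
| add: "V \<in> AMSY n \<Omega> \<Longrightarrow> W \<in> AMSY n \<Omega> \<Longrightarrow> V + W \<in> AMSY n \<Omega>"
| scale: "h \<in> regular n \<Omega> \<Longrightarrow> V \<in> AMSY n \<Omega> \<Longrightarrow> scale_vf h V \<in> AMSY n \<Omega>"

section \<open>Weights\<close>

definition wt :: "nat \<Rightarrow> nat \<Rightarrow> int" where
  "wt n j =
     (if n = 1 then int j
      else if n = 2 then (if j = 4 then 8 else 2)
      else if j = 1 then 1
      else if j = n + 2 then int (n + 2)
      else let (i, k) = t_pos n j in
        if i = 2 \<or> i = n + 1 then int k + 1
        else if i = n then int k - 1
        else int k)"

definition wt_u :: "nat \<Rightarrow> int" where
  "wt_u n = (if n = 2 then 4 else int ((n + 2) div 2))"

text \<open>\<open>homogeneous n \<Omega> e f\<close> holds iff \<open>f\<close> is a sum of scalar multiples of monomials of weight \<open>e\<close>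
  in the generators of the ring of regular functions (0 being homogeneous of every weight). The
  function \<open>t\<^bsub>n+2\<^esub> - t\<^sub>1\<^sup>n\<^sup>+\<^sup>2\<close> has the weight of \<open>t\<^bsub>n+2\<^esub>\<close>, which gives the weight of
  \<open>inv_disc\<close>.\<close>

inductive homogeneous ::
  "nat \<Rightarrow> (complex \<Rightarrow> complex \<Rightarrow> complex mat) \<Rightarrow> int \<Rightarrow> func \<Rightarrow> bool"
  for n \<Omega> where
  zero: "homogeneous n \<Omega> e 0"
| const: "homogeneous n \<Omega> 0 (cst n \<Omega> z)"
| coord: "j \<in> I_index n \<Longrightarrow> homogeneous n \<Omega> (wt n j) (t_coord n \<Omega> j)"
| root: "even n \<Longrightarrow> homogeneous n \<Omega> (wt_u n) (u_coord n \<Omega>)"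
| inv: "homogeneous n \<Omega> (- (2 * wt n (n + 2) + (\<Sum>j\<in>diag_index n. wt n j))) (inv_disc n \<Omega>)"
| add: "homogeneous n \<Omega> e f \<Longrightarrow> homogeneous n \<Omega> e g \<Longrightarrow> homogeneous n \<Omega> e (f + g)"
| mult: "homogeneous n \<Omega> e f \<Longrightarrow> homogeneous n \<Omega> e' g \<Longrightarrow> homogeneous n \<Omega> (e + e') (f * g)"

text \<open>Here \<open>x\<close> is a chart whose coordinate \<open>x j\<close> has weight \<open>wt n j\<close>, and \<open>E (x j)\<close> is the
  component \<open>E\<^sup>j\<close> of \<open>E = \<Sum>\<^sub>j E\<^sup>j \<partial>/\<partial>x\<^sub>j\<close>.\<close>

definition quasi_homogeneous ::
  "nat \<Rightarrow> (complex \<Rightarrow> complex \<Rightarrow> complex mat) \<Rightarrow> (nat \<Rightarrow> func) \<Rightarrow> int \<Rightarrow> vfield \<Rightarrow> bool" where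
  "quasi_homogeneous n \<Omega> x e E \<longleftrightarrow>
     vector_field n \<Omega> E \<and> (\<forall>j\<in>I_index n. homogeneous n \<Omega> (wt n j + e) (E (x j)))"

section \<open>The vector field \<open>D\<close>\<close>

datatype construction = Option1 | Option2

fun chart ::
  "construction \<Rightarrow> nat \<Rightarrow> (complex \<Rightarrow> complex \<Rightarrow> complex mat) \<Rightarrow> nat \<Rightarrow> func" where
  "chart Option1 n \<Omega> j =
     (if odd n \<and> n \<ge> 3 \<and> j = d_index n
      then t_coord n \<Omega> j + t_coord n \<Omega> 2 * (if n = 3 then t_coord n \<Omega> 4 else t_coord n \<Omega> (d_index n - 2))
      else t_coord n \<Omega> j)"
| "chart Option2 n \<Omega> j = t_coord n \<Omega> j"

text \<open>The vector field \<open>(1 + \<delta>\<^sub>2\<^sup>n) \<partial>/\<partial>t\<^sub>2\<close> with respect to the chart in use.\<close>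

definition delta_partial2 ::
  "construction \<Rightarrow> nat \<Rightarrow> (complex \<Rightarrow> complex \<Rightarrow> complex mat) \<Rightarrow> vfield" where
  "delta_partial2 opt n \<Omega> =
     scale_vf (cst n \<Omega> (1 + of_bool (n = 2))) (partial_deriv n \<Omega> (chart opt n \<Omega>) 2)"

fun D_vf :: "construction \<Rightarrow> nat \<Rightarrow> (complex \<Rightarrow> complex \<Rightarrow> complex mat) \<Rightarrow> vfield" where
  "D_vf Option1 n \<Omega> = modular_vf n \<Omega>"
| "D_vf Option2 n \<Omega> = modular_vf n \<Omega>
     + scale_vf (t_coord n \<Omega> 2)
         (bracket (modular_vf n \<Omega>) (delta_partial2 Option2 n \<Omega>) - radial_vf n \<Omega>)"

end

theory Submission
  imports Defs "HOL-Analysis.Complex_Transcendental" "Jordan_Normal_Form.Determinant"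
begin

text \<open>
  At a point, a vector field \<open>E\<close> is given on the base by two numbers \<open>w\<close>, \<open>v\<close> with
  \<open>E(t\<^sub>1) = v - t\<^sub>1 w\<close> and \<open>E(t\<^bsub>n+2\<^esub>) = - (n + 2) t\<^bsub>n+2\<^esub> w\<close>; then
  \<open>B(E) = w diag(1, ..., n+1) + v C\<close> for a companion matrix \<open>C\<close>. By the derivative of
  \<open>S \<Omega> S\<^sup>t\<^sup>r = \<Phi>\<close>, a matrix \<open>A\<close> with \<open>A \<Phi> + \<Phi> A\<^sup>t\<^sup>r = 0\<close> is the Gauss-Manin matrix of a vector
  field as soon as \<open>A S - S B(E)\<close> is lower triangular with vanishing first entry. This yields all
  \<open>R\<^sub>g\<close>, and \<open>R\<close> with \<open>w = s\<^sub>2\<^sub>1\<close>, \<open>v = s\<^sub>2\<^sub>2\<close> and the superdiagonal entries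
  \<open>s\<^sub>2\<^sub>2 s\<^sub>i\<^sub>i / s\<^bsub>i+1,i+1\<^esub>\<close>; and \<open>H\<close> multiplies each \<open>s\<^sub>i\<^sub>j\<close> by its weight.

  In the chart of Option 1, \<open>(1 + \<delta>) \<partial>/\<partial>t\<^sub>2\<close> has the constant matrix
  \<open>(1 + \<delta>) (E\<^sub>2\<^sub>1 - E\<^bsub>n+1,n\<^esub>)\<close>. It fixes \<open>t\<^sub>1\<close>, \<open>t\<^bsub>n+2\<^esub>\<close> and the diagonal of \<open>S\<close>, hence \<open>Y\<close>, so its
  bracket with \<open>R\<close> is governed by the commutator of the two matrices, which is diagonal and gives
  \<open>H\<close>. For odd \<open>n \<ge> 3\<close> the original chart adds \<open>s\<^bsub>n1\<^esub> Z\<close> to this field, where \<open>Z\<close> has matrix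
  \<open>E\<^bsub>n+1,1\<^esub>\<close>. Then \<open>F = [R, \<partial>/\<partial>t\<^sub>2] - H\<close> lies in the AMSY-Lie algebra and multiplies the coordinates
  \<open>s\<^bsub>n1\<^esub>\<close> and \<open>s\<^bsub>n+1,1\<^esub>\<close> by \<open>1\<close> and \<open>-1\<close> and kills the others, so it commutes with
  \<open>\<partial>/\<partial>t\<^sub>2\<close>; hence \<open>R + t\<^sub>2 F\<close> has bracket \<open>H\<close>.
\<close>

text \<open>Regular functions are functions on points, generated by the coordinates, a root and one
  inverse. The ring is not presented by relations, so a derivation cannot be defined by prescribing
  it on generators: the independence of the coordinates has to be established. This is done by
  constructing points. Near any point a coordinate can be moved alone, and differentiation along
  such curves gives derivations. That a derivation is determined by the coordinates follows from the
  equations of the root and of the inverse.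

  The dependent entries of S are governed by one triangular system. Its order of solution, by rows
  and in each row from the diagonal to the left, is used three times: for weights, for points and
  for tangent vectors.

  The factor 1 + \<delta> comes from the commutator with Y, which for n \<ge> 2 is E_22 +
  E_{n+1,n+1} - E_11 - E_nn before scaling. For n = 2 the middle terms cancel, and doubling gives
  the diagonal matrix of H. The degree 2 is the weight of s_21, the parameter w of R; the larger
  weight of v = s_22 is compensated by the shift of columns in B(E).\<close>

lemma entry_mat1:
  "\<lbrakk>1 \<le> i; i \<le> N; 1 \<le> j; j \<le> N\<rbrakk> \<Longrightarrow> entry (mat1 N f) i j = f i j"
  by (simp add: entry_def mat1_def)

lemma mat1_carrier [simp]: "mat1 N f \<in> carrier_mat N N"
  by (simp add: mat1_def)

subsection \<open>Numbering of the independent entries\<close>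

text \<open>The bound \<open>2 * ((n + 1) div 2) + 1\<close> is n + 2 for odd n and n + 1 for even
  n, so one inequality serves both parities of \<open>positions\<close>.\<close>

definition free :: "nat \<Rightarrow> nat \<Rightarrow> nat \<Rightarrow> bool" where
  "free n i j \<longleftrightarrow> 1 \<le> j \<and> j \<le> i \<and> (i, j) \<noteq> (1, 1) \<and> i + j \<le> 2 * ((n + 1) div 2) + 1"

text \<open>The left side is what the list comprehension in \<open>positions\<close> unfolds to; as
  a filter of concatenated rows the list is easily seen to be distinct.\<close>

lemma concat_if_eq_filter:
  "concat (map (\<lambda>i. concat (map (\<lambda>j. if P i j then [(i, j)] else []) (g i))) xs)
    = filter (\<lambda>(i, j). P i j) (concat (map (\<lambda>i. map (Pair i) (g i)) xs))"
proof -
  have "concat (map (\<lambda>j. if P i j then [(i, j)] else []) ys)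
      = filter (\<lambda>(i, j). P i j) (map (Pair i) ys)" for i ys
    by (induction ys) auto
  then show ?thesis by (induction xs) auto
qed

lemma distinct_concat_Pair:
  assumes "distinct xs" "\<And>i. distinct (g i)"
  shows "distinct (concat (map (\<lambda>i. map (Pair i) (g i)) xs))"
  using assms by (induction xs) (auto simp: distinct_map inj_on_def)

lemma distinct_positions: "distinct (positions n)"
  unfolding positions_def concat_if_eq_filter
  by (intro distinct_filter distinct_concat_Pair) auto

lemma set_positions:
  assumes "n \<ge> 1" shows "set (positions n) = {(i, j). free n i j}"
proof -
  have eq: "(if odd n then i + j \<le> n + 2 else i + j < n + 2) \<longleftrightarrow> i + j \<le> 2 * ((n + 1) div 2) + 1" for i j
    by (auto elim!: oddE evenE)
  have le: "2 * ((n + 1) div 2) + 1 \<le> n + 2" by linarith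
  show ?thesis
    unfolding positions_def concat_if_eq_filter eq using le
    by (auto simp: free_def image_iff)
qed

text \<open>Counting is done by columns: for m = (n + 1) div 2, column j \<le> m holds the rows j,
  ..., 2m + 1 - j, which gives m(m + 1) positions before (1, 1) is removed.\<close>

lemma card_free:
  assumes "n \<ge> 1"
  shows "card {(i, j). free n i j} = ((n + 1) div 2) * ((n + 1) div 2 + 1) - 1"
proof -
  define m where "m = (n + 1) div 2"
  have m: "m \<ge> 1" using assms by (simp add: m_def)
  define X where "X = Sigma {1..m} (\<lambda>j. {j..2 * m + 1 - j})"
  have "k \<le> m \<Longrightarrow> (\<Sum>j\<in>{1..k}. 2 * m + 2 - 2 * j) = k * (2 * m + 1 - k)" for k
  proof (induction k)
    case (Suc k)
    then obtain r where "m = Suc k + r" using le_Suc_ex by blast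
    with Suc show ?case by (simp add: algebra_simps)
  qed simp
  from this[of m] have sum: "(\<Sum>j\<in>{1..m}. 2 * m + 2 - 2 * j) = m * (m + 1)" by simp
  have "card X = (\<Sum>j\<in>{1..m}. card {j..2 * m + 1 - j})" by (simp add: X_def)
  also have "\<dots> = (\<Sum>j\<in>{1..m}. 2 * m + 2 - 2 * j)" by (rule sum.cong) auto
  finally have cX: "card X = m * (m + 1)" using sum by simp
  have "{(i, j). free n i j} = prod.swap ` (X - {(1, 1)})"
    unfolding set_eq_iff image_iff Bex_def
    by (auto simp: free_def X_def prod.swap_def m_def)
  then have "card {(i, j). free n i j} = card (X - {(1, 1)})"
    by (simp add: card_image inj_on_def prod.swap_def split_beta prod_eq_iff)
  also have "\<dots> = card X - 1"
    using m by (intro card_Diff_singleton) (auto simp: X_def)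
  finally show ?thesis using cX by (simp add: m_def)
qed

lemma length_positions:
  assumes "n \<ge> 1"
  shows "length (positions n) = ((n + 1) div 2) * ((n + 1) div 2 + 1) - 1"
  using distinct_card[OF distinct_positions] card_free[OF assms] set_positions[OF assms] by metis

text \<open>Compared with \<open>length_positions\<close>, this makes d the number of independent
  entries of S plus two, the two being t_1 and t_{n+2}.\<close>

lemma d_index_eq: "d_index n = ((n + 1) div 2) * ((n + 1) div 2 + 1) + 1"
proof (cases "odd n")
  case True
  then obtain k where "n = 2 * k + 1" by (elim oddE)
  moreover have "(2 * k + 2) * (2 * k + 4) = 4 * ((k + 1) * (k + 2))" by (simp add: algebra_simps)
  then have "(2 * k + 2) * (2 * k + 4) div 4 = (k + 1) * (k + 2)"
    by (metis nonzero_mult_div_cancel_left zero_neq_numeral)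
  moreover have "2 * k + 1 + 1 = 2 * k + 2" "2 * k + 1 + 3 = 2 * k + 4" "(2 * k + 1 + 1) div 2 = k + 1"
    by simp_all
  ultimately show ?thesis by (simp only: d_index_def) simp
next
  case False
  then obtain k where "n = 2 * k" by (auto elim: evenE)
  moreover have "(2 * k) * (2 * k + 2) = 4 * (k * (k + 1))" by (simp add: algebra_simps)
  then have "(2 * k) * (2 * k + 2) div 4 = k * (k + 1)"
    by (metis nonzero_mult_div_cancel_left zero_neq_numeral)
  moreover have "(2 * k + 1) div 2 = k" by simp
  ultimately show ?thesis using False by (simp only: d_index_def) simp
qed

text \<open>Only for n = 2 is the reserved index n + 2 larger than d, which explains the exceptional
  index set {1, 2, 4}.\<close>

lemma I_index_cases:
  assumes "n \<ge> 1"
  shows "1 \<in> I_index n" "n + 2 \<in> I_index n" "finite (I_index n)"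
    and "2 \<in> I_index n" "n \<noteq> 2 \<Longrightarrow> n + 2 \<le> d_index n"
proof -
  define m where "m = (n + 1) div 2"
  have d: "d_index n = m * (m + 1) + 1" by (simp add: d_index_eq m_def)
  have m1: "m \<ge> 1" using assms by (simp add: m_def)
  show le: "n + 2 \<le> d_index n" if "n \<noteq> 2"
  proof (cases "n = 1")
    case False
    then have "m \<ge> 2" using that assms by (simp add: m_def)
    then have "m * (m + 1) \<ge> m * 3" by (intro mult_le_mono) auto
    moreover have "n \<le> 2 * m" by (simp add: m_def)
    ultimately show ?thesis using \<open>m \<ge> 2\<close> d by linarith
  qed (simp add: d_index_def)
  have "m * (m + 1) \<ge> 1 * 2" using m1 by (intro mult_le_mono) auto
  then have "d_index n \<ge> 3" using d by linarith
  then show "1 \<in> I_index n" "n + 2 \<in> I_index n" "finite (I_index n)" "2 \<in> I_index n"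
    using le by (auto simp: I_index_def)
qed

text \<open>The shift \<open>f\<close> closes the gap at the skipped index n + 2 and
  \<open>g\<close> reopens it; what remains is the enumeration of the list
  \<open>positions\<close>.\<close>

lemma bij_betw_t_pos:
  assumes "n \<ge> 1"
  shows "bij_betw (t_pos n) (I_index n - {1, n + 2}) {(i, j). free n i j}"
proof -
  define f where "f j = (if j < n + 2 then j - 2 else j - 3)" for j
  define L where "L = length (positions n)"
  define g where "g k = (if k < n then k + 2 else k + 3)" for k
  have L: "L = d_index n - 2"
    using length_positions[OF assms] d_index_eq[of n] by (simp add: L_def)
  have "bij_betw f (I_index n - {1, n + 2}) {..<L}"
  proof (rule bij_betw_byWitness[where f' = g])
    have L2: "n = 2 \<Longrightarrow> L = 1" using L by (simp add: d_index_def)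
    show "\<forall>a\<in>I_index n - {1, n + 2}. g (f a) = a"
      by (auto simp: f_def g_def I_index_def split: if_splits)
    show "\<forall>a'\<in>{..<L}. f (g a') = a'" by (auto simp: f_def g_def)
    show "f ` (I_index n - {1, n + 2}) \<subseteq> {..<L}"
      using L L2 I_index_cases(5)[OF assms] by (auto simp: f_def I_index_def split: if_splits)
    show "g ` {..<L} \<subseteq> I_index n - {1, n + 2}"
      using L L2 by (auto simp: g_def I_index_def split: if_splits)
  qed
  moreover have "bij_betw ((!) (positions n)) {..<L} {(i, j). free n i j}"
    using bij_betw_nth[OF distinct_positions refl refl, of n] set_positions[OF assms] L_def by simp
  ultimately have "bij_betw ((!) (positions n) \<circ> f) (I_index n - {1, n + 2}) {(i, j). free n i j}"
    by (rule bij_betw_trans)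
  moreover have "(!) (positions n) \<circ> f = t_pos n" by (auto simp: f_def t_pos_def)
  ultimately show ?thesis by simp
qed

lemma t_pos_2:
  assumes "n \<ge> 1" shows "t_pos n 2 = (2, 1)"
proof -
  have e: "[1..<n + 2] = 1 # 2 # [3..<n + 2]"
    using assms by (simp add: upt_conv_Cons numeral_2_eq_2 numeral_3_eq_3)
  have "n = 1 \<or> n \<ge> 2" using assms by linarith
  then have "positions n ! 0 = (2, 1)"
    unfolding positions_def e using assms by (auto simp: upt_conv_Cons numeral_2_eq_2 elim!: evenE)
  then show ?thesis using assms by (simp add: t_pos_def)
qed

text \<open>For odd n the condition i + j \<le> n + 2 leaves two entries in row n and one in row n +
  1. The end of the list locates the coordinates that enter the modified chart.\<close>

lemma positions_tail:
  assumes "odd n" "n \<ge> 3"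
  obtains ps where "positions n = ps @ [(n, 1), (n, 2), (n + 1, 1)]"
proof -
  have e: "[1..<n + 2] = [1..<n] @ [n, n + 1]" 
    using assms upt_add_eq_append[of 1 n 2] by simp
  have e1: "[1..<n + 1] = 1 # 2 # [3..<n + 1]" "[1..<n + 1 + 1] = 1 # [2..<n + 2]"
    using assms by (simp_all add: upt_conv_Cons numeral_2_eq_2 numeral_3_eq_3)
  have "filter P [a..<b] = []" if "\<And>x. a \<le> x \<Longrightarrow> \<not> P x" for P a b
    using that by (auto simp: filter_empty_conv)
  then have z: "concat (map (\<lambda>j. if (i, j) \<noteq> (1, 1) \<and> (if odd n then i + j \<le> n + 2 else i + j < n + 2)
      then [(i, j)] else []) [a..<b]) = []" if "i + a > n + 2" for i a b
    using that assms by (auto simp: concat_eq_Nil_conv)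
  show ?thesis
    apply (rule that)
    unfolding positions_def e using assms z[of n 3 "n + 1"] z[of "n + 1" 2 "n + 2"]
    apply (simp only: map_append concat_append list.map concat.simps e1)
    apply simp
    done
qed

text \<open>Counting back from the end of the list, s_{n1} has index d - 2, except for n = 3: there
  d - 2 is the skipped index n + 2 = 5, and the index drops to 4.\<close>

lemma t_pos_last:
  assumes "odd n" "n \<ge> 3"
  shows "t_pos n (d_index n) = (n + 1, 1)"
    and "t_pos n (if n = 3 then 4 else d_index n - 2) = (n, 1)"
    and "(if n = 3 then 4 else d_index n - 2) \<in> I_index n - {1, 2, n + 2, d_index n}"
    and "d_index n \<in> I_index n - {1, 2, n + 2}"
proof -
  from positions_tail[OF assms] obtain ps
    where ps: "positions n = ps @ [(n, 1), (n, 2), (n + 1, 1)]" .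
  have L: "length ps + 5 = d_index n"
    using length_positions[of n] d_index_eq[of n] assms ps by simp
  obtain k where n: "n = 2 * k + 1" "k \<ge> 1" using assms by (auto elim!: oddE)
  define r where "r = (k + 1) * (k + 2)"
  have dk: "d_index n = r + 1" using n by (simp add: d_index_eq r_def)
  have d: "d_index n \<ge> n + 4"
  proof -
    have "r \<ge> (k + 1) * 3" unfolding r_def using n by (intro mult_le_mono) auto
    then show ?thesis using n unfolding dk by simp
  qed
  have d5: "d_index n \<ge> n + 5" if "n \<noteq> 3"
  proof -
    have "k \<ge> 2" using n that by auto
    then have "r \<ge> (k + 1) * 4" unfolding r_def by (intro mult_le_mono) auto
    then show ?thesis using n \<open>k \<ge> 2\<close> unfolding dk by simp
  qed
  show "t_pos n (d_index n) = (n + 1, 1)"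
    using L d ps by (auto simp: t_pos_def nth_append)
  show "t_pos n (if n = 3 then 4 else d_index n - 2) = (n, 1)"
  proof (cases "n = 3")
    case True
    then have "length ps = 2" using L by (simp add: d_index_def)
    then show ?thesis using True ps by (simp add: t_pos_def nth_append)
  next
    case False
    then have "positions n ! (d_index n - 2 - 3) = (n, 1)" 
      using L d5 ps by (simp add: nth_append flip: L)
    moreover have "\<not> d_index n - 2 < n + 2" using d5 False by linarith
    ultimately show ?thesis using False by (simp add: t_pos_def)
  qed
  show "(if n = 3 then 4 else d_index n - 2) \<in> I_index n - {1, 2, n + 2, d_index n}"
    using d d5 assms by (auto simp: I_index_def)
  show "d_index n \<in> I_index n - {1, 2, n + 2}"
    using d d5 assms by (auto simp: I_index_def)
qed

subsection \<open>Matrix entries and forms vanishing above the antidiagonal\<close>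

lemma sum_atLeast1: fixes N :: nat shows "(\<Sum>k = 1..N. f k) = (\<Sum>k = 0..<N. f (k + 1))"
  unfolding One_nat_def sum.atLeast1_atMost_eq lessThan_atLeast0 by simp

lemma entry_mult:
  assumes "A \<in> carrier_mat N N" "B \<in> carrier_mat N N" "1 \<le> i" "i \<le> N" "1 \<le> j" "j \<le> N"
  shows "entry (A * B) i j = (\<Sum>k = 1..N. entry A i k * entry B k j)"
  using assms by (simp add: entry_def scalar_prod_def sum_atLeast1 del: sum.op_ivl_Suc One_nat_def)

lemma entry_add:
  assumes "B \<in> carrier_mat N N" "1 \<le> i" "i \<le> N" "1 \<le> j" "j \<le> N"
  shows "entry (A + B) i j = entry A i j + entry B i j"
  using assms by (simp add: entry_def)

lemma entry_diff:
  assumes "B \<in> carrier_mat N N" "1 \<le> i" "i \<le> N" "1 \<le> j" "j \<le> N"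
  shows "entry (A - B) i j = entry A i j - entry B i j"
  using assms by (simp add: entry_def)

lemma entry_transpose:
  assumes "A \<in> carrier_mat N N" "1 \<le> i" "i \<le> N" "1 \<le> j" "j \<le> N"
  shows "entry (transpose_mat A) i j = entry A j i"
  using assms by (simp add: entry_def)

lemma entry_map:
  assumes "A \<in> carrier_mat N N" "1 \<le> i" "i \<le> N" "1 \<le> j" "j \<le> N"
  shows "entry (map_mat f A) i j = f (entry A i j)"
  using assms by (simp add: entry_def)

lemma entry_smult:
  assumes "A \<in> carrier_mat N N" "1 \<le> i" "i \<le> N" "1 \<le> j" "j \<le> N"
  shows "entry (x \<cdot>\<^sub>m A) i j = x * entry A i j"
  using assms by (simp add: entry_def)

lemma eq_mat_entryI:
  assumes "A \<in> carrier_mat N N" "B \<in> carrier_mat N N"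
    and "\<And>i j. \<lbrakk>1 \<le> i; i \<le> N; 1 \<le> j; j \<le> N\<rbrakk> \<Longrightarrow> entry A i j = entry B i j"
  shows "A = B"
proof (rule eq_matI)
  fix i j assume "i < dim_row B" "j < dim_col B"
  then show "A $$ (i, j) = B $$ (i, j)"
    using assms(1,2) assms(3)[of "i + 1" "j + 1"] by (simp add: entry_def)
qed (use assms in auto)

text \<open>Only one term contains the entry of \<open>f\<close> at \<open>n + 2 - k\<close>.\<close>

lemma anti_sum:
  fixes f g :: "nat \<Rightarrow> complex"
  assumes Q: "\<And>j l. \<lbrakk>1 \<le> j; 1 \<le> l; j + l \<le> n + 1\<rbrakk> \<Longrightarrow> Q j l = 0"
    and f: "\<And>j. j > i \<Longrightarrow> f j = 0" and g: "\<And>l. l > k \<Longrightarrow> g l = 0"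
    and ik: "i \<le> n + 1" "1 \<le> k" "k \<le> n + 1" "i + k \<ge> n + 2"
  shows "(\<Sum>j = 1..n+1. \<Sum>l = 1..n+1. f j * Q j l * g l) =
    f (n + 2 - k) * Q (n + 2 - k) k * g k
      + (\<Sum>j = n+2-k+1..i. \<Sum>l = 1..k. f j * Q j l * g l)"
proof -
  define j0 where "j0 = n + 2 - k"
  have "(\<Sum>j = 1..n+1. \<Sum>l = 1..n+1. f j * Q j l * g l)
      = (\<Sum>j = 1..n+1. \<Sum>l = 1..k. f j * Q j l * g l)"
    by (intro sum.cong refl sum.mono_neutral_right) (use ik in \<open>auto simp: g\<close>)
  also have "\<dots> = (\<Sum>j\<in>insert j0 {j0+1..i}. \<Sum>l = 1..k. f j * Q j l * g l)"
  proof (rule sum.mono_neutral_right)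
    show "insert j0 {j0 + 1..i} \<subseteq> {1..n + 1}" using ik by (auto simp: j0_def)
    show "\<forall>j\<in>{1..n+1} - insert j0 {j0+1..i}. (\<Sum>l = 1..k. f j * Q j l * g l) = 0"
    proof
      fix j assume j: "j \<in> {1..n+1} - insert j0 {j0+1..i}"
      show "(\<Sum>l = 1..k. f j * Q j l * g l) = 0"
      proof (cases "j > i")
        case False
        then have "j < j0" using j by auto
        then have "Q j l = 0" if "1 \<le> l" "l \<le> k" for l
          using that j by (intro Q) (auto simp: j0_def)
        then show ?thesis by (intro sum.neutral) auto
      qed (simp add: f)
    qed
  qed auto
  also have "\<dots> = (\<Sum>l = 1..k. f j0 * Q j0 l * g l)
      + (\<Sum>j = j0+1..i. \<Sum>l = 1..k. f j * Q j l * g l)"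
    by (subst sum.insert) auto
  also have "(\<Sum>l = 1..k. f j0 * Q j0 l * g l) = (\<Sum>l\<in>{k}. f j0 * Q j0 l * g l)"
    by (rule sum.mono_neutral_right) (use ik in \<open>auto simp: j0_def intro!: Q\<close>)
  finally show ?thesis by (simp add: j0_def)
qed

text \<open>For equal row indices the entry at n + 2 - i enters twice, once in each argument of the
  form; both occurrences are split off.\<close>

lemma anti_sum_diag:
  fixes f g :: "nat \<Rightarrow> complex"
  assumes Q: "\<And>j l. \<lbrakk>1 \<le> j; 1 \<le> l; j + l \<le> n + 1\<rbrakk> \<Longrightarrow> Q j l = 0"
    and f: "\<And>j. j > i \<Longrightarrow> f j = 0" and g: "\<And>l. l > i \<Longrightarrow> g l = 0"
    and i: "i \<le> n + 1" "i + i > n + 2"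
  shows "(\<Sum>j = 1..n+1. \<Sum>l = 1..n+1. f j * Q j l * g l) =
    f (n + 2 - i) * Q (n + 2 - i) i * g i + f i * Q i (n + 2 - i) * g (n + 2 - i)
      + (\<Sum>j = n+2-i+1..i. \<Sum>l = n+2-i+1..i. f j * Q j l * g l)"
proof -
  define j0 where "j0 = n + 2 - i"
  have inner: "(\<Sum>l = 1..i. f j * Q j l * g l)
      = f j * Q j j0 * g j0 + (\<Sum>l = j0+1..i. f j * Q j l * g l)" if "j \<in> {j0+1..i}" for j
  proof -
    have "(\<Sum>l = 1..i. f j * Q j l * g l) = (\<Sum>l\<in>insert j0 {j0+1..i}. f j * Q j l * g l)"
      by (rule sum.mono_neutral_right) (use i that in \<open>auto simp: j0_def intro!: Q\<close>)
    then show ?thesis by simp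
  qed
  have "(\<Sum>j = j0+1..i. f j * Q j j0 * g j0) = (\<Sum>j\<in>{i}. f j * Q j j0 * g j0)"
    by (rule sum.mono_neutral_right) (use i in \<open>auto simp: j0_def intro!: Q\<close>)
  then have "(\<Sum>j = j0+1..i. \<Sum>l = 1..i. f j * Q j l * g l)
      = f i * Q i j0 * g j0 + (\<Sum>j = j0+1..i. \<Sum>l = j0+1..i. f j * Q j l * g l)"
    using inner by (simp add: sum.distrib)
  then show ?thesis
    using anti_sum[where Q = Q and f = f and g = g and i = i and k = i and n = n, OF Q f g] i
    by (simp add: j0_def)
qed

subsection \<open>Weights of the intersection form\<close>

text \<open>Rational functions of \<open>t\<^sub>1\<close> and \<open>t\<^bsub>n+2\<^esub>\<close>, with \<open>t\<^sub>1\<close> of weight 1 also for \<open>n = 2\<close>.\<close>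

inductive weighted :: "nat \<Rightarrow> int \<Rightarrow> (complex \<Rightarrow> complex \<Rightarrow> complex) \<Rightarrow> bool" for n where
  zero: "weighted n e (\<lambda>a b. 0)"
| const: "weighted n 0 (\<lambda>a b. z)"
| var1: "weighted n 1 (\<lambda>a b. a)"
| var2: "weighted n (int n + 2) (\<lambda>a b. b)"
| inv: "weighted n (- (int n + 2)) (\<lambda>a b. 1 / (a ^ (n + 2) - b))"
| add: "weighted n e f \<Longrightarrow> weighted n e g \<Longrightarrow> weighted n e (\<lambda>a b. f a b + g a b)"
| mult: "weighted n e f \<Longrightarrow> weighted n e' g \<Longrightarrow> weighted n (e + e') (\<lambda>a b. f a b * g a b)"

lemma weighted_eq:
  assumes "weighted n e f" "e = e'" "\<And>a b. f a b = g a b" shows "weighted n e' g"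
proof -
  have "f = g" using assms(3) by (intro ext)
  then show ?thesis using assms by simp
qed

lemma weighted_cmult:
  assumes "weighted n e f" shows "weighted n e (\<lambda>a b. z * f a b)"
  using weighted.mult[OF weighted.const assms, of z] by simp

lemma weighted_diff:
  assumes "weighted n e f" "weighted n e g" shows "weighted n e (\<lambda>a b. f a b - g a b)"
  using weighted.add[OF assms(1) weighted_cmult[OF assms(2), of "- 1"]] by simp

lemma weighted_sum:
  assumes "finite A" "\<And>x. x \<in> A \<Longrightarrow> weighted n e (f x)"
  shows "weighted n e (\<lambda>a b. \<Sum>x\<in>A. f x a b)"
  using assms by (induction A) (simp_all add: weighted.zero weighted.add)

lemma weighted_power_var1: "weighted n (int k) (\<lambda>a b. a ^ k)"
proof (induction k)
  case (Suc k)
  show ?case using weighted.mult[OF weighted.var1 Suc] by (simp add: add.commute)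
qed (use weighted.const[of n 1] in simp)

text \<open>Weights of \<Omega> are to be read off its differential equation without solving it. For
  this the derivative along t_1 is produced together with its weight, one less than before, by
  recursion on how the function is built.\<close>

lemma weighted_deriv:
  assumes "weighted n e f"
  shows "\<exists>f'. weighted n (e - 1) f' \<and>
    (\<forall>a b. b * (a ^ (n + 2) - b) \<noteq> 0 \<longrightarrow> ((\<lambda>z. f z b) has_field_derivative f' a b) (at a))"
  using assms
proof induction
  case (zero e)
  show ?case by (intro exI[of _ "\<lambda>a b. 0"]) (auto intro: weighted.zero)
next
  case (const z)
  show ?case by (intro exI[of _ "\<lambda>a b. 0"]) (auto intro: weighted.zero)
next
  case var1
  show ?case using weighted.const[of n 1] by (intro exI[of _ "\<lambda>a b. 1"]) auto
next
  case var2
  show ?case by (intro exI[of _ "\<lambda>a b. 0"]) (auto intro: weighted.zero)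
next
  case inv
  let ?i = "\<lambda>a b :: complex. 1 / (a ^ (n + 2) - b)"
  let ?f' = "\<lambda>a b. - of_nat (n + 2) * (a ^ (n + 1) * (?i a b * ?i a b))"
  have "weighted n (int (n + 1) + (- (int n + 2) + - (int n + 2))) (\<lambda>a b. a ^ (n + 1) * (?i a b * ?i a b))"
    by (intro weighted.mult weighted_power_var1 weighted.inv)
  moreover have "int (n + 1) + (- (int n + 2) + - (int n + 2)) = - (int n + 2) - 1" by simp
  ultimately have "weighted n (- (int n + 2) - 1) ?f'" by (intro weighted_cmult) (simp only:)
  moreover have "((\<lambda>z. ?i z b) has_field_derivative ?f' a b) (at a)"
    if "b * (a ^ (n + 2) - b) \<noteq> 0" for a b
  proof -
    have nz: "a ^ (n + 2) - b \<noteq> 0" using that by auto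
    have "((\<lambda>z. z ^ (n + 2) - b) has_field_derivative of_nat (n + 2) * a ^ (n + 1)) (at a)"
      by (rule DERIV_cong[OF DERIV_diff[OF DERIV_power[OF DERIV_ident, where n = "n + 2"] DERIV_const]]) simp
    from DERIV_inverse'[OF this nz]
    have "((\<lambda>z. inverse (z ^ (n + 2) - b)) has_field_derivative
       - (inverse (a ^ (n + 2) - b) * (of_nat (n + 2) * a ^ (n + 1)) * inverse (a ^ (n + 2) - b))) (at a)" .
    then show ?thesis unfolding inverse_eq_divide
      by (rule DERIV_cong) (simp only: mult_ac mult_minus_left mult_minus_right)
  qed
  ultimately show ?case by (intro exI[of _ ?f']) blast
next
  case (add e f g)
  then obtain f' g' where "weighted n (e - 1) f'" "weighted n (e - 1) g'"
    and "\<forall>a b. b * (a ^ (n + 2) - b) \<noteq> 0 \<longrightarrow> ((\<lambda>z. f z b) has_field_derivative f' a b) (at a)"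
    and "\<forall>a b. b * (a ^ (n + 2) - b) \<noteq> 0 \<longrightarrow> ((\<lambda>z. g z b) has_field_derivative g' a b) (at a)"
    by blast
  then show ?case
    by (intro exI[of _ "\<lambda>a b. f' a b + g' a b"]) (auto intro!: weighted.add DERIV_add)
next
  case (mult e f e' g)
  then obtain f' g' where w: "weighted n (e - 1) f'" "weighted n (e' - 1) g'"
    and d: "\<forall>a b. b * (a ^ (n + 2) - b) \<noteq> 0 \<longrightarrow> ((\<lambda>z. f z b) has_field_derivative f' a b) (at a)"
      "\<forall>a b. b * (a ^ (n + 2) - b) \<noteq> 0 \<longrightarrow> ((\<lambda>z. g z b) has_field_derivative g' a b) (at a)"
    by blast
  have "weighted n (e - 1 + e') (\<lambda>a b. f' a b * g a b)" "weighted n (e' - 1 + e) (\<lambda>a b. g' a b * f a b)"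
    using w mult.hyps by (auto intro: weighted.mult)
  then have "weighted n (e + e' - 1) (\<lambda>a b. f' a b * g a b + g' a b * f a b)"
    by (intro weighted.add) (simp_all add: algebra_simps)
  then show ?case using d
    by (intro exI[of _ "\<lambda>a b. f' a b * g a b + g' a b * f a b"]) (auto intro!: DERIV_mult)
qed

section \<open>Antidiagonal shape of \<Phi> and \<Omega>\<close>

locale dwork =
  fixes n :: nat and c :: complex and \<Omega> :: "complex \<Rightarrow> complex \<Rightarrow> complex mat"
  assumes n1: "n \<ge> 1" and c0: "c \<noteq> 0" and inter: "intersection_matrix n c \<Omega>"
begin

definition m :: nat where "m = (n + 1) div 2"

text \<open>This is the number 1 + \<delta> of the theorem. It is also the weight of t_1, since for
  n = 2 the variables t_1 and t_{n+2} carry twice their usual weights 1 and n + 2.\<close>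

definition q :: nat where "q = (if n = 2 then 2 else 1)"

text \<open>The weight of the entry \<open>s\<^sub>i\<^sub>j\<close> is \<open>hw i + q j\<close>, and that of \<open>t\<^sub>1\<close> is \<open>q\<close>.\<close>

definition hw :: "nat \<Rightarrow> int" where
  "hw i = (if i = 1 then - int q else if i = n + 1 then int q
     else if i = 2 then 2 - int q else if i = n then int q - 2 else 0)"

text \<open>Used for the weights of the equations in S \<Omega> S^tr = \<Phi>: the entry (i, k) is
  expected to have weight \<open>hw i + hw k\<close>, and the nonzero entries of \<Phi> are
  constants.\<close>

lemma hw_dual:
  assumes "1 \<le> i" "i \<le> n + 1" shows "hw (n + 2 - i) = - hw i"
proof -
  consider "i = 1" | "i = n + 1" "n \<noteq> 0" | "i = 2" "n \<ge> 2" | "i = n" "n \<ge> 3" | "3 \<le> i" "i < n"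
    using assms n1 by linarith
  then show ?thesis
  proof cases
    case 3
    then show ?thesis unfolding hw_def q_def by (cases "n = 2") simp_all
  next
    case 5
    then have "n + 2 - i \<notin> {1, 2, n, n + 1}" "i \<notin> {1, 2, n, n + 1}" by auto
    then show ?thesis unfolding hw_def by simp
  qed (use assms n1 in \<open>simp_all add: hw_def q_def\<close>)
qed

definition eps :: "nat \<Rightarrow> complex" where
  "eps i = (if odd n \<and> i > m then - 1 else 1)"

lemma eps_nz: "eps i \<noteq> 0" by (simp add: eps_def)

definition ph :: "nat \<Rightarrow> nat \<Rightarrow> complex" where
  "ph i k = (if i + k = n + 2 then eps i else 0)"

lemma Phi_carrier: "Phi n \<in> carrier_mat (n + 1) (n + 1)"
proof (cases "odd n")
  case True
  then have "(n + 1) div 2 + (n + 1) div 2 = n + 1" by presburger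
  then show ?thesis using True unfolding Phi_def Let_def antidiag_def
    by (metis four_block_carrier_mat mat1_carrier uminus_carrier_mat zero_carrier_mat)
qed (simp add: Phi_def antidiag_def)

lemma entry_Phi:
  assumes "1 \<le> i" "i \<le> n + 1" "1 \<le> k" "k \<le> n + 1"
  shows "entry (Phi n) i k = ph i k"
proof (cases "odd n")
  case True
  then have m2: "m + m = n + 1" unfolding m_def by presburger
  have "entry (Phi n) i k
      = four_block_mat (0\<^sub>m m m) (antidiag m) (- antidiag m) (0\<^sub>m m m) $$ (i - 1, k - 1)"
    using True by (simp add: entry_def Phi_def m_def)
  also have "\<dots> = ph i k"
  proof -
    have c: "antidiag m \<in> carrier_mat m m" by (simp add: antidiag_def)
    have ad: "antidiag m $$ (r, s) = (if r + s + 1 = m then 1 else 0)" if "r < m" "s < m" for r s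
      using that by (simp add: antidiag_def mat1_def)
    have bl: "i - 1 < m + m" "k - 1 < m + m" using assms m2 by simp_all
    consider "i \<le> m" "k \<le> m" | "i \<le> m" "k > m" | "i > m" "k \<le> m" | "i > m" "k > m" by linarith
    then show ?thesis
    proof cases
      case 2
      have lt: "i - 1 < m" "\<not> k - 1 < m" "k - 1 - m < m" using 2 assms m2 by linarith+
      have "i - 1 + (k - 1 - m) + 1 = m \<longleftrightarrow> i + k = n + 2" using 2 assms m2 by linarith
      then have "antidiag m $$ (i - 1, k - 1 - m) = ph i k"
        unfolding ad[OF lt(1,3)] using 2 by (simp only: ph_def eps_def) simp
      then show ?thesis using c bl lt by (subst index_mat_four_block) auto
    next
      case 3
      have lt: "\<not> i - 1 < m" "k - 1 < m" "i - 1 - m < m" using 3 assms m2 by linarith+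
      have "i - 1 - m + (k - 1) + 1 = m \<longleftrightarrow> i + k = n + 2" using 3 assms m2 by linarith
      then have "- antidiag m $$ (i - 1 - m, k - 1) = ph i k"
        unfolding ad[OF lt(3,2)] using 3 True by (simp only: ph_def eps_def) simp
      then show ?thesis using c bl lt by (subst index_mat_four_block) auto
    qed (use assms m2 c bl in \<open>auto simp: ph_def\<close>)
  qed
  finally show ?thesis .
next
  case False
  then show ?thesis using assms by (simp add: Phi_def antidiag_def entry_mat1 ph_def eps_def)
qed

lemma congruence_Phi_iff:
  assumes S: "S \<in> carrier_mat (n + 1) (n + 1)" and Q: "Q \<in> carrier_mat (n + 1) (n + 1)"
  shows "S * Q * transpose_mat S = Phi n \<longleftrightarrow> (\<forall>i\<in>{1..n+1}. \<forall>k\<in>{1..n+1}.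
    (\<Sum>j = 1..n+1. \<Sum>l = 1..n+1. entry S i j * entry Q j l * entry S k l) = ph i k)"
proof -
  have SQ: "S * Q \<in> carrier_mat (n + 1) (n + 1)" and St: "transpose_mat S \<in> carrier_mat (n + 1) (n + 1)"
    using S Q by auto
  have e: "entry (S * Q * transpose_mat S) i k
      = (\<Sum>j = 1..n+1. \<Sum>l = 1..n+1. entry S i j * entry Q j l * entry S k l)"
    if ik: "1 \<le> i" "i \<le> n + 1" "1 \<le> k" "k \<le> n + 1" for i k
  proof -
    have "entry (S * Q * transpose_mat S) i k
        = (\<Sum>l = 1..n+1. \<Sum>j = 1..n+1. entry S i j * entry Q j l * entry S k l)"
      unfolding entry_mult[OF SQ St ik]
    proof (intro sum.cong refl)
      fix l assume "l \<in> {1..n+1}"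
      then have l: "1 \<le> l" "l \<le> n + 1" by auto
      show "entry (S * Q) i l * entry (transpose_mat S) l k
          = (\<Sum>j = 1..n+1. entry S i j * entry Q j l * entry S k l)"
        unfolding entry_mult[OF S Q ik(1,2) l] entry_transpose[OF S l ik(3,4)] sum_distrib_right ..
    qed
    also have "\<dots> = (\<Sum>j = 1..n+1. \<Sum>l = 1..n+1. entry S i j * entry Q j l * entry S k l)"
      by (rule sum.swap)
    finally show ?thesis .
  qed
  show ?thesis
  proof
    assume eq: "S * Q * transpose_mat S = Phi n"
    show "\<forall>i\<in>{1..n+1}. \<forall>k\<in>{1..n+1}.
        (\<Sum>j = 1..n+1. \<Sum>l = 1..n+1. entry S i j * entry Q j l * entry S k l) = ph i k"
    proof (intro ballI)
      fix i k assume "i \<in> {1..n+1}" "k \<in> {1..n+1}"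
      then have ik: "1 \<le> i" "i \<le> n + 1" "1 \<le> k" "k \<le> n + 1" by auto
      show "(\<Sum>j = 1..n+1. \<Sum>l = 1..n+1. entry S i j * entry Q j l * entry S k l) = ph i k"
        unfolding e[OF ik, symmetric] eq by (rule entry_Phi[OF ik])
    qed
  next
    assume "\<forall>i\<in>{1..n+1}. \<forall>k\<in>{1..n+1}.
        (\<Sum>j = 1..n+1. \<Sum>l = 1..n+1. entry S i j * entry Q j l * entry S k l) = ph i k"
    then show "S * Q * transpose_mat S = Phi n"
      using SQ St by (intro eq_mat_entryI[OF _ Phi_carrier]) (auto simp: e entry_Phi simp del: sum.cl_ivl_Suc)
  qed
qed

definition nondeg :: "complex \<Rightarrow> complex \<Rightarrow> bool" where
  "nondeg a b \<longleftrightarrow> b * (a ^ (n + 2) - b) \<noteq> 0"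

definition om :: "nat \<Rightarrow> nat \<Rightarrow> complex \<Rightarrow> complex \<Rightarrow> complex" where
  "om i j a b = entry (\<Omega> a b) i j"

definition disc_const :: complex where "disc_const = (- of_nat (n + 2)) ^ n * c"

lemma disc_const_nz: "disc_const \<noteq> 0"
  using c0 unfolding disc_const_def by (simp only: mult_eq_0_iff power_eq_0_iff neg_equal_0_iff_equal of_nat_eq_0_iff) simp

context
  fixes a b assumes nd: "nondeg a b"
begin

lemma om_carrier: "\<Omega> a b \<in> carrier_mat (n + 1) (n + 1)"
  and om_zero: "\<lbrakk>1 \<le> i; 1 \<le> j; i + j \<le> n + 1\<rbrakk> \<Longrightarrow> om i j a b = 0"
  and om_antidiag: "\<lbrakk>1 \<le> j; j \<le> n + 1\<rbrakk> \<Longrightarrow>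
    om j (n + 2 - j) a b = (- 1) ^ (j - 1) * (disc_const / (a ^ (n + 2) - b))"
proof -
  note * = inter[unfolded intersection_matrix_def, rule_format, OF nd[unfolded nondeg_def]]
  show "\<Omega> a b \<in> carrier_mat (n + 1) (n + 1)" using * by blast
  show "om i j a b = 0" if "1 \<le> i" "1 \<le> j" "i + j \<le> n + 1"
    using * that unfolding om_def by simp
  show "om j (n + 2 - j) a b = (- 1) ^ (j - 1) * (disc_const / (a ^ (n + 2) - b))" if "1 \<le> j" "j \<le> n + 1"
    using * that unfolding om_def disc_const_def by simp
qed

lemma om_antidiag_nz:
  assumes "1 \<le> j" "j \<le> n + 1" shows "om j (n + 2 - j) a b \<noteq> 0"
  using om_antidiag[OF assms] disc_const_nz nd by (simp add: nondeg_def)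

lemma om_sym:
  assumes "1 \<le> i" "i \<le> n + 1" "1 \<le> j" "j \<le> n + 1"
  shows "om j i a b = (- 1) ^ n * om i j a b"
proof -
  have "transpose_mat (\<Omega> a b) = (- 1) ^ n \<cdot>\<^sub>m \<Omega> a b"
    using inter[unfolded intersection_matrix_def, rule_format, OF nd[unfolded nondeg_def]] by blast
  then have "entry (transpose_mat (\<Omega> a b)) i j = entry ((- 1) ^ n \<cdot>\<^sub>m \<Omega> a b) i j" by simp
  then show ?thesis
    unfolding om_def entry_transpose[OF om_carrier assms] entry_smult[OF om_carrier assms] .
qed

lemma om_derivs:
  assumes "1 \<le> i" "i \<le> n + 1" "1 \<le> j" "j \<le> n + 1"
  shows "((\<lambda>z. om i j z b) has_field_derivative
      (\<Sum>k = 1..n+1. entry (B1 n a b) i k * om k j a b + om i k a b * entry (B1 n a b) j k)) (at a)"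
    and "((\<lambda>z. om i j a z) has_field_derivative
      (\<Sum>k = 1..n+1. entry (B2 n a b) i k * om k j a b + om i k a b * entry (B2 n a b) j k)) (at b)"
proof -
  have *: "entry (B * \<Omega> a b + \<Omega> a b * transpose_mat B) i j
      = (\<Sum>k = 1..n+1. entry B i k * om k j a b + om i k a b * entry B j k)"
    if "B \<in> carrier_mat (n + 1) (n + 1)" for B
  proof -
    have t: "transpose_mat B \<in> carrier_mat (n + 1) (n + 1)" using that by simp
    have p: "\<Omega> a b * transpose_mat B \<in> carrier_mat (n + 1) (n + 1)" using that om_carrier by simp
    show ?thesis
      unfolding entry_add[OF p assms] entry_mult[OF that om_carrier assms] entry_mult[OF om_carrier t assms]
      using assms by (simp add: om_def sum.distrib entry_transpose[OF that] del: sum.cl_ivl_Suc)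
  qed
  have "B1 n a b \<in> carrier_mat (n + 1) (n + 1)" "B2 n a b \<in> carrier_mat (n + 1) (n + 1)"
    by (simp_all add: B1_def B2_def)
  note B = *[OF this(1)] *[OF this(2)]
  from inter[unfolded intersection_matrix_def, rule_format, OF nd[unfolded nondeg_def]]
  have "((\<lambda>z. entry (\<Omega> z b) i j) has_field_derivative
           entry (B1 n a b * \<Omega> a b + \<Omega> a b * transpose_mat (B1 n a b)) i j) (at a) \<and>
        ((\<lambda>z. entry (\<Omega> a z) i j) has_field_derivative
           entry (B2 n a b * \<Omega> a b + \<Omega> a b * transpose_mat (B2 n a b)) i j) (at b)"
    using assms by simp
  then show "((\<lambda>z. om i j z b) has_field_derivative
      (\<Sum>k = 1..n+1. entry (B1 n a b) i k * om k j a b + om i k a b * entry (B1 n a b) j k)) (at a)"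
    "((\<lambda>z. om i j a z) has_field_derivative
      (\<Sum>k = 1..n+1. entry (B2 n a b) i k * om k j a b + om i k a b * entry (B2 n a b) j k)) (at b)"
    unfolding om_def B by blast+
qed

end

lemma eventually_nondeg_1: "nondeg a b \<Longrightarrow> eventually (\<lambda>z. nondeg z b) (nhds a)"
proof -
  assume "nondeg a b"
  moreover have "open {z. nondeg z b}"
    unfolding nondeg_def by (intro open_Collect_neq continuous_intros)
  ultimately show ?thesis by (auto simp: eventually_nhds)
qed

definition ctail :: "nat \<Rightarrow> complex \<Rightarrow> complex \<Rightarrow> complex" where
  "ctail j a b = - of_nat (Stirling (n + 2) j) * a ^ j / (a ^ (n + 2) - b)"

lemma weighted_ctail: "weighted n (int j - (int n + 2)) (ctail j)"
proof -
  have "weighted n (int j + - (int n + 2)) (\<lambda>a b. a ^ j * (1 / (a ^ (n + 2) - b)))"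
    by (intro weighted.mult weighted_power_var1 weighted.inv)
  from weighted_cmult[OF this, of "- of_nat (Stirling (n + 2) j)"]
  show ?thesis by (rule weighted_eq) (simp_all add: ctail_def)
qed

lemma entry_B1:
  assumes "1 \<le> i" "i \<le> n + 1" "1 \<le> j" "j \<le> n + 1"
  shows "entry (B1 n a b) i j = (if i \<le> n then (if j = i + 1 then 1 else 0) else ctail j a b)"
  using assms by (simp add: B1_def entry_mat1 ctail_def)

text \<open>This is the homogeneity of B: its contraction with the Euler field t_1 \<partial>_1 + (n
  + 2) t_{n+2} \<partial>_{n+2} is -diag(1, ..., n + 1). Hence the companion matrix
  \<open>B1\<close> carries all further information.\<close>

lemma entry_B2:
  assumes "1 \<le> i" "i \<le> n + 1" "1 \<le> j" "j \<le> n + 1" "nondeg a b"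
  shows "of_nat (n + 2) * b * entry (B2 n a b) i j = - of_nat i * of_bool (j = i)
    - a * entry (B1 n a b) i j"
proof -
  define K where "K = (of_nat (n + 2) :: complex)"
  define D where "D = a ^ (n + 2) - b"
  have nz: "K \<noteq> 0" "b \<noteq> 0" "D \<noteq> 0"
    using assms(5) unfolding nondeg_def D_def K_def by (auto simp flip: of_nat_Suc)
  have B2: "entry (B2 n a b) i j = (if i \<le> n then
       (if j = i then - of_nat i / (K * b) else if j = i + 1 then - a / (K * b) else 0)
     else if j \<le> n then of_nat (Stirling (n + 2) j) * a ^ (j + 1) / (K * b * D)
     else (of_nat (n * (n + 1)) / 2 * a ^ (n + 2) + of_nat (n + 1) * b) / (K * b * D))"
    unfolding B2_def entry_mat1[OF assms(1-4)] K_def D_def by simp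
  have B1: "entry (B1 n a b) i j = (if i \<le> n then (if j = i + 1 then 1 else 0)
      else - of_nat (Stirling (n + 2) j) * a ^ j / D)"
    unfolding entry_B1[OF assms(1-4)] ctail_def D_def ..
  consider "i \<le> n" | "i = n + 1" "j \<le> n" | "i = n + 1" "j = n + 1" using assms by linarith
  then show ?thesis
  proof cases
    case 1
    then show ?thesis using nz unfolding B2 B1 K_def[symmetric] by auto
  next
    case 2
    then show ?thesis using nz unfolding B2 B1 K_def[symmetric] by auto
  next
    case 3
    \<comment> \<open>In the corner the numerator of \<open>B2\<close> is not written with a
      Stirling number; the value S_2(n + 2, n + 1) = (n + 1)(n + 2) / 2 restores the pattern of the
      last row.\<close>
    have "2 * Stirling (Suc k) k = k * (k + 1)" for k
      by (induction k) (auto simp: algebra_simps)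
    from this[of "n + 1"] have "2 * Stirling (n + 2) (n + 1) = (n + 1) * (n + 2)" by simp
    then have "of_nat (2 * Stirling (n + 2) (n + 1)) = (of_nat ((n + 1) * (n + 2)) :: complex)"
      by (simp only:)
    then have St: "of_nat (Stirling (n + 2) (n + 1)) = (of_nat ((n + 1) * (n + 2)) / 2 :: complex)"
      by (metis nonzero_mult_div_cancel_left of_nat_mult of_nat_numeral zero_neq_numeral)
    define e where "e = (of_nat n :: complex)"
    have e: "of_nat ((n + 1) * (n + 2)) = (e + 1) * (e + 2)" "of_nat (n * (n + 1)) = e * (e + 1)"
      "of_nat (n + 1) = e + 1"
      unfolding e_def by (simp_all add: algebra_simps)
    define Z where "Z = (e + 1) * (e + 2) / 2"
    define x where "x = a ^ (n + 1)"
    have x: "a ^ (n + 2) = a * x" by (simp add: x_def)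
    have "K * b * entry (B2 n a b) i j = (e * (e + 1) / 2 * (a * x) + (e + 1) * b) / D"
      using 3 nz unfolding B2 e x by simp
    also have "e * (e + 1) / 2 * (a * x) + (e + 1) * b = - (e + 1) * D + a * (Z * x)"
      unfolding D_def x Z_def by (simp add: field_simps)
    also have "(- (e + 1) * D + a * (Z * x)) / D = - (e + 1) - a * (- Z * x / D)"
      using nz by (simp add: add_divide_distrib diff_divide_distrib)
    also have "- Z * x / D = entry (B1 n a b) i j"
      using 3 unfolding B1 by (simp only: St e x_def Z_def) simp
    finally have "K * b * entry (B2 n a b) i j = - (e + 1) - a * entry (B1 n a b) i j" .
    then show ?thesis using 3 by (simp add: K_def e_def)
  qed
qed

text \<open>The derivative along \<open>t\<^sub>1\<close> expresses each column of \<open>\<Omega>\<close> through the preceding one.\<close>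

lemma om_weighted:
  assumes "1 \<le> j" "j \<le> n + 1"
  shows "\<forall>i\<in>{1..n+1}. \<exists>f. weighted n (- int (i + j)) f \<and> (\<forall>a b. nondeg a b \<longrightarrow> om i j a b = f a b)"
  using assms
proof (induction j rule: dec_induct)
  case base
  show ?case
  proof
    fix i assume i: "i \<in> {1..n+1}"
    show "\<exists>f. weighted n (- int (i + 1)) f \<and> (\<forall>a b. nondeg a b \<longrightarrow> om i 1 a b = f a b)"
    proof (cases "i = n + 1")
      case True
      have "weighted n (- int (i + 1)) (\<lambda>a b. ((- 1) ^ n * disc_const) * (1 / (a ^ (n + 2) - b)))"
        using weighted_cmult[OF weighted.inv] True by (simp add: algebra_simps)
      then show ?thesis using om_antidiag[of _ _ "n + 1"] True by (intro exI conjI) auto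
    next
      case False
      then show ?thesis using i om_zero by (intro exI[of _ "\<lambda>_ _. 0"]) (auto intro: weighted.zero)
    qed
  qed
next
  case (step j)
  then have j: "1 \<le> j" "j \<le> n" by auto
  have "\<exists>F. \<forall>i\<in>{1..n+1}. weighted n (- int (i + j)) (F i) \<and> (\<forall>a b. nondeg a b \<longrightarrow> om i j a b = F i a b)"
    using step j by (intro bchoice) simp
  then obtain F where F: "\<And>i. 1 \<le> i \<Longrightarrow> i \<le> n + 1 \<Longrightarrow> weighted n (- int (i + j)) (F i)"
    and Feq: "\<And>i a b. 1 \<le> i \<Longrightarrow> i \<le> n + 1 \<Longrightarrow> nondeg a b \<Longrightarrow> om i j a b = F i a b"
    by (metis atLeastAtMost_iff)
  show ?case
  proof
    fix i assume "i \<in> {1..n+1}"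
    then have i: "1 \<le> i" "i \<le> n + 1" by auto
    from weighted_deriv[OF F[OF i]] obtain f' where f': "weighted n (- int (i + j) - 1) f'"
      and df: "\<And>a b. nondeg a b \<Longrightarrow> ((\<lambda>z. F i z b) has_field_derivative f' a b) (at a)"
      unfolding nondeg_def by blast
    \<comment> \<open>For j \<le> n row j of \<open>B1\<close> has its only nonzero entry, 1, in
      column j + 1. So \<Omega> B^tr contributes exactly the entry of the next column, for which the
      equation is solved.\<close>
    have d: "f' a b = (\<Sum>k = 1..n+1. entry (B1 n a b) i k * F k a b) + om i (j + 1) a b"
      if nd: "nondeg a b" for a b
    proof -
      have "eventually (\<lambda>z. om i j z b = F i z b) (nhds a)"
        using eventually_nondeg_1[OF nd] by eventually_elim (use Feq i in auto)
      from DERIV_cong_ev[OF refl this refl] df[OF nd]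
      have "((\<lambda>z. om i j z b) has_field_derivative f' a b) (at a)" by simp
      from DERIV_unique[OF this om_derivs(1)[OF nd i, of j]] j
      have "f' a b = (\<Sum>k = 1..n+1. entry (B1 n a b) i k * om k j a b)
          + (\<Sum>k = 1..n+1. om i k a b * entry (B1 n a b) j k)"
        by (simp add: sum.distrib del: sum.cl_ivl_Suc)
      moreover have "(\<Sum>k = 1..n+1. om i k a b * entry (B1 n a b) j k)
          = (\<Sum>k = 1..n+1. if k = j + 1 then om i (j + 1) a b else 0)"
        using j by (intro sum.cong refl) (auto simp: entry_B1)
      moreover have "\<dots> = om i (j + 1) a b" using j by (subst sum.delta) auto
      moreover have "(\<Sum>k = 1..n+1. entry (B1 n a b) i k * om k j a b)
          = (\<Sum>k = 1..n+1. entry (B1 n a b) i k * F k a b)"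
        using Feq nd by (intro sum.cong refl) auto
      ultimately show ?thesis by simp
    qed
    have w: "weighted n (- int (i + (j + 1))) (\<lambda>a b. \<Sum>k = 1..n+1. entry (B1 n a b) i k * F k a b)"
    proof (intro weighted_sum)
      fix k assume "k \<in> {1..n+1}"
      then have k: "1 \<le> k" "k \<le> n + 1" by auto
      consider "i \<le> n" "k = i + 1" | "i \<le> n" "k \<noteq> i + 1" | "i = n + 1" using i by linarith
      then show "weighted n (- int (i + (j + 1))) (\<lambda>a b. entry (B1 n a b) i k * F k a b)"
      proof cases
        case 1
        then show ?thesis using F[OF k] i k by (simp add: entry_B1 algebra_simps)
      next
        case 2
        then show ?thesis using i k by (simp add: entry_B1 weighted.zero)
      next
        case 3
        have "weighted n ((int k - (int n + 2)) + - int (k + j)) (\<lambda>a b. ctail k a b * F k a b)"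
          by (intro weighted.mult weighted_ctail F k)
        then show ?thesis using i k 3 by (simp add: entry_B1 algebra_simps)
      qed
    qed simp
    have "weighted n (- int (i + (j + 1))) f'" using f' by (rule weighted_eq) auto
    from weighted_diff[OF this w]
    have "weighted n (- int (i + Suc j)) (\<lambda>a b. f' a b - (\<Sum>k = 1..n+1. entry (B1 n a b) i k * F k a b))"
      by (rule weighted_eq) auto
    then show "\<exists>f. weighted n (- int (i + Suc j)) f \<and> (\<forall>a b. nondeg a b \<longrightarrow> om i (Suc j) a b = f a b)"
      using d
      by (intro exI[of _ "\<lambda>a b. f' a b - (\<Sum>k = 1..n+1. entry (B1 n a b) i k * F k a b)"] conjI allI impI) auto
  qed
qed

subsection \<open>Weights of the entries of S\<close>

abbreviation M :: "point set" where "M \<equiv> moduli n \<Omega>"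
abbreviation ext :: "func \<Rightarrow> func" where "ext \<equiv> on_moduli n \<Omega>"

definition aa :: "point \<Rightarrow> complex" where "aa p = fst p"
definition bb :: "point \<Rightarrow> complex" where "bb p = fst (snd p)"
text \<open>The value 0 outside the matrix lets the column j - 1 and the row i + 1 of later formulas
  run over the border without case distinctions.\<close>

definition ss :: "nat \<Rightarrow> nat \<Rightarrow> point \<Rightarrow> complex" where
  "ss i j p = (if 1 \<le> i \<and> i \<le> n + 1 \<and> 1 \<le> j \<and> j \<le> n + 1 then entry (snd (snd p)) i j else 0)"
definition ww :: "nat \<Rightarrow> nat \<Rightarrow> point \<Rightarrow> complex" where "ww i j p = om i j (aa p) (bb p)"

lemma ext_in [simp]: "p \<in> M \<Longrightarrow> ext f p = f p"
  and ext_out [simp]: "p \<notin> M \<Longrightarrow> ext f p = 0"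
  by (simp_all add: on_moduli_def)

lemma ext_cong: "(\<And>p. p \<in> M \<Longrightarrow> f p = g p) \<Longrightarrow> ext f = ext g"
  by (auto simp: on_moduli_def)

lemma cst_in [simp]: "p \<in> M \<Longrightarrow> cst n \<Omega> z p = z"
  and cst_out [simp]: "p \<notin> M \<Longrightarrow> cst n \<Omega> z p = 0"
  by (simp_all add: cst_def)

lemma ss_out: "\<not> (1 \<le> i \<and> i \<le> n + 1 \<and> 1 \<le> j \<and> j \<le> n + 1) \<Longrightarrow> ss i j p = 0"
  by (auto simp: ss_def)

context
  fixes p assumes p: "p \<in> M"
begin

lemma point_nondeg: "nondeg (aa p) (bb p)"
  using p by (auto simp: moduli_def aa_def bb_def nondeg_def)

lemma ss_upper: "i < j \<Longrightarrow> ss i j p = 0"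
proof -
  assume ij: "i < j"
  have c: "snd (snd p) \<in> carrier_mat (n + 1) (n + 1)" "upper_triangular (transpose_mat (snd (snd p)))"
    using p by (auto simp: moduli_def)
  show ?thesis
  proof (cases "1 \<le> i \<and> j \<le> n + 1")
    case True
    then have "transpose_mat (snd (snd p)) $$ (j - 1, i - 1) = 0"
      using c ij by (intro upper_triangularD) auto
    then have "snd (snd p) $$ (i - 1, j - 1) = 0"
      using True c(1) ij by (subst (asm) index_transpose_mat(1)) auto
    then show ?thesis by (simp add: ss_def entry_def)
  qed (auto simp: ss_def)
qed

lemma ss_11: "ss 1 1 p = 1"
  using p by (auto simp: moduli_def ss_def)

lemma quad:
  assumes "1 \<le> i" "i \<le> n + 1" "1 \<le> k" "k \<le> n + 1"
  shows "(\<Sum>j = 1..n+1. \<Sum>l = 1..n+1. ss i j p * ww j l p * ss k l p) = ph i k"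
proof -
  obtain a b S where pe: "p = (a, b, S)" by (cases p)
  have S: "S \<in> carrier_mat (n + 1) (n + 1)" and eq: "S * \<Omega> a b * transpose_mat S = Phi n"
    using p by (auto simp: moduli_def pe)
  have O: "\<Omega> a b \<in> carrier_mat (n + 1) (n + 1)"
    using om_carrier point_nondeg by (simp add: pe aa_def bb_def)
  have "ph i k = (\<Sum>j = 1..n+1. \<Sum>l = 1..n+1. entry S i j * entry (\<Omega> a b) j l * entry S k l)"
    using eq[unfolded congruence_Phi_iff[OF S O]] assms by simp
  also have "\<dots> = (\<Sum>j = 1..n+1. \<Sum>l = 1..n+1. ss i j p * ww j l p * ss k l p)"
    using assms by (intro sum.cong refl) (simp add: ss_def ww_def om_def pe aa_def bb_def)
  finally show ?thesis ..
qed

lemma ww_zero: "\<lbrakk>1 \<le> i; 1 \<le> j; i + j \<le> n + 1\<rbrakk> \<Longrightarrow> ww i j p = 0"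
  unfolding ww_def by (rule om_zero[OF point_nondeg])

lemma ww_antidiag_nz: "\<lbrakk>1 \<le> j; j \<le> n + 1\<rbrakk> \<Longrightarrow> ww j (n + 2 - j) p \<noteq> 0"
  unfolding ww_def by (rule om_antidiag_nz[OF point_nondeg])

lemma ww_antidiag: "\<lbrakk>1 \<le> j; j \<le> n + 1\<rbrakk> \<Longrightarrow>
    ww j (n + 2 - j) p = (- 1) ^ (j - 1) * (disc_const / (aa p ^ (n + 2) - bb p))"
  unfolding ww_def by (rule om_antidiag[OF point_nondeg])

lemma ww_sym: "\<lbrakk>1 \<le> i; i \<le> n + 1; 1 \<le> j; j \<le> n + 1\<rbrakk> \<Longrightarrow> ww j i p = (- 1) ^ n * ww i j p"
  unfolding ww_def by (rule om_sym[OF point_nondeg])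

text \<open>In the equation at (i, k), triangularity of S and vanishing of \<Omega> above its
  antidiagonal isolate the entry of row i in column n + 2 - k; the remaining terms take from the
  first factor only columns further right.\<close>

lemma row_eq:
  assumes "1 \<le> k" "k \<le> n + 1" "1 \<le> i" "i \<le> n + 1" "i + k \<ge> n + 2"
  shows "ss i (n + 2 - k) p * ww (n + 2 - k) k p * ss k k p
    + (\<Sum>j = n+2-k+1..i. \<Sum>l = 1..k. ss i j p * ww j l p * ss k l p) = ph i k"
  unfolding quad[OF assms(3,4,1,2), symmetric]
  by (rule anti_sum[symmetric, where f = "\<lambda>j. ss i j p" and g = "\<lambda>l. ss k l p"])
    (use assms in \<open>auto intro: ww_zero ss_upper\<close>)

text \<open>For even n the form is symmetric, so the two occurrences of the unknown are equal,
  whence the factor 2.\<close>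

lemma row_eq_diag:
  assumes "even n" "i \<le> n + 1" "i + i > n + 2"
  shows "2 * ss i (n + 2 - i) p * ww (n + 2 - i) i p * ss i i p
    + (\<Sum>j = n+2-i+1..i. \<Sum>l = n+2-i+1..i. ss i j p * ww j l p * ss i l p) = 0"
proof -
  have "ww i (n + 2 - i) p = ww (n + 2 - i) i p"
    using ww_sym[of "n + 2 - i" i] assms by simp
  moreover have "ph i i = 0" using assms by (simp add: ph_def)
  moreover have "(\<Sum>j = 1..n+1. \<Sum>l = 1..n+1. ss i j p * ww j l p * ss i l p) =
    ss i (n + 2 - i) p * ww (n + 2 - i) i p * ss i i p + ss i i p * ww i (n + 2 - i) p * ss i (n + 2 - i) p
      + (\<Sum>j = n+2-i+1..i. \<Sum>l = n+2-i+1..i. ss i j p * ww j l p * ss i l p)"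
    by (rule anti_sum_diag[where f = "\<lambda>j. ss i j p" and g = "\<lambda>l. ss i l p"])
      (use assms in \<open>auto intro: ww_zero ss_upper\<close>)
  moreover have "(\<Sum>j = 1..n+1. \<Sum>l = 1..n+1. ss i j p * ww j l p * ss i l p) = ph i i"
    by (rule quad) (use assms in auto)
  ultimately show ?thesis by (simp only:) (simp only: mult_ac mult_2 distrib_left)
qed

text \<open>For i + k = n + 2 the remaining sum of \<open>row_eq\<close> is empty. The relation ties
  the diagonal entries of S in pairs and shows that none of them vanishes.\<close>

lemma diag_rel:
  assumes "1 \<le> i" "i \<le> n + 1"
  shows "ss i i p * ww i (n + 2 - i) p * ss (n + 2 - i) (n + 2 - i) p = eps i"
  using row_eq[of "n + 2 - i" i] assms by (simp add: ph_def)

lemma ss_diag_nz: "\<lbrakk>1 \<le> i; i \<le> n + 1\<rbrakk> \<Longrightarrow> ss i i p \<noteq> 0"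
  using diag_rel[of i] eps_nz by force

end

text \<open>Cutting off outside the moduli space inside the predicate allows weights to be computed
  for plain pointwise formulas, divisions included.\<close>

definition Hm :: "int \<Rightarrow> func \<Rightarrow> bool" where "Hm e f \<longleftrightarrow> homogeneous n \<Omega> e (ext f)"

lemma ext_ext [simp]: "ext (ext f) = ext f"
  by (rule ext_cong) simp

lemma ext_add: "ext f + ext g = ext (\<lambda>p. f p + g p)"
  and ext_mult: "ext f * ext g = ext (\<lambda>p. f p * g p)"
  by (auto simp: on_moduli_def)

lemma Hm_eq: "Hm e f \<Longrightarrow> e = e' \<Longrightarrow> (\<And>p. p \<in> M \<Longrightarrow> f p = g p) \<Longrightarrow> Hm e' g"
  using ext_cong[of f g] by (simp add: Hm_def)

lemma Hm_zero: "Hm e (\<lambda>_. 0)"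
proof -
  have "ext (\<lambda>_. 0) = 0" by (auto simp: on_moduli_def)
  then show ?thesis by (simp add: Hm_def homogeneous.zero)
qed

lemma Hm_const: "Hm 0 (\<lambda>_. z)"
  using homogeneous.const[of n \<Omega> z] by (simp add: Hm_def cst_def)

lemma Hm_add: "Hm e f \<Longrightarrow> Hm e g \<Longrightarrow> Hm e (\<lambda>p. f p + g p)"
  unfolding Hm_def ext_add[symmetric] by (rule homogeneous.add)

lemma Hm_mult: "Hm e f \<Longrightarrow> Hm e' g \<Longrightarrow> Hm (e + e') (\<lambda>p. f p * g p)"
  unfolding Hm_def ext_mult[symmetric] by (rule homogeneous.mult)

lemma Hm_cmult: "Hm e f \<Longrightarrow> Hm e (\<lambda>p. z * f p)"
  using Hm_mult[OF Hm_const, of e f z] by simp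

lemma Hm_diff: "Hm e f \<Longrightarrow> Hm e g \<Longrightarrow> Hm e (\<lambda>p. f p - g p)"
  using Hm_add[OF _ Hm_cmult[of e g "- 1"], of f] by simp

lemma Hm_sum: "finite A \<Longrightarrow> (\<And>x. x \<in> A \<Longrightarrow> Hm e (f x)) \<Longrightarrow> Hm e (\<lambda>p. \<Sum>x\<in>A. f x p)"
  by (induction A rule: finite_induct) (simp_all add: Hm_zero Hm_add)

lemma Hm_prod: "finite A \<Longrightarrow> (\<And>x. x \<in> A \<Longrightarrow> Hm (e x) (f x)) \<Longrightarrow> Hm (\<Sum>x\<in>A. e x) (\<lambda>p. \<Prod>x\<in>A. f x p)"
  by (induction A rule: finite_induct) (simp_all add: Hm_const Hm_mult)

lemma Hm_power:
  assumes "Hm e f" shows "Hm (int k * e) (\<lambda>p. f p ^ k)"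
proof (induction k)
  case 0
  show ?case using Hm_const[of 1] by simp
next
  case (Suc k)
  have "int (Suc k) * e = e + int k * e" by (simp add: algebra_simps)
  then show ?case using Hm_mult[OF assms Suc] by simp
qed

lemma t_coord_in: "p \<in> M \<Longrightarrow> t_coord n \<Omega> j p = (if j = 1 then aa p else if j = n + 2 then bb p
    else entry (snd (snd p)) (fst (t_pos n j)) (snd (t_pos n j)))"
  by (cases p) (simp add: t_coord_def aa_def bb_def)

lemma free_range: "free n i j \<Longrightarrow> 1 \<le> j \<and> j \<le> i \<and> 2 \<le> i \<and> i \<le> n + 1"
proof -
  assume f: "free n i j"
  have "2 * ((n + 1) div 2) \<le> n + 1" by simp
  moreover have "1 \<le> j" "j \<le> i" "i + j \<le> 2 * ((n + 1) div 2) + 1" "i \<noteq> 1 \<or> j \<noteq> 1"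
    using f unfolding free_def by simp_all
  ultimately show ?thesis by linarith
qed

lemma free_iff: "free n i j \<longleftrightarrow> 1 \<le> j \<and> j \<le> i \<and> (i, j) \<noteq> (1, 1) \<and> i + j \<le> 2 * m + 1"
  by (simp add: free_def m_def)

lemma t_pos_free:
  assumes "t \<in> I_index n - {1, n + 2}" "t_pos n t = (i, j)" shows "free n i j"
proof -
  have "t_pos n t \<in> {(i, j). free n i j}"
    by (rule bij_betw_apply[OF bij_betw_t_pos[OF n1] assms(1)])
  then show ?thesis using assms(2) by simp
qed

lemma free_t_pos:
  assumes "free n i j" shows "\<exists>t \<in> I_index n - {1, n + 2}. t_pos n t = (i, j)"
proof -
  have "(i, j) \<in> t_pos n ` (I_index n - {1, n + 2})"
    using bij_betw_imp_surj_on[OF bij_betw_t_pos[OF n1]] assms by simp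
  then show ?thesis by (metis imageE)
qed

lemma t_coord_ss:
  assumes p: "p \<in> M" and t: "t \<in> I_index n - {1, n + 2}" "t_pos n t = (i, j)"
  shows "t_coord n \<Omega> t p = ss i j p"
proof -
  have "t_coord n \<Omega> t p = entry (snd (snd p)) i j"
    unfolding t_coord_in[OF p] t(2) using t(1) by simp
  then show ?thesis using free_range[OF t_pos_free[OF t]] unfolding ss_def by simp
qed

lemma Hm_coord: "j \<in> I_index n \<Longrightarrow> Hm (wt n j) (t_coord n \<Omega> j)"
  using homogeneous.coord[of j n \<Omega>] by (simp add: Hm_def t_coord_def)

lemma wt_1: "wt n 1 = int q" and wt_2: "wt n (n + 2) = int q * (int n + 2)"
  using n1 unfolding wt_def q_def by simp_all

lemma wt_t: "t \<in> I_index n - {1, n + 2} \<Longrightarrow> t_pos n t = (i, j) \<Longrightarrow> wt n t = hw i + int q * int j"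
proof -
  assume t: "t \<in> I_index n - {1, n + 2}" "t_pos n t = (i, j)"
  have fr: "free n i j" by (rule t_pos_free[OF t])
  note r = free_range[OF fr]
  consider "n = 1" | "n = 2" | "n \<ge> 3" using n1 by linarith
  then show ?thesis
  proof cases
    case 1
    then have "i = 2" "j = 1" using fr r by (auto simp: free_def)
    moreover have "t = 2" using t 1 by (auto simp: I_index_def d_index_def)
    ultimately show ?thesis unfolding wt_def hw_def q_def using 1 by simp
  next
    case 2
    then have "i = 2" "j = 1" using fr r by (auto simp: free_def)
    moreover have "t = 2" using t 2 by (auto simp: I_index_def)
    ultimately show ?thesis unfolding wt_def hw_def q_def using 2 by simp
  next
    case 3
    then show ?thesis using t r by (auto simp: wt_def hw_def q_def)
  qed
qed

lemma Hm_aa: "Hm (int q) aa"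
  by (rule Hm_eq[OF Hm_coord[OF I_index_cases(1)[OF n1]]]) (simp_all add: wt_1[simplified] t_coord_in)

lemma Hm_bb: "Hm (int q * (int n + 2)) bb"
  by (rule Hm_eq[OF Hm_coord[OF I_index_cases(2)[OF n1]]]) (use wt_2 in \<open>simp_all add: t_coord_in\<close>)

lemma Hm_free: "free n i j \<Longrightarrow> Hm (hw i + int q * int j) (ss i j)"
proof -
  assume "free n i j"
  then obtain t where t: "t \<in> I_index n - {1, n + 2}" "t_pos n t = (i, j)" using free_t_pos by blast
  then have "Hm (wt n t) (t_coord n \<Omega> t)" by (intro Hm_coord) simp
  then show ?thesis by (rule Hm_eq) (use t wt_t t_coord_ss in auto)
qed

definition dd :: "point \<Rightarrow> complex" where "dd p = aa p ^ (n + 2) - bb p"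

lemma dd_nz: "p \<in> M \<Longrightarrow> dd p \<noteq> 0" and bb_nz: "p \<in> M \<Longrightarrow> bb p \<noteq> 0"
  using point_nondeg by (auto simp: nondeg_def dd_def)

lemma Hm_dd: "Hm (int q * (int n + 2)) dd"
  using Hm_diff[OF Hm_eq[OF Hm_power[OF Hm_aa, of "n + 2"]] Hm_bb] by (simp add: dd_def[abs_def] algebra_simps)

definition pd :: "nat set \<Rightarrow> point \<Rightarrow> complex" where "pd A p = (\<Prod>j\<in>A. t_coord n \<Omega> j p)"

lemma finite_diag_index: "finite (diag_index n)"
  using I_index_cases(3)[OF n1] by (auto simp: diag_index_def)

lemma diag_index_pos: "t \<in> diag_index n \<Longrightarrow> \<exists>k. t_pos n t = (k, k) \<and> free n k k"
  using t_pos_free unfolding diag_index_def by (metis (mono_tags, lifting) mem_Collect_eq prod.collapse)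

lemma t_diag_nz: "t \<in> diag_index n \<Longrightarrow> p \<in> M \<Longrightarrow> t_coord n \<Omega> t p \<noteq> 0"
proof -
  assume t: "t \<in> diag_index n" and p: "p \<in> M"
  from diag_index_pos[OF t] obtain k where k: "t_pos n t = (k, k)" "free n k k" by blast
  then have "t_coord n \<Omega> t p = ss k k p" using t p by (intro t_coord_ss) (auto simp: diag_index_def)
  then show ?thesis using ss_diag_nz[OF p] free_range[OF k(2)] by simp
qed

lemma inv_disc_in: "p \<in> M \<Longrightarrow> inv_disc n \<Omega> p = - 1 / (bb p * dd p * pd (diag_index n) p)"
proof -
  assume p: "p \<in> M"
  then have "inv_disc n \<Omega> p = 1 / (bb p * (- dd p) * pd (diag_index n) p)"
    unfolding inv_disc_def by (simp add: t_coord_in dd_def pd_def)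
  also have "bb p * (- dd p) * pd (diag_index n) p = - (bb p * dd p * pd (diag_index n) p)" by simp
  also have "1 / - (bb p * dd p * pd (diag_index n) p) = - 1 / (bb p * dd p * pd (diag_index n) p)"
    by (metis minus_divide_left minus_divide_right)
  finally show ?thesis .
qed

lemma Hm_inv: "Hm (- (2 * (int q * (int n + 2)) + (\<Sum>j\<in>diag_index n. wt n j))) (\<lambda>p. 1 / (bb p * dd p * pd (diag_index n) p))"
proof -
  have "Hm (- (2 * (int q * (int n + 2)) + (\<Sum>j\<in>diag_index n. wt n j))) (inv_disc n \<Omega>)"
    using homogeneous.inv[of n \<Omega>] wt_2 by (simp add: Hm_def inv_disc_def)
  from Hm_cmult[OF this, of "- 1"] show ?thesis
    by (rule Hm_eq) (simp_all add: inv_disc_in)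
qed

lemma Hm_pd: "A \<subseteq> diag_index n \<Longrightarrow> Hm (\<Sum>j\<in>A. wt n j) (pd A)"
  unfolding pd_def[abs_def] using finite_subset[OF _ finite_diag_index, of A]
  by (intro Hm_prod Hm_coord) (auto simp: diag_index_def)

lemma pd_nz: "p \<in> M \<Longrightarrow> pd (diag_index n) p \<noteq> 0"
  using t_diag_nz finite_diag_index by (auto simp: pd_def)

lemma Hm_inv_dd: "Hm (- (int q * (int n + 2))) (\<lambda>p. 1 / dd p)"
  using Hm_mult[OF Hm_mult[OF Hm_inv Hm_bb] Hm_pd[OF order.refl]]
  by (rule Hm_eq) (auto simp: bb_nz pd_nz)

text \<open>The generator \<open>inv_disc\<close> inverts only the whole product; multiplication by
  all the other factors isolates the inverse of one diagonal coordinate.\<close>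

lemma Hm_inv_free: "free n k k \<Longrightarrow> Hm (- (hw k + int q * int k)) (\<lambda>p. 1 / ss k k p)"
proof -
  assume "free n k k"
  then obtain t where t: "t \<in> I_index n - {1, n + 2}" "t_pos n t = (k, k)" using free_t_pos by blast
  then have td: "t \<in> diag_index n" by (simp add: diag_index_def)
  let ?A = "diag_index n - {t}"
  have split: "pd (diag_index n) p = t_coord n \<Omega> t p * pd ?A p" for p
    unfolding pd_def using td finite_diag_index by (simp add: prod.remove)
  have wsplit: "(\<Sum>j\<in>diag_index n. wt n j) = wt n t + (\<Sum>j\<in>?A. wt n j)"
    using td finite_diag_index by (simp add: sum.remove)
  have "Hm (- (2 * (int q * (int n + 2)) + (\<Sum>j\<in>diag_index n. wt n j))
      + int q * (int n + 2) + int q * (int n + 2) + (\<Sum>j\<in>?A. wt n j))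
      (\<lambda>p. 1 / (bb p * dd p * pd (diag_index n) p) * bb p * dd p * pd ?A p)"
    by (intro Hm_mult Hm_inv Hm_bb Hm_dd Hm_pd) auto
  then show ?thesis
  proof (rule Hm_eq)
    fix p assume p: "p \<in> M"
    have "pd ?A p \<noteq> 0" using pd_nz[OF p] split[of p] by auto
    then show "1 / (bb p * dd p * pd (diag_index n) p) * bb p * dd p * pd ?A p = 1 / ss k k p"
      using bb_nz[OF p] dd_nz[OF p] t_coord_ss[OF p t] by (simp add: split)
  qed (simp add: wsplit wt_t[OF t])
qed

lemma Hm_weighted: "weighted n e f \<Longrightarrow> Hm (int q * e) (\<lambda>p. f (aa p) (bb p))"
proof (induction rule: weighted.induct)
  case (zero e)
  show ?case by (rule Hm_zero)
next
  case (const z)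
  show ?case using Hm_const[of z] by simp
next
  case var1
  show ?case using Hm_aa by simp
next
  case var2
  show ?case using Hm_bb by simp
next
  case inv
  show ?case by (rule Hm_eq[OF Hm_inv_dd]) (simp_all add: dd_def algebra_simps)
next
  case (add e f g)
  show ?case using add.IH by (rule Hm_add)
next
  case (mult e f e' g)
  show ?case using Hm_mult[OF mult.IH] by (simp add: distrib_left)
qed

lemma Hm_ww: "\<lbrakk>1 \<le> i; i \<le> n + 1; 1 \<le> j; j \<le> n + 1\<rbrakk> \<Longrightarrow> Hm (- (int q * int (i + j))) (ww i j)"
proof -
  assume ij: "1 \<le> i" "i \<le> n + 1" "1 \<le> j" "j \<le> n + 1"
  then obtain f where "weighted n (- int (i + j)) f" and f: "\<And>a b. nondeg a b \<Longrightarrow> om i j a b = f a b"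
    using om_weighted[of j] by (metis atLeastAtMost_iff)
  from Hm_weighted[OF this(1)] show ?thesis
    by (rule Hm_eq) (auto simp: ww_def f point_nondeg algebra_simps)
qed

text \<open>On its antidiagonal \<Omega> is a constant over \<open>dd\<close>, so the inverse is a
  constant multiple of the polynomial \<open>dd\<close>.\<close>

lemma Hm_inv_ww: "\<lbrakk>1 \<le> j; j \<le> n + 1\<rbrakk> \<Longrightarrow> Hm (int q * (int n + 2)) (\<lambda>p. 1 / ww j (n + 2 - j) p)"
proof -
  assume j: "1 \<le> j" "j \<le> n + 1"
  show ?thesis
    using Hm_cmult[OF Hm_dd, of "(- 1) ^ (j - 1) / disc_const"]
  proof (rule Hm_eq)
    fix p assume p: "p \<in> M"
    have "(- 1 :: complex) ^ (j - 1) * (- 1) ^ (j - 1) = 1" by (simp flip: power_add mult_2)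
    then have "(- 1 :: complex) ^ (j - 1) = 1 / (- 1) ^ (j - 1)" by (simp add: field_simps)
    then show "(- 1) ^ (j - 1) / disc_const * dd p = 1 / ww j (n + 2 - j) p"
      unfolding ww_antidiag[OF p j] dd_def by (metis divide_divide_eq_right mult.commute mult_1 times_divide_eq_left times_divide_eq_right)
  qed simp
qed

lemma m_odd: "odd n \<Longrightarrow> n + 1 = 2 * m" and m_even: "even n \<Longrightarrow> n = 2 * m"
  unfolding m_def by presburger+

lemma m_bounds: "n \<le> 2 * m" "2 * m \<le> n + 1" "1 \<le> m"
  using n1 m_odd m_even by (cases "even n"; force)+

lemma Hm_u:
  assumes "even n" shows "Hm (hw (m + 1) + int q * int (m + 1)) (ss (m + 1) (m + 1))"
proof -
  have m: "n = 2 * m" "m \<ge> 1" "(n + 2) div 2 = m + 1" using m_even m_bounds assms by auto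
  have "Hm (wt_u n) (u_coord n \<Omega>)"
    using homogeneous.root[OF assms, of \<Omega>] by (simp add: Hm_def u_coord_def)
  then show ?thesis
  proof (rule Hm_eq)
    show "wt_u n = hw (m + 1) + int q * int (m + 1)"
    proof (cases "n = 2")
      case True
      then have "m = 1" using m by simp
      then show ?thesis using True unfolding wt_u_def hw_def q_def by simp
    next
      case False
      then have "3 \<le> m + 1" "m + 1 < n" using m by auto
      then have "hw (m + 1) = 0" unfolding hw_def by simp
      then show ?thesis using False m unfolding wt_u_def q_def by simp
    qed
    show "u_coord n \<Omega> p = ss (m + 1) (m + 1) p" if "p \<in> M" for p
      using that m unfolding u_coord_def ss_def by (simp add: split_beta)
  qed
qed

lemma Hm_ss_diag_low:
  assumes "1 \<le> j" "j \<le> m \<or> even n \<and> j = m + 1"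
  shows "Hm (hw j + int q * int j) (ss j j)"
proof -
  consider "j = 1" | "j \<ge> 2" "j \<le> m" | "even n" "j = m + 1" using assms by linarith
  then show ?thesis
  proof cases
    case 1
    then show ?thesis using Hm_const[of 1] by (intro Hm_eq[OF Hm_const[of 1]]) (auto simp: ss_11[simplified] hw_def)
  next
    case 2
    then show ?thesis by (intro Hm_free) (auto simp: free_iff)
  qed (use Hm_u in simp)
qed

text \<open>In the lower half \<open>diag_rel\<close> turns the inverse into a product of the dual
  diagonal entry with an entry of \<Omega>; for even n the root u is its own dual. The diagonal
  factors of \<open>inv_disc\<close> serve the upper half.\<close>

lemma Hm_inv_diag:
  assumes "1 \<le> k" "k \<le> n + 1"
  shows "Hm (- (hw k + int q * int k)) (\<lambda>p. 1 / ss k k p)"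
proof -
  consider "k = 1" | "k \<ge> 2" "k \<le> m" | "k > m" using assms by linarith
  then show ?thesis
  proof cases
    case 1
    then show ?thesis by (intro Hm_eq[OF Hm_const[of 1]]) (auto simp: ss_11[simplified] hw_def)
  next
    case 2
    then show ?thesis by (intro Hm_inv_free) (auto simp: free_iff)
  next
    case 3
    define j where "j = n + 2 - k"
    have j: "1 \<le> j" "j \<le> n + 1" "k = n + 2 - j" using assms 3 by (auto simp: j_def)
    have "j \<le> m \<or> even n \<and> j = m + 1"
      using 3 j_def m_odd m_even by (cases "even n") auto
    then have "Hm (- (int q * int (k + j)) + (hw j + int q * int j)) (\<lambda>p. ww k j p * ss j j p)"
      using assms j by (intro Hm_mult Hm_ww Hm_ss_diag_low) auto
    from Hm_cmult[OF this, of "1 / eps k"] show ?thesis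
    proof (rule Hm_eq)
      show "- (int q * int (k + j)) + (hw j + int q * int j) = - (hw k + int q * int k)"
        using hw_dual[of k, folded j_def] assms by (simp add: algebra_simps)
      fix p assume p: "p \<in> M"
      from diag_rel[OF p assms] show "1 / eps k * (ww k j p * ss j j p) = 1 / ss k k p"
        using ss_diag_nz[OF p assms] eps_nz[of k] unfolding j_def[symmetric] by (simp add: field_simps)
    qed
  qed
qed

lemma Hm_ph: "\<lbrakk>1 \<le> i; i \<le> n + 1\<rbrakk> \<Longrightarrow> Hm (hw i + hw k) (\<lambda>_. ph i k)"
proof (cases "i + k = n + 2")
  case True
  assume "1 \<le> i" "i \<le> n + 1"
  then have "hw k = - hw i" using hw_dual[of i] True by (metis add_diff_cancel_left')
  then show ?thesis using Hm_const[of "ph i k"] by simp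
qed (simp add: ph_def Hm_zero)

text \<open>A dependent entry is solved from the equation of S \<Omega> S^tr = \<Phi> at (i, n + 2 -
  j). Its coefficient is an antidiagonal entry of \<Omega> times a diagonal entry of S, both with
  homogeneous inverse; the other entries in the equation lie in earlier rows or further right in the
  same row. Regularity of every entry of S is a by-product.\<close>

lemma Hm_ss: "Hm (hw i + int q * int j) (ss i j)"
proof (induction i arbitrary: j rule: less_induct)
  case (less i)
  note rows = less
  show ?case
  proof (induction "i - j" arbitrary: j rule: less_induct)
    case less
    have cols: "Hm (hw i + int q * int j') (ss i j')" if "j < j'" "j' \<le> i" for j'
      using less[of j'] that by simp
    consider "\<not> (1 \<le> j \<and> j \<le> i \<and> i \<le> n + 1)" | "1 \<le> j" "j \<le> i" "i \<le> n + 1" "i = j" "i \<le> m \<or> even n \<and> i = m + 1"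
      | "free n i j"
      | "1 \<le> j" "j \<le> i" "i \<le> n + 1" "i + j \<ge> 2 * m + 2" "\<not> (i = j \<and> even n \<and> i = m + 1)"
      unfolding free_iff by fastforce
    then show ?case
    proof cases
      case 1
      have "ss i j p = 0" if "p \<in> M" for p
        using 1 ss_upper[OF that, of i j] ss_out[of i j] by (cases "i < j") auto
      then show ?thesis by (intro Hm_eq[OF Hm_zero[of "hw i + int q * int j"]]) auto
    next
      case 2
      then show ?thesis using Hm_ss_diag_low[of i] by simp
    next
      case 3
      then show ?thesis by (rule Hm_free)
    next
      case 4
      define k where "k = n + 2 - j"
      have k: "1 \<le> k" "k \<le> n + 1" "j = n + 2 - k" "k \<le> i" "i + k \<ge> n + 2" "1 \<le> i" "j \<le> n + 1" "k + j = n + 2"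
        using 4 m_bounds by (auto simp: k_def)
      have w: "hw i + hw k + int q * (int n + 2) + - (hw k + int q * int k) = hw i + int q * int j"
      proof -
        have "int k + int j = int n + 2" using k(8) by linarith
        then show ?thesis by (simp flip: \<open>int k + int j = int n + 2\<close>) (simp add: algebra_simps)
      qed
      show ?thesis
      proof (cases "k = i")
        case False
        then have ki: "k < i" using k by simp
        have "Hm (hw i + hw k + int q * (int n + 2) + - (hw k + int q * int k))
          (\<lambda>p. (ph i k - (\<Sum>j' = j+1..i. \<Sum>l = 1..k. ss i j' p * ww j' l p * ss k l p))
             * (1 / ww j (n + 2 - j) p) * (1 / ss k k p))"
        proof (rule Hm_mult[OF Hm_mult[OF Hm_diff[OF Hm_ph Hm_sum[OF _ Hm_sum]] Hm_inv_ww] Hm_inv_diag])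
          fix j' l assume jl: "j' \<in> {j+1..i}" "l \<in> {1..k}"
          have "Hm ((hw i + int q * int j') + - (int q * int (j' + l)) + (hw k + int q * int l))
              (\<lambda>p. ss i j' p * ww j' l p * ss k l p)"
            using jl 4 k by (intro Hm_mult cols rows[OF ki] Hm_ww) auto
          then show "Hm (hw i + hw k) (\<lambda>p. ss i j' p * ww j' l p * ss k l p)"
            by (rule Hm_eq) (simp_all add: algebra_simps)
        qed (use 4 k in auto)
        then show ?thesis
        proof (rule Hm_eq)
          fix p assume p: "p \<in> M"
          have nz: "ww j k p \<noteq> 0" "ss k k p \<noteq> 0"
            using ww_antidiag_nz[OF p, of j] ss_diag_nz[OF p, of k] 4 k unfolding k_def by auto
          have "ss i j p * ww j k p * ss k k p
              + (\<Sum>j' = j+1..i. \<Sum>l = 1..k. ss i j' p * ww j' l p * ss k l p) = ph i k"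
            using row_eq[OF p k(1,2) k(6) _ k(5)] 4 unfolding k(3)[symmetric] by simp
          then have "ph i k - (\<Sum>j' = j+1..i. \<Sum>l = 1..k. ss i j' p * ww j' l p * ss k l p)
              = ss i j p * ww j k p * ss k k p" by (simp add: algebra_simps)
          then show "(ph i k - (\<Sum>j' = j+1..i. \<Sum>l = 1..k. ss i j' p * ww j' l p * ss k l p))
              * (1 / ww j (n + 2 - j) p) * (1 / ss k k p) = ss i j p"
            using nz unfolding k_def[symmetric] by simp
        qed (rule w)
      next
        case True
        \<comment> \<open>A diagonal equation serves for a dependent entry only when n is even,
          because for odd n the positions with i + j = n + 2 are free. The unknown then occurs
          twice, which accounts for the factor 1 / 2 below.\<close>
        have "2 * m + 2 \<le> n + 2" using 4 k True by linarith
        then have ev: "even n" using m_odd by (cases "even n") auto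
        have nm: "n = 2 * m" by (rule m_even[OF ev])
        have "i \<noteq> m + 1" using 4(5) ev k(8) True nm by auto
        then have ji: "j < i" "i + i > n + 2" using 4(2) k(8) True nm by linarith+
        have "Hm (hw i + hw k + int q * (int n + 2) + - (hw k + int q * int k))
          (\<lambda>p. (- (1 / 2)) * (\<Sum>j' = j+1..i. \<Sum>l = j+1..i. ss i j' p * ww j' l p * ss i l p)
             * (1 / ww j (n + 2 - j) p) * (1 / ss k k p))"
        proof (rule Hm_mult[OF Hm_mult[OF Hm_cmult[OF Hm_sum[OF _ Hm_sum]] Hm_inv_ww] Hm_inv_diag])
          fix j' l assume jl: "j' \<in> {j+1..i}" "l \<in> {j+1..i}"
          have "Hm ((hw i + int q * int j') + - (int q * int (j' + l)) + (hw i + int q * int l))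
              (\<lambda>p. ss i j' p * ww j' l p * ss i l p)"
            using jl 4 k by (intro Hm_mult cols Hm_ww) auto
          then show "Hm (hw i + hw k) (\<lambda>p. ss i j' p * ww j' l p * ss i l p)"
            by (rule Hm_eq) (simp_all add: True algebra_simps)
        qed (use 4 k in auto)
        then show ?thesis
        proof (rule Hm_eq)
          fix p assume p: "p \<in> M"
          have nz: "ww j k p \<noteq> 0" "ss k k p \<noteq> 0"
            using ww_antidiag_nz[OF p, of j] ss_diag_nz[OF p, of k] 4 k unfolding k_def by auto
          have "2 * ss i j p * ww j i p * ss i i p
              + (\<Sum>j' = j+1..i. \<Sum>l = j+1..i. ss i j' p * ww j' l p * ss i l p) = 0"
            using row_eq_diag[OF p ev _ ji(2)] 4 True unfolding k(3) by simp
          then have sm: "(\<Sum>j' = j+1..i. \<Sum>l = j+1..i. ss i j' p * ww j' l p * ss i l p)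
              = - (2 * ss i j p * ww j i p * ss i i p)" by (simp only: add_eq_0_iff)
          show "(- (1 / 2)) * (\<Sum>j' = j+1..i. \<Sum>l = j+1..i. ss i j' p * ww j' l p * ss i l p)
              * (1 / ww j (n + 2 - j) p) * (1 / ss k k p) = ss i j p"
            using nz unfolding sm k_def[symmetric] True by simp
        qed (rule w)
      qed
    qed
  qed
qed

text \<open>The entries of \<open>S\<close> that are not coordinates are solved for row by row, each row from the
  diagonal to the left: for \<open>k = n + 2 - j\<close> the entry \<open>(i, k)\<close> of \<open>S \<Omega> S\<^sup>t\<^sup>r = \<Phi>\<close> is linear in \<open>s\<^sub>i\<^sub>j\<close>,
  given the entries above and to the right. For even \<open>n\<close>, \<open>F (m + 1) (m + 1)\<close> is the root \<open>u\<close>.\<close>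

context
  fixes a b :: complex and F :: "nat \<Rightarrow> nat \<Rightarrow> complex"
begin

function fill :: "nat \<Rightarrow> nat \<Rightarrow> complex" where
  "fill i j = (if j < 1 \<or> j > i \<or> i > n + 1 then 0 else if i = 1 then 1
     else if i + j \<le> 2 * m + 1 \<or> (i = j \<and> i + j = n + 2) then F i j
     else if n + 2 - j < i then
       (ph i (n + 2 - j) - (\<Sum>j'\<in>{j+1..i}. \<Sum>l\<in>{1..n+2-j}. fill i j' * om j' l a b * fill (n + 2 - j) l))
         / (om j (n + 2 - j) a b * fill (n + 2 - j) (n + 2 - j))
     else - (\<Sum>j'\<in>{j+1..i}. \<Sum>l\<in>{j+1..i}. fill i j' * om j' l a b * fill i l) / (2 * om j i a b * fill i i))"
  by pat_completeness auto
termination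
  by (relation "measures [\<lambda>(i, j). i, \<lambda>(i, j). n + 1 - j]") (use m_bounds in auto)

declare fill.simps [simp del]

lemma fill_upper: "j > i \<Longrightarrow> fill i j = 0" "j < 1 \<Longrightarrow> fill i j = 0"
  by (simp_all add: fill.simps)

lemma fill_11: "fill 1 1 = 1"
  by (simp add: fill.simps)

lemma fill_free: "free n i j \<Longrightarrow> fill i j = F i j"
  using free_range[of i j] by (subst fill.simps) (auto simp: free_iff)

lemma fill_u: "even n \<Longrightarrow> fill (m + 1) (m + 1) = F (m + 1) (m + 1)"
  using m_even m_bounds by (subst fill.simps) auto

context
  assumes nd: "nondeg a b" and Fnz: "\<And>k. free n k k \<Longrightarrow> F k k \<noteq> 0"
    and u: "even n \<Longrightarrow> F (m + 1) (m + 1) ^ 2 * om (m + 1) (m + 1) a b = 1"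
begin

lemma fill_row:
  assumes "1 \<le> k" "k < i" "i \<le> n + 1" "i + k \<ge> n + 2"
  shows "fill i (n + 2 - k) = (ph i k - (\<Sum>j'\<in>{n+2-k+1..i}. \<Sum>l\<in>{1..k}. fill i j' * om j' l a b * fill k l))
         / (om (n + 2 - k) k a b * fill k k)"
proof -
  have "n + 2 - (n + 2 - k) = k" using assms by simp
  moreover have "\<not> i + (n + 2 - k) \<le> 2 * m + 1" "n + 2 - k \<ge> 1" "n + 2 - k \<le> i" "i \<noteq> 1"
    "i + (n + 2 - k) \<noteq> n + 2"
    using assms m_bounds by linarith+
  ultimately show ?thesis
    using assms by (subst fill.simps) (simp only: if_False if_True, simp)
qed

text \<open>Needed because \<open>fill\<close> divides by its own diagonal. In the lower half the
  entry is, up to sign, the inverse of an antidiagonal entry of \<Omega> times the dual diagonal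
  entry, which lies in an earlier row.\<close>

lemma fill_diag_nz: "1 \<le> k \<Longrightarrow> k \<le> n + 1 \<Longrightarrow> fill k k \<noteq> 0"
proof (induction k rule: less_induct)
  case (less k)
  consider "k = 1" | "k \<ge> 2" "k \<le> m" | "even n" "k = m + 1" | "n + 2 - k < k" "k + k \<ge> 2 * m + 2"
  proof (cases "even n")
    case True
    then show ?thesis using that m_even less.prems by (cases "k = 1 \<or> k \<le> m \<or> k = m + 1") force+
  next
    case False
    then show ?thesis using that m_odd less.prems by (cases "k = 1 \<or> k \<le> m") force+
  qed
  then show ?case
  proof cases
    case 1
    then show ?thesis using fill_11 by simp
  next
    case 2
    then have "free n k k" by (simp add: free_iff)
    then show ?thesis using fill_free Fnz by simp
  next
    case 3
    then show ?thesis using fill_u u by auto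
  next
    case 4
    define j where "j = n + 2 - k"
    have j: "1 \<le> j" "j < k" "n + 2 - j = k" "k + j = n + 2" using 4 less.prems by (auto simp: j_def)
    have "fill j j \<noteq> 0" using less.IH[OF j(2)] j less.prems by simp
    moreover have "om k j a b \<noteq> 0" using om_antidiag_nz[OF nd less.prems] by (simp add: j_def)
    moreover have "fill k k = ph k j / (om k j a b * fill j j)"
      using fill_row[of j k] j less.prems by simp
    ultimately show ?thesis using eps_nz[of k] j by (simp add: ph_def)
  qed
qed

lemma ph_sym: "\<lbrakk>1 \<le> i; i \<le> n + 1; 1 \<le> k; k \<le> n + 1\<rbrakk> \<Longrightarrow> ph i k = (- 1) ^ n * ph k i"
  using m_odd by (cases "even n") (auto simp: ph_def eps_def)

text \<open>For i + k < n + 2 all products vanish. Otherwise, off the diagonal, the equation holds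
  because an entry was solved from it. On the diagonal it is automatic for odd n; for even n it is
  the equation of the root in the middle and was used to solve for an entry beyond.\<close>

lemma fill_quad_le:
  assumes "1 \<le> k" "k \<le> i" "i \<le> n + 1"
  shows "(\<Sum>j = 1..n+1. \<Sum>l = 1..n+1. fill i j * om j l a b * fill k l) = ph i k"
proof -
  let ?Q = "\<lambda>j l. om j l a b"
  have Q: "?Q j l = 0" if "1 \<le> j" "1 \<le> l" "j + l \<le> n + 1" for j l
    using that by (rule om_zero[OF nd])
  have anti: "(\<Sum>j = 1..n+1. \<Sum>l = 1..n+1. fill i j * ?Q j l * fill k l) =
    fill i (n + 2 - k) * ?Q (n + 2 - k) k * fill k k
      + (\<Sum>j = n+2-k+1..i. \<Sum>l = 1..k. fill i j * ?Q j l * fill k l)" if "i + k \<ge> n + 2"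
    by (rule anti_sum) (use assms that in \<open>auto intro: Q fill_upper\<close>)
  consider "i + k < n + 2" | "i + k \<ge> n + 2" "k < i" | "odd n" "k = i" | "even n" "k = i" "i = m + 1"
    | "even n" "k = i" "i + i > n + 2"
    using assms m_even by (cases "even n") force+
  then show ?thesis
  proof cases
    case 1
    have "fill i j * ?Q j l * fill k l = 0" if "j \<in> {1..n+1}" "l \<in> {1..n+1}" for j l
      using that 1 fill_upper(1)[of i j] fill_upper(1)[of k l] Q[of j l]
      by (cases "j > i \<or> l > k") auto
    then have "(\<Sum>j = 1..n+1. \<Sum>l = 1..n+1. fill i j * ?Q j l * fill k l) = 0"
      by (intro sum.neutral ballI)
    then show ?thesis using 1 by (simp only: ph_def) simp
  next
    case 2
    have "om (n + 2 - k) k a b \<noteq> 0" "fill k k \<noteq> 0"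
      using om_antidiag_nz[OF nd, of "n + 2 - k"] fill_diag_nz[of k] assms by auto
    then show ?thesis unfolding anti[OF 2(1)] fill_row[OF assms(1) 2(2) assms(3) 2(1)] by simp
  next
    case 3
    \<comment> \<open>For odd n the form is alternating, so its value on a single row is its own
      negative.\<close>
    let ?X = "\<Sum>j = 1..n+1. \<Sum>l = 1..n+1. fill i j * ?Q j l * fill i l"
    have "?X = (\<Sum>l = 1..n+1. \<Sum>j = 1..n+1. fill i j * ?Q j l * fill i l)" by (rule sum.swap)
    also have "\<dots> = (\<Sum>l = 1..n+1. \<Sum>j = 1..n+1. - (fill i l * ?Q l j * fill i j))"
    proof (intro sum.cong refl)
      fix l j assume "l \<in> {1..n+1}" "j \<in> {1..n+1}"
      then have "?Q j l = - ?Q l j" using om_sym[OF nd, of l j] 3 by simp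
      then show "fill i j * ?Q j l * fill i l = - (fill i l * ?Q l j * fill i j)" by simp
    qed
    also have "\<dots> = - ?X" by (simp add: sum_negf del: sum.cl_ivl_Suc)
    finally have "?X = - ?X" .
    moreover have "x = 0" if "x = - x" for x :: complex
      using that by (simp add: complex_eq_iff)
    ultimately have "?X = 0" by blast
    moreover have "i + i \<noteq> n + 2" using 3 by presburger
    ultimately show ?thesis using 3 by (simp only: ph_def if_False)
  next
    case 4
    then have "i + k = n + 2" "n + 2 - k = i" using m_even by auto
    then show ?thesis using anti u[OF 4(1)] fill_u[OF 4(1)] 4 
      by (simp add: ph_def eps_def power2_eq_square algebra_simps del: sum.cl_ivl_Suc)
  next
    case 5
    define j where "j = n + 2 - i"
    have j: "1 \<le> j" "j < i" "n + 2 - j = i" "j \<le> n + 1" "i + j = n + 2" using 5 assms by (auto simp: j_def)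
    have "?Q i j = ?Q j i" using om_sym[OF nd, of j i] 5 assms j by simp
    moreover have "(\<Sum>j = 1..n+1. \<Sum>l = 1..n+1. fill i j * ?Q j l * fill i l) =
       fill i (n + 2 - i) * ?Q (n + 2 - i) i * fill i i + fill i i * ?Q i (n + 2 - i) * fill i (n + 2 - i)
      + (\<Sum>j = n+2-i+1..i. \<Sum>l = n+2-i+1..i. fill i j * ?Q j l * fill i l)"
      by (rule anti_sum_diag) (use assms 5 in \<open>auto intro: Q fill_upper\<close>)
    moreover have "fill i j = - (\<Sum>j'\<in>{j+1..i}. \<Sum>l\<in>{j+1..i}. fill i j' * ?Q j' l * fill i l) / (2 * ?Q j i * fill i i)"
    proof -
      have "\<not> i + j \<le> 2 * m + 1" "\<not> n + 2 - j < i" "i \<noteq> 1" "\<not> (j < 1 \<or> j > i \<or> i > n + 1)" "i \<noteq> j"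
        using j assms m_even[OF 5(1)] by auto
      then show ?thesis by (subst fill.simps) (simp only: if_False if_True, simp)
    qed
    moreover have "?Q j i \<noteq> 0" "fill i i \<noteq> 0"
      using om_antidiag_nz[OF nd, of j] fill_diag_nz[of i] assms 5 j by auto
    ultimately have "(\<Sum>j = 1..n+1. \<Sum>l = 1..n+1. fill i j * ?Q j l * fill i l) = 0"
      unfolding j_def[symmetric] by (simp add: field_simps del: sum.cl_ivl_Suc)
    moreover have "i + i \<noteq> n + 2" using 5 by simp
    ultimately show ?thesis using 5 by (simp only: ph_def if_False)
  qed
qed

lemma fill_quad:
  assumes "1 \<le> k" "k \<le> n + 1" "1 \<le> i" "i \<le> n + 1"
  shows "(\<Sum>j = 1..n+1. \<Sum>l = 1..n+1. fill i j * om j l a b * fill k l) = ph i k"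
proof (cases "k \<le> i")
  case False
  have "(\<Sum>j = 1..n+1. \<Sum>l = 1..n+1. fill i j * om j l a b * fill k l)
      = (\<Sum>l = 1..n+1. \<Sum>j = 1..n+1. fill i j * om j l a b * fill k l)" by (rule sum.swap)
  also have "\<dots> = (\<Sum>l = 1..n+1. \<Sum>j = 1..n+1. (- 1) ^ n * (fill k l * om l j a b * fill i j))"
  proof (intro sum.cong refl)
    fix l j assume "l \<in> {1..n+1}" "j \<in> {1..n+1}"
    then have "om j l a b = (- 1) ^ n * om l j a b" using om_sym[OF nd, of l j] by simp
    then show "fill i j * om j l a b * fill k l = (- 1) ^ n * (fill k l * om l j a b * fill i j)" by simp
  qed
  also have "\<dots> = (- 1) ^ n * ph k i"
    unfolding fill_quad_le[of i k, OF assms(3) _ assms(2), symmetric, OF less_imp_le[OF not_le_imp_less[OF False]]]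
    by (simp only: sum_distrib_left)
  finally show ?thesis using ph_sym[of i k] assms by simp
qed (use fill_quad_le assms in auto)

lemma fill_moduli: "(a, b, mat1 (n + 1) fill) \<in> M"
proof -
  define S where "S = mat1 (n + 1) fill"
  have S: "S \<in> carrier_mat (n + 1) (n + 1)" by (simp add: S_def)
  have O: "\<Omega> a b \<in> carrier_mat (n + 1) (n + 1)" by (rule om_carrier[OF nd])
  have e: "entry S i j = fill i j" if "1 \<le> i" "i \<le> n + 1" "1 \<le> j" "j \<le> n + 1" for i j
    unfolding S_def using that by (rule entry_mat1)
  have "S * \<Omega> a b * transpose_mat S = Phi n"
    unfolding congruence_Phi_iff[OF S O]
  proof (intro ballI)
    fix i k assume ik: "i \<in> {1..n+1}" "k \<in> {1..n+1}"
    have "(\<Sum>j = 1..n+1. \<Sum>l = 1..n+1. entry S i j * entry (\<Omega> a b) j l * entry S k l)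
        = (\<Sum>j = 1..n+1. \<Sum>l = 1..n+1. fill i j * om j l a b * fill k l)"
      using ik by (intro sum.cong refl) (simp add: e om_def)
    also have "\<dots> = ph i k" by (rule fill_quad) (use ik in auto)
    finally show "(\<Sum>j = 1..n+1. \<Sum>l = 1..n+1. entry S i j * entry (\<Omega> a b) j l * entry S k l) = ph i k" .
  qed
  moreover have "invertible_mat S"
  proof -
    have "det S = prod_list (diag_mat S)"
      by (rule det_lower_triangular[OF _ S])
        (auto simp: S_def mat1_def fill_upper)
    also have "\<dots> \<noteq> 0"
      using fill_diag_nz by (auto simp: diag_mat_def S_def mat1_def prod_list_zero_iff simp del: upt_Suc)
    finally have "S \<in> Units (ring_mat TYPE(complex) (n + 1) ())"
      by (rule det_non_zero_imp_unit[OF S])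
    then obtain B where "B \<in> carrier_mat (n + 1) (n + 1)" "B * S = 1\<^sub>m (n + 1)" "S * B = 1\<^sub>m (n + 1)"
      by (auto simp: Units_def ring_mat_def)
    then show ?thesis using S unfolding invertible_mat_def inverts_mat_def by auto
  qed
  moreover have "upper_triangular (transpose_mat S)"
    by (auto simp: S_def mat1_def fill_upper upper_triangular_def)
  moreover have "entry S 1 1 = 1" using e[of 1 1] fill_11 by simp
  ultimately show ?thesis using nd S by (simp add: moduli_def nondeg_def S_def)
qed

end

end

text \<open>This is the independence of the coordinates: only open conditions and the quadratic
  equation of the root restrict them. The coordinate curves are built from these points.\<close>

lemma point_exists:
  assumes "nondeg a b" "\<And>k. free n k k \<Longrightarrow> F k k \<noteq> 0"
    and "even n \<Longrightarrow> F (m + 1) (m + 1) ^ 2 * om (m + 1) (m + 1) a b = 1"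
  obtains p where "p \<in> M" "aa p = a" "bb p = b" "\<And>i j. free n i j \<Longrightarrow> ss i j p = F i j"
    "even n \<Longrightarrow> ss (m + 1) (m + 1) p = F (m + 1) (m + 1)"
proof -
  define p where "p = (a, b, mat1 (n + 1) (fill a b F))"
  have s: "ss i j p = fill a b F i j" if "1 \<le> i" "i \<le> n + 1" "1 \<le> j" "j \<le> n + 1" for i j
    using that by (simp add: ss_def p_def entry_mat1)
  show ?thesis
  proof (rule that)
    show "p \<in> M" unfolding p_def by (rule fill_moduli) (use assms in auto)
    show "ss i j p = F i j" if "free n i j" for i j
      using free_range[OF that] fill_free[OF that] by (subst s) auto
    show "ss (m + 1) (m + 1) p = F (m + 1) (m + 1)" if "even n"
      using m_bounds m_even[OF that] fill_u[OF that] by (subst s) auto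
  qed (simp_all add: p_def aa_def bb_def)
qed

subsection \<open>Partial derivatives along coordinate curves\<close>

abbreviation RR :: "func set" where "RR \<equiv> regular n \<Omega>"
abbreviation II :: "nat set" where "II \<equiv> I_index n"
abbreviation tc :: "nat \<Rightarrow> func" where "tc \<equiv> t_coord n \<Omega>"
abbreviation cs :: "complex \<Rightarrow> func" where "cs \<equiv> cst n \<Omega>"

lemma cs_0: "cs 0 = 0"
  by (auto simp: cst_def on_moduli_def)

lemma zero_regular: "0 \<in> RR"
  using regular.const[of n \<Omega> 0] unfolding cs_0 .

lemma homogeneous_regular: "homogeneous n \<Omega> e f \<Longrightarrow> f \<in> RR"
proof (induction rule: homogeneous.induct)
  case (zero e)
  show ?case by (rule zero_regular)
qed (rule regular.intros; assumption)+

lemma Hm_regular: "Hm e f \<Longrightarrow> ext f \<in> RR"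
  unfolding Hm_def by (rule homogeneous_regular)

lemma regular_outside: "f \<in> RR \<Longrightarrow> p \<notin> M \<Longrightarrow> f p = 0"
proof (induction rule: regular.induct)
  case (coord j)
  then show ?case by (simp add: t_coord_def)
next
  case root
  then show ?case by (simp add: u_coord_def)
next
  case inv
  then show ?case by (simp add: inv_disc_def)
qed auto

lemma regular_eqI: "f \<in> RR \<Longrightarrow> g \<in> RR \<Longrightarrow> (\<And>p. p \<in> M \<Longrightarrow> f p = g p) \<Longrightarrow> f = g"
  using regular_outside by (metis HOL.ext)

lemma regular_cmult: "f \<in> RR \<Longrightarrow> cs z * f \<in> RR"
  by (intro regular.mult regular.const)

lemma regular_uminus: "f \<in> RR \<Longrightarrow> - f \<in> RR"
proof -
  assume f: "f \<in> RR"
  have "- f = cs (- 1) * f"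
    using regular_outside[OF f] by (auto simp: cst_def on_moduli_def)
  then show ?thesis using regular_cmult[OF f] by simp
qed

lemma regular_diff: "f \<in> RR \<Longrightarrow> g \<in> RR \<Longrightarrow> f - g \<in> RR"
  using regular.add[OF _ regular_uminus, of f g] by simp

lemma sum_func_apply: "(\<Sum>x\<in>A. F x) (p :: point) = (\<Sum>x\<in>A. F x p :: complex)"
  by (induction A rule: infinite_finite_induct) auto

lemma regular_sum: "finite A \<Longrightarrow> (\<And>x. x \<in> A \<Longrightarrow> F x \<in> RR) \<Longrightarrow> (\<Sum>x\<in>A. F x) \<in> RR"
proof (induction A rule: finite_induct)
  case empty
  show ?case unfolding sum.empty by (rule zero_regular)
qed (simp add: regular.add)

lemma cs_mult_regular: "f \<in> RR \<Longrightarrow> cs 1 * f = f"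
  using regular_outside by (auto simp: cst_def on_moduli_def)

definition sf :: "nat \<Rightarrow> nat \<Rightarrow> func" where "sf i j = ext (ss i j)"

lemma sf_regular: "sf i j \<in> RR"
  unfolding sf_def by (rule Hm_regular[OF Hm_ss])

lemma sf_in [simp]: "p \<in> M \<Longrightarrow> sf i j p = ss i j p"
  by (simp add: sf_def)

lemma tc_regular: "j \<in> II \<Longrightarrow> tc j \<in> RR"
  by (rule regular.coord)

lemma tc_1: "tc 1 = ext aa" and tc_2: "tc (n + 2) = ext bb"
  using n1 by (auto simp: t_coord_def on_moduli_def aa_def bb_def)

lemma tc_sf: "t \<in> II - {1, n + 2} \<Longrightarrow> t_pos n t = (i, j) \<Longrightarrow> tc t = sf i j"
proof
  fix p assume "t \<in> II - {1, n + 2}" "t_pos n t = (i, j)"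
  then show "tc t p = sf i j p"
    using t_coord_ss[of p t i j] by (cases "p \<in> M") (simp, simp add: t_coord_def sf_def)
qed

text \<open>Both functions are polynomials in the coordinates; the first occurs in the relation for
  u, the second is the denominator of \<open>inv_disc\<close>. A property stable under the ring
  operations thus reaches them before u and the inverse are treated.\<close>

lemma coord_closed:
  assumes P: "\<And>z. P (cs z)" "\<And>j. j \<in> II \<Longrightarrow> P (tc j)" "\<And>f g. P f \<Longrightarrow> P g \<Longrightarrow> P (f + g)"
    "\<And>f g. P f \<Longrightarrow> P g \<Longrightarrow> P (f * g)"
  shows "P (ext dd)" "P (ext (\<lambda>p. bb p * dd p * pd (diag_index n) p))"
proof -
  have ab: "P (ext aa)" "P (ext bb)"
    using P(2)[OF I_index_cases(1)[OF n1]] P(2)[OF I_index_cases(2)[OF n1]] tc_1 tc_2 by auto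
  have "P (ext (\<lambda>p. aa p ^ k))" for k
  proof (induction k)
    case 0
    show ?case using P(1)[of 1] by (simp add: cst_def)
  next
    case (Suc k)
    show ?case using P(4)[OF ab(1) Suc] by (simp add: ext_mult)
  qed
  then have "P (ext (\<lambda>p. aa p ^ (n + 2)) + cs (- 1) * ext bb)" using P ab by blast
  also have "ext (\<lambda>p. aa p ^ (n + 2)) + cs (- 1) * ext bb = ext dd"
    by (auto simp: on_moduli_def cst_def dd_def)
  finally show dd: "P (ext dd)" .
  have "P (ext (pd A))" if "A \<subseteq> diag_index n" for A
    using finite_subset[OF that finite_diag_index] that
  proof (induction A rule: finite_induct)
    case empty
    show ?case using P(1)[of 1] by (simp add: cst_def pd_def[abs_def])
  next
    case (insert x A)
    then have "P (tc x * ext (pd A))" using P by (auto simp: diag_index_def)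
    also have "tc x * ext (pd A) = ext (pd (insert x A))"
      using insert by (auto simp: on_moduli_def pd_def)
    finally show ?case .
  qed
  from P(4)[OF P(4)[OF ab(2) dd] this[OF order.refl]]
  show "P (ext (\<lambda>p. bb p * dd p * pd (diag_index n) p))" by (simp only: ext_mult)
qed

lemma inv_disc_mult: "inv_disc n \<Omega> * ext (\<lambda>p. bb p * dd p * pd (diag_index n) p) = cs (- 1)"
proof
  fix p show "(inv_disc n \<Omega> * ext (\<lambda>p. bb p * dd p * pd (diag_index n) p)) p = cs (- 1) p"
    using bb_nz[of p] dd_nz[of p] pd_nz[of p] by (cases "p \<in> M") (simp_all add: inv_disc_in)
qed

definition uu :: "point \<Rightarrow> complex" where "uu = ss (m + 1) (m + 1)"

lemma u_coord_eq: "even n \<Longrightarrow> u_coord n \<Omega> = ext uu"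
proof -
  assume "even n"
  then have "(n + 2) div 2 = m + 1" "m \<le> n" using m_even m_bounds by auto
  then show ?thesis by (auto simp: u_coord_def on_moduli_def uu_def ss_def)
qed

lemma uu_sq:
  assumes "even n" "p \<in> M"
  shows "uu p ^ 2 * ((- 1) ^ m * disc_const) = dd p" and "uu p \<noteq> 0"
proof -
  have m: "1 \<le> m + 1" "m + 1 \<le> n + 1" "n + 2 - (m + 1) = m + 1"
    using m_even[OF assms(1)] m_bounds by auto
  show u: "uu p \<noteq> 0" unfolding uu_def using ss_diag_nz[OF assms(2) m(1,2)] .
  have "uu p * ww (m + 1) (m + 1) p * uu p = 1"
    using diag_rel[OF assms(2) m(1,2)] assms(1) unfolding m(3) uu_def by (simp add: eps_def)
  moreover have "ww (m + 1) (m + 1) p = (- 1) ^ m * (disc_const / dd p)"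
    using ww_antidiag[OF assms(2) m(1,2)] unfolding m(3) dd_def by simp
  ultimately show "uu p ^ 2 * ((- 1) ^ m * disc_const) = dd p"
    using dd_nz[OF assms(2)] by (simp add: power2_eq_square nonzero_divide_eq_eq) (simp only: mult_ac)
qed

text \<open>The factor \<open>csqrt\<close> selects the branch of \<open>u\<close> through the given point.\<close>

definition on_curve :: "nat \<Rightarrow> point \<Rightarrow> complex \<Rightarrow> point \<Rightarrow> bool" where
  "on_curve t p z p' \<longleftrightarrow> p' \<in> M \<and> (\<forall>s\<in>II. tc s p' = tc s p + of_bool (s = t) * z) \<and>
     (even n \<longrightarrow> uu p' = uu p * csqrt (dd p' / dd p))"

text \<open>The nonvanishing conditions of \<open>point_exists\<close> are open, hence survive small
  displacements. The displaced root is prescribed by \<open>csqrt\<close>, and its square has the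
  right value because u^2 is a constant multiple of \<open>dd\<close>.\<close>

lemma curve_exists:
  assumes t: "t \<in> II" and p: "p \<in> M"
  shows "eventually (\<lambda>z. \<exists>p'. on_curve t p z p') (nhds 0)"
proof -
  define a where "a z = aa p + of_bool (t = 1) * z" for z
  define b where "b z = bb p + of_bool (t = n + 2) * z" for z
  define d where "d z = a z ^ (n + 2) - b z" for z
  \<comment> \<open>Off the free positions F is consulted only at (m + 1, m + 1), where it supplies
    the root.\<close>
  define F where "F z i j = (if free n i j then ss i j p + of_bool (t \<notin> {1, n + 2} \<and> t_pos n t = (i, j)) * z
     else uu p * csqrt (d z / dd p))" for z i j
  have nf: "\<not> free n (m + 1) (m + 1)" by (simp add: free_iff)
  have "open {z. nondeg (a z) (b z)}"
    unfolding nondeg_def a_def b_def by (intro open_Collect_neq continuous_intros)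
  moreover have "nondeg (a 0) (b 0)" using point_nondeg[OF p] by (simp add: a_def b_def)
  ultimately have e1: "eventually (\<lambda>z. nondeg (a z) (b z)) (nhds 0)"
    by (auto simp: eventually_nhds)
  have "eventually (\<lambda>z. F z k k \<noteq> 0) (nhds 0)" if k: "free n k k" for k
  proof -
    have "open {z. ss k k p + of_bool (t \<notin> {1, n + 2} \<and> t_pos n t = (k, k)) * z \<noteq> 0}"
      by (intro open_Collect_neq continuous_intros)
    moreover have "0 \<in> {z. ss k k p + of_bool (t \<notin> {1, n + 2} \<and> t_pos n t = (k, k)) * z \<noteq> 0}"
      using ss_diag_nz[OF p] free_range[OF k] by simp
    ultimately have "eventually (\<lambda>z. z \<in> {z. ss k k p + of_bool (t \<notin> {1, n + 2} \<and> t_pos n t = (k, k)) * z \<noteq> 0}) (nhds 0)"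
      by (rule eventually_nhds_in_open)
    then show ?thesis using k unfolding F_def by simp
  qed
  then have "eventually (\<lambda>z. free n k k \<longrightarrow> F z k k \<noteq> 0) (nhds 0)" for k
    by (cases "free n k k") auto
  then have "eventually (\<lambda>z. \<forall>k\<in>{..n+1}. free n k k \<longrightarrow> F z k k \<noteq> 0) (nhds 0)"
    by (simp add: eventually_ball_finite_distrib)
  with e1 show ?thesis
  proof eventually_elim
    case (elim z)
    have dz: "d z \<noteq> 0" using elim(1) by (auto simp: nondeg_def d_def)
    have u: "F z (m + 1) (m + 1) ^ 2 * om (m + 1) (m + 1) (a z) (b z) = 1" if ev: "even n"
    proof -
      have m: "1 \<le> m + 1" "m + 1 \<le> n + 1" "n + 2 - (m + 1) = m + 1"
        using m_even[OF ev] m_bounds by auto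
      have "om (m + 1) (m + 1) (a z) (b z) = (- 1) ^ m * (disc_const / d z)"
        using om_antidiag[OF elim(1) m(1,2)] unfolding m(3) d_def by simp
      moreover have "F z (m + 1) (m + 1) ^ 2 = uu p ^ 2 * (d z / dd p)"
        using nf by (simp add: F_def power_mult_distrib)
      ultimately have "F z (m + 1) (m + 1) ^ 2 * om (m + 1) (m + 1) (a z) (b z)
          = uu p ^ 2 * ((- 1) ^ m * disc_const) / dd p" using dz by simp
      then show ?thesis using uu_sq(1)[OF ev p] dd_nz[OF p] by simp
    qed
    have Fnz: "F z k k \<noteq> 0" if "free n k k" for k using elim(2) that free_range[OF that] by simp
    from point_exists[where F = "F z", OF elim(1) Fnz u] obtain p'
      where p': "p' \<in> M" "aa p' = a z" "bb p' = b z" "\<And>i j. free n i j \<Longrightarrow> ss i j p' = F z i j"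
        "even n \<Longrightarrow> ss (m + 1) (m + 1) p' = F z (m + 1) (m + 1)" by blast
    have "tc s p' = tc s p + of_bool (s = t) * z" if s: "s \<in> II" for s
    proof (cases "s \<in> {1, n + 2}")
      case True
      then show ?thesis using p' p n1 by (auto simp: t_coord_in a_def b_def)
    next
      case False
      obtain i j where ij: "t_pos n s = (i, j)" by (cases "t_pos n s")
      have s': "s \<in> II - {1, n + 2}" using s False by simp
      have "(t \<notin> {1, n + 2} \<and> t_pos n t = (i, j)) \<longleftrightarrow> s = t"
      proof -
        have "s = t" if "t \<notin> {1, n + 2}" "t_pos n t = (i, j)"
          by (rule inj_onD[OF bij_betw_imp_inj_on[OF bij_betw_t_pos[OF n1]]]) (use that s' t ij in auto)
        then show ?thesis using s' ij by auto
      qed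
      then show ?thesis
        using t_coord_ss[OF p'(1) s' ij] t_coord_ss[OF p s' ij] p'(4)[OF t_pos_free[OF s' ij]]
          t_pos_free[OF s' ij] by (simp add: F_def)
    qed
    moreover have "uu p' = uu p * csqrt (dd p' / dd p)" if "even n"
      using p' that nf by (simp add: uu_def[of] F_def dd_def d_def)
    ultimately show ?case using p'(1) unfolding on_curve_def by blast
  qed
qed

definition curve :: "nat \<Rightarrow> point \<Rightarrow> complex \<Rightarrow> point" where
  "curve t p z = (SOME p'. on_curve t p z p')"

lemma curve: "t \<in> II \<Longrightarrow> p \<in> M \<Longrightarrow> eventually (\<lambda>z. on_curve t p z (curve t p z)) (nhds 0)"
  unfolding curve_def by (drule (1) curve_exists) (erule eventually_mono, erule someI_ex)

text \<open>That the chosen curve starts at p is recorded only through the value of f; this is what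
  the product rule uses.\<close>

definition has_pd :: "nat \<Rightarrow> func \<Rightarrow> func \<Rightarrow> bool" where
  "has_pd t f g \<longleftrightarrow> (\<forall>p\<in>M. f (curve t p 0) = f p \<and>
     ((\<lambda>z. f (curve t p z)) has_field_derivative g p) (at 0))"

lemma has_pdI:
  assumes "t \<in> II" "\<And>p. p \<in> M \<Longrightarrow> F p 0 = f p"
    and "\<And>p z p'. p \<in> M \<Longrightarrow> on_curve t p z p' \<Longrightarrow> f p' = F p z"
    and "\<And>p. p \<in> M \<Longrightarrow> (F p has_field_derivative g p) (at 0)"
  shows "has_pd t f g"
  unfolding has_pd_def
proof (intro ballI conjI)
  fix p assume p: "p \<in> M"
  have ev: "eventually (\<lambda>z. f (curve t p z) = F p z) (nhds 0)"
    using curve[OF assms(1) p] by eventually_elim (rule assms(3)[OF p])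
  then show "f (curve t p 0) = f p"
    using assms(2)[OF p] by (auto dest: eventually_nhds_x_imp_x)
  show "((\<lambda>z. f (curve t p z)) has_field_derivative g p) (at 0)"
    using DERIV_cong_ev[OF refl ev refl] assms(4)[OF p] by simp
qed

lemma has_pd_tc: "t \<in> II \<Longrightarrow> s \<in> II \<Longrightarrow> has_pd t (tc s) (cs (of_bool (s = t)))"
  by (rule has_pdI[where F = "\<lambda>p z. tc s p + of_bool (s = t) * z"])
    (auto simp: on_curve_def intro!: derivative_eq_intros)

lemma has_pd_cs: "t \<in> II \<Longrightarrow> has_pd t (cs z) (cs 0)"
  by (rule has_pdI[where F = "\<lambda>p _. z"]) (auto simp: on_curve_def)

lemma has_pd_add: "has_pd t f f' \<Longrightarrow> has_pd t g g' \<Longrightarrow> has_pd t (f + g) (f' + g')"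
  unfolding has_pd_def by (auto intro!: derivative_eq_intros)

lemma has_pd_mult: "has_pd t f f' \<Longrightarrow> has_pd t g g' \<Longrightarrow> has_pd t (f * g) (f' * g + f * g')"
  unfolding has_pd_def by (auto intro!: derivative_eq_intros)

lemma on_curve_ab:
  assumes "on_curve t p z p'" "p \<in> M"
  shows "aa p' = aa p + of_bool (t = 1) * z" "bb p' = bb p + of_bool (t = n + 2) * z"
proof -
  have "tc 1 p' = tc 1 p + of_bool (1 = t) * z" "tc (n + 2) p' = tc (n + 2) p + of_bool (n + 2 = t) * z"
    using assms(1) I_index_cases(1,2)[OF n1] unfolding on_curve_def by blast+
  then show "aa p' = aa p + of_bool (t = 1) * z" "bb p' = bb p + of_bool (t = n + 2) * z"
    using assms n1 unfolding on_curve_def by (auto simp: t_coord_in split: if_splits)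
qed

text \<open>Along the curve u is u(p) times the square root of dd / dd(p), differentiated at
  argument 1, away from the branch cut. The result u dd' / (2 dd) is again regular.\<close>

lemma has_pd_uu:
  assumes "t \<in> II" "even n"
  shows "\<exists>g\<in>RR. has_pd t (ext uu) g"
proof -
  define G where "G p = uu p * ((of_nat (n + 2) * of_bool (t = 1)) * aa p ^ (n + 1) - of_bool (t = n + 2))
      * (1 / dd p) * (1 / 2)" for p
  have "ext G \<in> RR"
  proof -
    have r: "ext uu \<in> RR" "ext (\<lambda>p. 1 / dd p) \<in> RR" "ext (\<lambda>p. aa p ^ (n + 1)) \<in> RR"
      using Hm_regular[OF Hm_ss[of "m + 1" "m + 1"]] Hm_regular[OF Hm_inv_dd]
        Hm_regular[OF Hm_power[OF Hm_aa, of "n + 1"]] by (auto simp: uu_def)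
    have "ext uu * (cs (of_nat (n + 2) * of_bool (t = 1)) * ext (\<lambda>p. aa p ^ (n + 1)) - cs (of_bool (t = n + 2)))
       * ext (\<lambda>p. 1 / dd p) * cs (1 / 2) \<in> RR"
      by (intro regular.mult regular_diff r regular.const)
    also have "ext uu * (cs (of_nat (n + 2) * of_bool (t = 1)) * ext (\<lambda>p. aa p ^ (n + 1)) - cs (of_bool (t = n + 2)))
       * ext (\<lambda>p. 1 / dd p) * cs (1 / 2) = ext G"
    proof
      fix p show "(ext uu * (cs (of_nat (n + 2) * of_bool (t = 1)) * ext (\<lambda>p. aa p ^ (n + 1)) - cs (of_bool (t = n + 2)))
       * ext (\<lambda>p. 1 / dd p) * cs (1 / 2)) p = ext G p"
        by (cases "p \<in> M") (simp_all add: G_def)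
    qed
    finally show ?thesis .
  qed
  moreover have "has_pd t (ext uu) (ext G)"
  proof (rule has_pdI[OF assms(1), where F = "\<lambda>p z. uu p * csqrt (((aa p + of_bool (t = 1) * z) ^ (n + 2)
      - (bb p + of_bool (t = n + 2) * z)) / dd p)"])
    fix p assume p: "p \<in> M"
    let ?D = "\<lambda>z. ((aa p + of_bool (t = 1) * z) ^ (n + 2) - (bb p + of_bool (t = n + 2) * z)) / dd p"
    have D0: "?D 0 = 1" using dd_nz[OF p] by (simp add: dd_def)
    show "uu p * csqrt (?D 0) = ext uu p" using p by (simp only: D0 ext_in[OF p]) simp
    have lin: "((\<lambda>z. x + of_bool B * z) has_field_derivative of_bool B) (at 0)" for x :: complex and B
      by (auto intro!: derivative_eq_intros)
    have dD: "(?D has_field_derivative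
        (of_nat (n + 2) * (of_bool (t = 1) * (aa p + of_bool (t = 1) * 0) ^ (n + 2 - Suc 0)) - of_bool (t = n + 2)) / dd p) (at 0)"
      by (intro DERIV_cdivide DERIV_diff DERIV_power lin)
    have "((\<lambda>z. uu p * csqrt (?D z)) has_field_derivative
        uu p * ((of_nat (n + 2) * (of_bool (t = 1) * (aa p + of_bool (t = 1) * 0) ^ (n + 2 - Suc 0)) - of_bool (t = n + 2)) / dd p
          / (2 * csqrt (?D 0)))) (at 0)"
      using D0 by (intro DERIV_cmult has_field_derivative_csqrt'[OF dD]) auto
    then show "((\<lambda>z. uu p * csqrt (?D z)) has_field_derivative ext G p) (at 0)"
      by (rule DERIV_cong) (simp only: D0 ext_in[OF p] G_def, simp add: field_simps)
  next
    fix p z p' assume p: "p \<in> M" and c: "on_curve t p z p'"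
    have "uu p' = uu p * csqrt (dd p' / dd p)" "p' \<in> M" using c assms(2) unfolding on_curve_def by blast+
    moreover have "dd p' = (aa p + of_bool (t = 1) * z) ^ (n + 2) - (bb p + of_bool (t = n + 2) * z)"
      unfolding dd_def on_curve_ab[OF c p] ..
    ultimately show "ext uu p' = uu p * csqrt (((aa p + of_bool (t = 1) * z) ^ (n + 2)
      - (bb p + of_bool (t = n + 2) * z)) / dd p)"
      by simp
  qed
  ultimately show ?thesis by blast
qed

lemma has_pd_exists:
  assumes "f \<in> RR" "t \<in> II" shows "\<exists>g\<in>RR. has_pd t f g"
  using assms(1)
proof (induction rule: regular.induct)
  case (const z)
  show ?case using has_pd_cs[OF assms(2)] regular.const by blast
next
  case (coord j)
  then show ?case using has_pd_tc[OF assms(2)] regular.const by blast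
next
  case root
  then show ?case using has_pd_uu[OF assms(2)] u_coord_eq by simp
next
  case inv
  let ?d = "ext (\<lambda>p. bb p * dd p * pd (diag_index n) p)"
  have "?d \<in> RR \<and> (\<exists>g\<in>RR. has_pd t ?d g)"
  proof (rule coord_closed(2)[where P = "\<lambda>f. f \<in> RR \<and> (\<exists>g\<in>RR. has_pd t f g)"])
    show "cs z \<in> RR \<and> (\<exists>g\<in>RR. has_pd t (cs z) g)" for z
      using has_pd_cs[OF assms(2)] regular.const by blast
    show "tc j \<in> RR \<and> (\<exists>g\<in>RR. has_pd t (tc j) g)" if "j \<in> II" for j
      using has_pd_tc[OF assms(2) that] regular.const regular.coord[OF that] by blast
    show "f + g \<in> RR \<and> (\<exists>h\<in>RR. has_pd t (f + g) h)"
      if "f \<in> RR \<and> (\<exists>h\<in>RR. has_pd t f h)" "g \<in> RR \<and> (\<exists>h\<in>RR. has_pd t g h)" for f g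
      using that has_pd_add regular.add by blast
    show "f * g \<in> RR \<and> (\<exists>h\<in>RR. has_pd t (f * g) h)"
      if "f \<in> RR \<and> (\<exists>h\<in>RR. has_pd t f h)" "g \<in> RR \<and> (\<exists>h\<in>RR. has_pd t g h)" for f g
    proof -
      from that obtain f' g' where "f' \<in> RR" "g' \<in> RR" "has_pd t f f'" "has_pd t g g'" by blast
      then have "has_pd t (f * g) (f' * g + f * g')" "f' * g + f * g' \<in> RR" "f * g \<in> RR"
        using that by (auto intro: has_pd_mult regular.intros)
      then show ?thesis by blast
    qed
  qed
  then obtain g where g: "g \<in> RR" "has_pd t ?d g" by blast
  \<comment> \<open>\<open>inv_disc\<close> is minus the inverse of \<open>?d\<close>, so its
    derivative is the derivative of \<open>?d\<close> times the square of
    \<open>inv_disc\<close>.\<close>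
  define h where "h = g * (inv_disc n \<Omega> * inv_disc n \<Omega>)"
  have inv: "inv_disc n \<Omega> p = - inverse (?d p)" if "p \<in> M" for p
    using that by (simp add: inv_disc_in divide_inverse)
  have "has_pd t (inv_disc n \<Omega>) h"
    unfolding has_pd_def
  proof (intro ballI conjI)
    fix p assume p: "p \<in> M"
    have ev: "eventually (\<lambda>z. inv_disc n \<Omega> (curve t p z) = - inverse (?d (curve t p z))) (nhds 0)"
      using curve[OF assms(2) p] by eventually_elim (use inv in \<open>simp add: on_curve_def\<close>)
    have d0: "?d (curve t p 0) = ?d p" and dd: "((\<lambda>z. ?d (curve t p z)) has_field_derivative g p) (at 0)"
      using g(2) p unfolding has_pd_def by blast+
    show "inv_disc n \<Omega> (curve t p 0) = inv_disc n \<Omega> p"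
      using eventually_nhds_x_imp_x[OF ev] d0 inv[OF p] by simp
    have nz: "?d (curve t p 0) \<noteq> 0" using d0 p dd_nz bb_nz pd_nz by simp
    have "((\<lambda>z. - inverse (?d (curve t p z))) has_field_derivative
       - (- (inverse (?d (curve t p 0)) * g p * inverse (?d (curve t p 0))))) (at 0)"
      by (rule DERIV_minus[OF DERIV_inverse'[OF dd nz]])
    then have "((\<lambda>z. inv_disc n \<Omega> (curve t p z)) has_field_derivative
       - (- (inverse (?d (curve t p 0)) * g p * inverse (?d (curve t p 0))))) (at 0)"
      using DERIV_cong_ev[OF refl ev refl] by simp
    then show "((\<lambda>z. inv_disc n \<Omega> (curve t p z)) has_field_derivative h p) (at 0)"
      by (rule DERIV_cong) (simp add: h_def inv[OF p] d0)
  qed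
  moreover have "h \<in> RR" unfolding h_def using g by (intro regular.mult regular.inv)
  ultimately show ?case by blast
next
  case (add f g)
  then show ?case using has_pd_add regular.add by blast
next
  case (mult f g)
  then obtain f' g' where "f' \<in> RR" "g' \<in> RR" "has_pd t f f'" "has_pd t g g'" by blast
  then have "has_pd t (f * g) (f' * g + f * g')" "f' * g + f * g' \<in> RR"
    using mult.hyps by (auto intro: has_pd_mult regular.intros)
  then show ?case by blast
qed

lemma has_pd_unique: "g \<in> RR \<Longrightarrow> h \<in> RR \<Longrightarrow> has_pd t f g \<Longrightarrow> has_pd t f h \<Longrightarrow> g = h"
  unfolding has_pd_def by (rule regular_eqI) (auto dest: DERIV_unique)

definition pdv :: "nat \<Rightarrow> func \<Rightarrow> func" where
  "pdv t f = (SOME g. g \<in> RR \<and> has_pd t f g)"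

lemma pdv: "f \<in> RR \<Longrightarrow> t \<in> II \<Longrightarrow> pdv t f \<in> RR" "f \<in> RR \<Longrightarrow> t \<in> II \<Longrightarrow> has_pd t f (pdv t f)"
  using someI_ex[of "\<lambda>g. g \<in> RR \<and> has_pd t f g"] has_pd_exists[of f t] unfolding pdv_def by blast+

lemma pdv_eq: "f \<in> RR \<Longrightarrow> t \<in> II \<Longrightarrow> g \<in> RR \<Longrightarrow> has_pd t f g \<Longrightarrow> pdv t f = g"
  using has_pd_unique pdv by blast

subsection \<open>Vector fields\<close>

abbreviation VF :: "vfield \<Rightarrow> bool" where "VF \<equiv> vector_field n \<Omega>"

context
  fixes V assumes V: "VF V"
begin

lemma vf_regular: "f \<in> RR \<Longrightarrow> V f \<in> RR"
  and vf_outside: "f \<notin> RR \<Longrightarrow> V f = 0"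
  and vf_add: "f \<in> RR \<Longrightarrow> g \<in> RR \<Longrightarrow> V (f + g) = V f + V g"
  and vf_cmult: "f \<in> RR \<Longrightarrow> V (cs z * f) = cs z * V f"
  and vf_mult: "f \<in> RR \<Longrightarrow> g \<in> RR \<Longrightarrow> V (f * g) = V f * g + f * V g"
  using V unfolding vector_field_def by blast+

lemma vf_cs: "V (cs z) = 0"
proof -
  have c: "cs z \<in> RR" for z by (rule regular.const)
  have "V (cs 1 * cs 1) = V (cs 1) * cs 1 + cs 1 * V (cs 1)" by (rule vf_mult[OF c c])
  moreover have "V (cs 1) * cs 1 = V (cs 1)" "cs 1 * V (cs 1) = V (cs 1)" "cs 1 * cs 1 = cs 1"
    using cs_mult_regular[OF vf_regular[OF c]] cs_mult_regular[OF c] by (simp_all add: mult.commute)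
  ultimately have "V (cs 1) = 0" by simp
  moreover have "V (cs z * cs 1) = cs z * V (cs 1)" by (rule vf_cmult[OF c])
  moreover have "cs z * cs 1 = cs z" using cs_mult_regular[OF c, of z] by (simp add: mult.commute)
  ultimately show ?thesis by simp
qed

lemma vf_zero: "V 0 = 0"
  using vf_cs[of 0] by (simp only: cs_0)

lemma cs_uminus: "f \<in> RR \<Longrightarrow> cs (- 1) * f = - f"
  using regular_outside by (auto simp: cst_def on_moduli_def)

lemma vf_uminus: "f \<in> RR \<Longrightarrow> V (- f) = - V f"
  using vf_cmult[of f "- 1"] by (simp only: cs_uminus vf_regular)

lemma vf_diff: "f \<in> RR \<Longrightarrow> g \<in> RR \<Longrightarrow> V (f - g) = V f - V g"
  using vf_add[of f "- g"] vf_uminus[of g] regular_uminus[of g] by simp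

lemma vf_sum: "finite A \<Longrightarrow> (\<And>x. x \<in> A \<Longrightarrow> F x \<in> RR) \<Longrightarrow> V (\<Sum>x\<in>A. F x) = (\<Sum>x\<in>A. V (F x))"
proof (induction A rule: finite_induct)
  case empty
  show ?case unfolding sum.empty by (rule vf_zero)
next
  case (insert x A)
  then have "V (F x + (\<Sum>x\<in>A. F x)) = V (F x) + V (\<Sum>x\<in>A. F x)"
    by (intro vf_add regular_sum) auto
  then show ?case using insert.IH insert.prems insert.hyps by (simp only: sum.insert insert_iff simp_thms)
qed

end

text \<open>The values on u and on the inverse are forced by two relations: a constant times u^2 is
  \<open>dd\<close>, and \<open>inv_disc\<close> times its denominator is -1. One applies both
  derivations and cancels u, respectively the denominator, neither of which has a zero.\<close>

lemma vf_unique: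
  assumes V: "VF V" and W: "VF W" and eq: "\<And>s. s \<in> II \<Longrightarrow> V (tc s) = W (tc s)"
  shows "V = W"
proof
  let ?P = "\<lambda>f. f \<in> RR \<and> V f = W f"
  have P: "?P (cs z)" "j \<in> II \<Longrightarrow> ?P (tc j)" "?P f \<Longrightarrow> ?P g \<Longrightarrow> ?P (f + g)" "?P f \<Longrightarrow> ?P g \<Longrightarrow> ?P (f * g)"
    for z j f g
    using eq vf_cs[OF V] vf_cs[OF W] vf_add[OF V] vf_add[OF W] vf_mult[OF V] vf_mult[OF W]
    by (simp_all add: regular.intros)
  have "V f = W f" if "f \<in> RR" for f
    using that
  proof (induction rule: regular.induct)
    case root
    have u: "ext uu \<in> RR" using regular.root[OF root, of \<Omega>] by (simp only: u_coord_eq[OF root])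
    have "?P (ext dd)" by (rule coord_closed(1)[where P = ?P]) (fact P)+
    then have d: "ext dd \<in> RR" "V (ext dd) = W (ext dd)" by blast+
    have "ext dd = cs ((- 1) ^ m * disc_const) * (ext uu * ext uu)"
    proof
      fix p show "ext dd p = (cs ((- 1) ^ m * disc_const) * (ext uu * ext uu)) p"
        using uu_sq(1)[OF root, of p] by (cases "p \<in> M") (simp_all add: power2_eq_square mult_ac)
    qed
    then have "cs ((- 1) ^ m * disc_const) * (V (ext uu) * ext uu + ext uu * V (ext uu))
        = cs ((- 1) ^ m * disc_const) * (W (ext uu) * ext uu + ext uu * W (ext uu))"
      using d vf_cmult[OF V, of "ext uu * ext uu"] vf_cmult[OF W, of "ext uu * ext uu"]
        vf_mult[OF V u u] vf_mult[OF W u u] regular.mult[OF u u] by simp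
    then have e: "(cs ((- 1) ^ m * disc_const) * (V (ext uu) * ext uu + ext uu * V (ext uu))) p
        = (cs ((- 1) ^ m * disc_const) * (W (ext uu) * ext uu + ext uu * W (ext uu))) p" for p by simp
    have "V (ext uu) = W (ext uu)"
    proof (rule regular_eqI[OF vf_regular[OF V u] vf_regular[OF W u]])
      fix p assume p: "p \<in> M"
      then have "((- 1) ^ m * disc_const) * (2 * uu p * (V (ext uu) p - W (ext uu) p)) = 0"
        using e[of p] by (simp add: algebra_simps)
      then show "V (ext uu) p = W (ext uu) p"
        using uu_sq(2)[OF root p] disc_const_nz by simp
    qed
    then show ?case by (simp only: u_coord_eq[OF root])
  next
    case inv
    let ?d = "ext (\<lambda>p. bb p * dd p * pd (diag_index n) p)"
    have "?P ?d" by (rule coord_closed(2)[where P = ?P]) (fact P)+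
    then have d: "?d \<in> RR" "V ?d = W ?d" by blast+
    have i: "inv_disc n \<Omega> \<in> RR" by (rule regular.inv)
    have "V (inv_disc n \<Omega>) * ?d + inv_disc n \<Omega> * V ?d = W (inv_disc n \<Omega>) * ?d + inv_disc n \<Omega> * W ?d"
      unfolding vf_mult[OF V i d(1), symmetric] vf_mult[OF W i d(1), symmetric] inv_disc_mult
        vf_cs[OF V] vf_cs[OF W] ..
    then have "V (inv_disc n \<Omega>) * ?d = W (inv_disc n \<Omega>) * ?d" using d(2) by simp
    then have e: "(V (inv_disc n \<Omega>) * ?d) p = (W (inv_disc n \<Omega>) * ?d) p" for p by simp
    show ?case
    proof (rule regular_eqI[OF vf_regular[OF V i] vf_regular[OF W i]])
      fix p assume p: "p \<in> M"
      then show "V (inv_disc n \<Omega>) p = W (inv_disc n \<Omega>) p"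
        using e[of p] bb_nz[OF p] dd_nz[OF p] pd_nz[OF p] by simp
    qed
  qed (use P eq in \<open>auto simp del: plus_fun_apply times_fun_apply simp: vf_add[OF V] vf_add[OF W] vf_mult[OF V] vf_mult[OF W]\<close>)
  then show "V f = W f" for f
    using vf_outside[OF V] vf_outside[OF W] by (cases "f \<in> RR") auto
qed

text \<open>Combinations of the partial derivatives along the coordinate curves are derivations,
  because \<open>has_pd\<close> obeys the product rule and determines the derivative
  uniquely.\<close>

lemma vf_exists:
  assumes E: "\<And>s. s \<in> II \<Longrightarrow> E s \<in> RR"
  shows "\<exists>V. VF V \<and> (\<forall>s\<in>II. V (tc s) = E s) \<and> (\<forall>f\<in>RR. V f = (\<Sum>t\<in>II. E t * pdv t f))"
proof -
  define V where "V f = (if f \<in> RR then (\<Sum>t\<in>II. E t * pdv t f) else 0)" for f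
  have fin: "finite II" by (rule I_index_cases(3)[OF n1])
  have "VF V"
    unfolding vector_field_def
  proof (intro conjI ballI allI impI)
    fix f assume f: "f \<in> RR"
    show "V f \<in> RR" unfolding V_def using f by (auto intro!: regular_sum fin regular.mult E pdv)
    fix g assume g: "g \<in> RR"
    have "pdv t (f + g) = pdv t f + pdv t g" if "t \<in> II" for t
      using f g that by (intro pdv_eq has_pd_add regular.add pdv) 
    then show "V (f + g) = V f + V g"
      using f g regular.add[OF f g] by (simp add: V_def distrib_left sum.distrib del: plus_fun_apply)
    have "pdv t (f * g) = pdv t f * g + f * pdv t g" if "t \<in> II" for t
      using f g that by (intro pdv_eq has_pd_mult regular.mult regular.add pdv)
    then have "V (f * g) = (\<Sum>t\<in>II. E t * (pdv t f * g + f * pdv t g))"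
      using regular.mult[OF f g] unfolding V_def by simp
    also have "\<dots> = (\<Sum>t\<in>II. E t * pdv t f) * g + f * (\<Sum>t\<in>II. E t * pdv t g)"
      unfolding sum_distrib_left sum_distrib_right sum.distrib[symmetric]
      by (intro sum.cong refl) (simp add: algebra_simps)
    finally show "V (f * g) = V f * g + f * V g" using f g by (simp add: V_def)
  next
    fix z f assume f: "f \<in> RR"
    have "pdv t (cs z * f) = cs z * pdv t f" if t: "t \<in> II" for t
    proof (rule pdv_eq[OF regular_cmult[OF f] t regular_cmult[OF pdv(1)[OF f t]]])
      have "has_pd t (cs z * f) (cs 0 * f + cs z * pdv t f)"
        by (intro has_pd_mult has_pd_cs pdv f t)
      then show "has_pd t (cs z * f) (cs z * pdv t f)" by (simp add: cs_0)
    qed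
    then have "V (cs z * f) = (\<Sum>t\<in>II. E t * (cs z * pdv t f))"
      using regular_cmult[OF f] unfolding V_def by simp
    also have "\<dots> = cs z * V f"
      unfolding V_def if_P[OF f] sum_distrib_left by (intro sum.cong refl) (rule mult.left_commute)
    finally show "V (cs z * f) = cs z * V f" .
  qed (simp add: V_def)
  moreover have "V (tc s) = E s" if s: "s \<in> II" for s
  proof -
    have "V (tc s) = (\<Sum>t\<in>II. E t * cs (of_bool (s = t)))"
      unfolding V_def if_P[OF tc_regular[OF s]]
      by (intro sum.cong refl arg_cong2[where f = "(*)"] pdv_eq tc_regular s regular.const has_pd_tc)
    also have "\<dots> = (\<Sum>t\<in>II. if s = t then E s else 0)"
      using cs_mult_regular[OF E] by (intro sum.cong refl) (auto simp: cs_0 mult.commute)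
    finally show ?thesis using s fin by simp
  qed
  ultimately show ?thesis unfolding V_def by auto
qed

lemma vf_expand:
  assumes V: "VF V" and f: "f \<in> RR"
  shows "V f = (\<Sum>t\<in>II. V (tc t) * pdv t f)"
proof -
  obtain W where W: "VF W" "\<forall>s\<in>II. W (tc s) = V (tc s)" "\<forall>f\<in>RR. W f = (\<Sum>t\<in>II. V (tc t) * pdv t f)"
    using vf_exists[of "\<lambda>s. V (tc s)"] vf_regular[OF V tc_regular] by blast
  then have "V = W" by (intro vf_unique V) auto
  then show ?thesis using W f by simp
qed

section \<open>Contraction with the Gauss-Manin matrix and the derivative of \<Omega>\<close>

definition Cn :: "nat \<Rightarrow> nat \<Rightarrow> point \<Rightarrow> complex" where "Cn i j p = entry (B1 n (aa p) (bb p)) i j"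
definition Bm :: "complex \<Rightarrow> complex \<Rightarrow> nat \<Rightarrow> nat \<Rightarrow> point \<Rightarrow> complex" where
  "Bm w v i j p = w * (of_nat i * of_bool (j = i)) + v * Cn i j p"

definition base :: "vfield \<Rightarrow> complex \<Rightarrow> complex \<Rightarrow> point \<Rightarrow> bool" where
  "base V w v p \<longleftrightarrow> V (tc 1) p = v - aa p * w \<and> V (tc (n + 2)) p = - of_nat (n + 2) * bb p * w"

lemma base_exists: "p \<in> M \<Longrightarrow> \<exists>w v. base V w v p"
proof -
  assume p: "p \<in> M"
  define K where "K = (of_nat (n + 2) :: complex)"
  define w where "w = - V (tc (n + 2)) p / (K * bb p)"
  have "K \<noteq> 0" unfolding K_def by (simp flip: of_nat_Suc)
  then have "- K * bb p * w = V (tc (n + 2)) p" using bb_nz[OF p] by (simp add: w_def)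
  then have "base V w (V (tc 1) p + aa p * w) p" unfolding base_def K_def by simp
  then show ?thesis by blast
qed

text \<open>After inserting the homogeneity relation \<open>entry_B2\<close>, the multiples of t_1
  cancel; this is the reason for parametrising the base components by w and v.\<close>

lemma B_contract:
  assumes "p \<in> M" "base V w v p" "1 \<le> i" "i \<le> n + 1" "1 \<le> j" "j \<le> n + 1"
  shows "entry (B1 n (aa p) (bb p)) i j * V (tc 1) p + entry (B2 n (aa p) (bb p)) i j * V (tc (n + 2)) p
    = Bm w v i j p"
proof -
  have "entry (B2 n (aa p) (bb p)) i j * V (tc (n + 2)) p
      = - w * (of_nat (n + 2) * bb p * entry (B2 n (aa p) (bb p)) i j)"
    using assms(2) unfolding base_def by (simp only:) (simp only: mult_ac mult_minus_left mult_minus_right)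
  also have "\<dots> = - w * (- of_nat i * of_bool (j = i) - aa p * entry (B1 n (aa p) (bb p)) i j)"
    unfolding entry_B2[OF assms(3-6) point_nondeg[OF assms(1)]] ..
  finally have e: "entry (B2 n (aa p) (bb p)) i j * V (tc (n + 2)) p
      = - w * (- of_nat i * of_bool (j = i) - aa p * entry (B1 n (aa p) (bb p)) i j)" .
  have "V (tc 1) p = v - aa p * w" using assms(2) unfolding base_def by blast
  then show ?thesis unfolding e Bm_def Cn_def by (simp only:) (simp add: algebra_simps)
qed

text \<open>\<Omega> depends on t_1 and t_{n+2} only, so the expansion in partial derivatives has
  two terms, and these combine by d\<Omega> = B \<Omega> + \<Omega> B^tr.\<close>

lemma vf_ww:
  assumes V: "VF V" and p: "p \<in> M" and b: "base V w v p"
    and i: "1 \<le> i" "i \<le> n + 1" and j: "1 \<le> j" "j \<le> n + 1"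
  shows "V (ext (ww i j)) p = (\<Sum>k = 1..n+1. Bm w v i k p * ww k j p + ww i k p * Bm w v j k p)"
proof -
  let ?f = "ext (ww i j)"
  have f: "?f \<in> RR" by (rule Hm_regular[OF Hm_ww[OF i j]])
  define D1 where "D1 = (\<Sum>k = 1..n+1. entry (B1 n (aa p) (bb p)) i k * ww k j p + ww i k p * entry (B1 n (aa p) (bb p)) j k)"
  define D2 where "D2 = (\<Sum>k = 1..n+1. entry (B2 n (aa p) (bb p)) i k * ww k j p + ww i k p * entry (B2 n (aa p) (bb p)) j k)"
  note om_d = om_derivs[OF point_nondeg[OF p] i j, folded ww_def, folded D1_def D2_def]
  have pd: "((\<lambda>z. ?f (curve t p z)) has_field_derivative pdv t ?f p) (at 0)" if "t \<in> II" for t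
    using pdv(2)[OF f that] p unfolding has_pd_def by blast
  have ev: "eventually (\<lambda>z. ?f (curve t p z) = om i j (aa p + of_bool (t = 1) * z) (bb p + of_bool (t = n + 2) * z)) (nhds 0)"
    if "t \<in> II" for t
    using curve[OF that p]
  proof eventually_elim
    case (elim z)
    then have "curve t p z \<in> M" by (simp add: on_curve_def)
    then show ?case using on_curve_ab[OF elim p] by (simp add: ww_def)
  qed
  have pd': "((\<lambda>z. om i j (aa p + of_bool (t = 1) * z) (bb p + of_bool (t = n + 2) * z)) has_field_derivative pdv t ?f p) (at 0)"
    if "t \<in> II" for t
    using DERIV_cong_ev[OF refl ev[OF that] refl] pd[OF that] by simp
  have I: "1 \<in> II" "n + 2 \<in> II" "finite II" using I_index_cases[OF n1] by auto
  have sh: "((\<lambda>z. g (x + z)) has_field_derivative D) (at 0)" if "(g has_field_derivative D) (at x)"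
    for g :: "complex \<Rightarrow> complex" and x D
    using DERIV_at_within_shift[of g D x 0 UNIV] that by simp
  have "((\<lambda>z. om i j (aa p + z) (bb p)) has_field_derivative D1) (at 0)"
    by (rule sh[OF om_d(1)])
  then have 1: "pdv 1 ?f p = D1"
    using pd'[OF I(1)] by (auto dest: DERIV_unique)
  have "((\<lambda>z. om i j (aa p) (bb p + z)) has_field_derivative D2) (at 0)"
    by (rule sh[OF om_d(2)])
  then have 2: "pdv (n + 2) ?f p = D2"
    using pd'[OF I(2)] by (auto dest: DERIV_unique)
  have 0: "pdv t ?f p = 0" if "t \<in> II - {1, n + 2}" for t
  proof -
    have "((\<lambda>z. om i j (aa p) (bb p)) has_field_derivative pdv t ?f p) (at 0)"
      using pd'[of t] that by simp
    from DERIV_unique[OF this DERIV_const] show ?thesis .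
  qed
  have "V ?f p = (\<Sum>t\<in>II. V (tc t) p * pdv t ?f p)"
    unfolding vf_expand[OF V f] by (simp add: sum_func_apply)
  also have "\<dots> = (\<Sum>t\<in>{1, n + 2}. V (tc t) p * pdv t ?f p)"
    by (rule sum.mono_neutral_right) (use I 0 in auto)
  also have "\<dots> = V (tc 1) p * D1 + V (tc (n + 2)) p * D2" using 1 2 by simp
  also have "\<dots> = (\<Sum>k = 1..n+1. (entry (B1 n (aa p) (bb p)) i k * V (tc 1) p + entry (B2 n (aa p) (bb p)) i k * V (tc (n + 2)) p) * ww k j p
      + ww i k p * (entry (B1 n (aa p) (bb p)) j k * V (tc 1) p + entry (B2 n (aa p) (bb p)) j k * V (tc (n + 2)) p))"
    unfolding D1_def D2_def sum_distrib_left sum.distrib[symmetric]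
    by (intro sum.cong refl) (simp only: algebra_simps)
  also have "\<dots> = (\<Sum>k = 1..n+1. Bm w v i k p * ww k j p + ww i k p * Bm w v j k p)"
    using B_contract[OF p b] i j by (intro sum.cong refl) auto
  finally show ?thesis .
qed

definition lieA :: "(nat \<Rightarrow> nat \<Rightarrow> complex) \<Rightarrow> bool" where
  "lieA A \<longleftrightarrow> (\<forall>i\<in>{1..n+1}. \<forall>k\<in>{1..n+1}. (\<Sum>j = 1..n+1. A i j * ph j k + ph i j * A k j) = 0)"

text \<open>The linearisation of \<open>S \<Omega> S\<^sup>t\<^sup>r = \<Phi>\<close> determines all entries from the coordinate entries.\<close>

lemma tangent_zero:
  fixes x :: "nat \<Rightarrow> nat \<Rightarrow> complex"
  assumes p: "p \<in> M"
    and lin: "\<And>i k. \<lbrakk>1 \<le> i; i \<le> n + 1; 1 \<le> k; k \<le> n + 1\<rbrakk> \<Longrightarrow>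
      (\<Sum>j = 1..n+1. \<Sum>l = 1..n+1. x i j * ww j l p * ss k l p)
      + (\<Sum>j = 1..n+1. \<Sum>l = 1..n+1. ss i j p * ww j l p * x k l) = 0"
    and up: "\<And>i j. i < j \<Longrightarrow> x i j = 0" and x11: "x 1 1 = 0"
    and fr: "\<And>i j. free n i j \<Longrightarrow> x i j = 0"
  shows "1 \<le> i \<Longrightarrow> i \<le> n + 1 \<Longrightarrow> 1 \<le> j \<Longrightarrow> x i j = 0"
proof (induction i arbitrary: j rule: less_induct)
  case (less i)
  note rows = less.IH and i = less.prems(1,2)
  show ?case using less.prems(3)
  proof (induction "i - j" arbitrary: j rule: less_induct)
    case less
    have cols: "x i j' = 0" if "j < j'" for j'
      using less.hyps[of j'] less.prems that up[of i j'] by (cases "i < j'") auto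
    show ?case
    proof (cases "i < j \<or> free n i j \<or> (i = 1 \<and> j = 1)")
      case True
      then show ?thesis using up fr x11 by blast
    next
      case False
      define k where "k = n + 2 - j"
      have f: "j \<le> i" "i + j \<ge> 2 * m + 2" using False less.prems by (auto simp: free_iff)
      have k: "1 \<le> k" "k \<le> n + 1" "k + j = n + 2" "k \<le> i" "n + 2 - k = j" "n + 2 - j = k"
        using f i less.prems m_bounds by (auto simp: k_def)
      have nz: "ww j k p * ss k k p \<noteq> 0"
        using ww_antidiag_nz[OF p, of j] ss_diag_nz[OF p, of k] k less.prems by auto
      have "(\<Sum>j = 1..n+1. \<Sum>l = 1..n+1. x i j * ww j l p * ss k l p)
          = x i (n + 2 - k) * ww (n + 2 - k) k p * ss k k p
            + (\<Sum>j = n+2-k+1..i. \<Sum>l = 1..k. x i j * ww j l p * ss k l p)"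
        by (rule anti_sum) (use i k f in \<open>auto intro: up ss_upper[OF p] ww_zero[OF p]\<close>)
      also have "(\<Sum>j = n+2-k+1..i. \<Sum>l = 1..k. x i j * ww j l p * ss k l p) = 0"
        using cols k by (intro sum.neutral ballI) auto
      finally have Q: "(\<Sum>j = 1..n+1. \<Sum>l = 1..n+1. x i j * ww j l p * ss k l p)
          = x i j * (ww j k p * ss k k p)" using k by simp
      show ?thesis
      proof (cases "k = i")
        case False
        \<comment> \<open>The variation of row k < i vanishes by induction, so only the first sum is
          left.\<close>
        have "(\<Sum>j = 1..n+1. \<Sum>l = 1..n+1. ss i j p * ww j l p * x k l) = 0"
          using rows[of k] False k by (intro sum.neutral ballI) auto
        with lin[OF i k(1,2)] Q have "x i j * (ww j k p * ss k k p) + 0 = 0" by (simp only:)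
        then show ?thesis using nz by (simp only: mult_eq_0_iff add_0_right) simp
      next
        case True
        \<comment> \<open>Here row i is paired with itself; n is even, so both sums agree by
          symmetry of the form and the factor 2 can be cancelled.\<close>
        have ev: "even n" using f k True m_odd by (cases "even n") auto
        have "(\<Sum>j = 1..n+1. \<Sum>l = 1..n+1. ss i j p * ww j l p * x i l)
            = (\<Sum>l = 1..n+1. \<Sum>j = 1..n+1. ss i j p * ww j l p * x i l)" by (rule sum.swap)
        also have "\<dots> = (\<Sum>l = 1..n+1. \<Sum>j = 1..n+1. x i l * ww l j p * ss i j p)"
        proof (intro sum.cong refl)
          fix l j assume "l \<in> {1..n+1}" "j \<in> {1..n+1}"
          then have "ww j l p = ww l j p" using ww_sym[OF p, of l j] ev by simp
          then show "ss i j p * ww j l p * x i l = x i l * ww l j p * ss i j p" by simp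
        qed
        finally have Q': "(\<Sum>j = 1..n+1. \<Sum>l = 1..n+1. ss i j p * ww j l p * x i l)
            = x i j * (ww j k p * ss k k p)" using Q unfolding True by (simp only:)
        have "x i j * (ww j k p * ss k k p) + x i j * (ww j k p * ss k k p) = 0"
          using lin[OF i i] Q Q' unfolding True by (simp only:)
        then have "2 * (x i j * (ww j k p * ss k k p)) = 0" by (simp only: mult_2)
        then show ?thesis using nz by (simp only: mult_eq_0_iff) simp
      qed
    qed
  qed
qed

lemma vf_unique_free:
  assumes "VF V" "VF W" "V (tc 1) = W (tc 1)" "V (tc (n + 2)) = W (tc (n + 2))"
    and "\<And>i j. free n i j \<Longrightarrow> V (sf i j) = W (sf i j)"
  shows "V = W"
proof (rule vf_unique[OF assms(1,2)])
  fix s assume s: "s \<in> II"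
  show "V (tc s) = W (tc s)"
  proof (cases "s \<in> {1, n + 2}")
    case False
    obtain i j where ij: "t_pos n s = (i, j)" by (cases "t_pos n s")
    have s': "s \<in> II - {1, n + 2}" using s False by simp
    show ?thesis unfolding tc_sf[OF s' ij] by (rule assms(5)[OF t_pos_free[OF s' ij]])
  qed (use assms in auto)
qed

lemma vf_exists_free:
  assumes "\<alpha> \<in> RR" "\<beta> \<in> RR" "\<And>i j. free n i j \<Longrightarrow> G i j \<in> RR"
  obtains V where "VF V" "V (tc 1) = \<alpha>" "V (tc (n + 2)) = \<beta>" "\<And>i j. free n i j \<Longrightarrow> V (sf i j) = G i j"
proof -
  define E where "E s = (if s = 1 then \<alpha> else if s = n + 2 then \<beta> else G (fst (t_pos n s)) (snd (t_pos n s)))" for s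
  have "E s \<in> RR" if "s \<in> II" for s
    using assms that t_pos_free[of s "fst (t_pos n s)" "snd (t_pos n s)"] by (simp add: E_def)
  then obtain V where V: "VF V" "\<forall>s\<in>II. V (tc s) = E s" using vf_exists[of E] by blast
  show ?thesis
  proof (rule that[OF V(1)])
    have e: "V (tc 1) = E 1" "V (tc (n + 2)) = E (n + 2)" using V(2) I_index_cases(1,2)[OF n1] by blast+
    show "V (tc 1) = \<alpha>" "V (tc (n + 2)) = \<beta>" using e n1 by (simp_all add: E_def)
    fix i j assume "free n i j"
    then obtain t where t: "t \<in> II - {1, n + 2}" "t_pos n t = (i, j)" using free_t_pos by blast
    show "V (sf i j) = G i j" using V(2) t unfolding tc_sf[OF t, symmetric] by (simp add: E_def)
  qed
qed

subsection \<open>Tangency and Gauss-Manin matrices\<close>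

definition SB :: "complex \<Rightarrow> complex \<Rightarrow> nat \<Rightarrow> nat \<Rightarrow> point \<Rightarrow> complex" where
  "SB w v i j p = (\<Sum>l = 1..n+1. ss i l p * Bm w v l j p)"

definition cc :: "nat \<Rightarrow> point \<Rightarrow> complex" where "cc j p = ctail j (aa p) (bb p)"

text \<open>Right multiplication by the companion matrix moves each column one step to the right;
  its last row adds multiples of the last column.\<close>

lemma SB_eq:
  assumes "1 \<le> j" "j \<le> n + 1"
  shows "SB w v i j p = w * of_nat j * ss i j p + v * (ss i (j - 1) p + ss i (n + 1) p * cc j p)"
proof -
  have C: "Cn l j p = of_bool (l \<le> n \<and> j = l + 1) + of_bool (l = n + 1) * cc j p" if "l \<in> {1..n+1}" for l
    using that assms unfolding Cn_def cc_def by (auto simp: entry_B1)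
  have "SB w v i j p = (\<Sum>l = 1..n+1. (if l = j then w * of_nat j * ss i j p else 0)
     + ((if l = j - 1 then v * ss i (j - 1) p else 0) + (if l = n + 1 then v * (ss i (n + 1) p * cc j p) else 0)))"
    unfolding SB_def Bm_def using assms C by (intro sum.cong refl) (auto simp: algebra_simps)
  also have "\<dots> = w * of_nat j * ss i j p + (v * ss i (j - 1) p + v * (ss i (n + 1) p * cc j p))"
    unfolding sum.distrib using assms by (auto simp: sum.delta ss_out simp del: sum.cl_ivl_Suc)
  finally show ?thesis by (simp add: algebra_simps)
qed

definition form :: "point \<Rightarrow> (nat \<Rightarrow> complex) \<Rightarrow> (nat \<Rightarrow> complex) \<Rightarrow> complex" where
  "form p f g = (\<Sum>j = 1..n+1. \<Sum>l = 1..n+1. f j * ww j l p * g l)"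

lemma form_diff: "form p (\<lambda>j. f j - g j) h = form p f h - form p g h"
  "form p h (\<lambda>j. f j - g j) = form p h f - form p h g"
  by (simp_all add: form_def left_diff_distrib right_diff_distrib sum_subtractf del: sum.cl_ivl_Suc)

lemma form_sum: "form p (\<lambda>j. \<Sum>r\<in>A. z r * f r j) h = (\<Sum>r\<in>A. z r * form p (f r) h)"
  "form p h (\<lambda>j. \<Sum>r\<in>A. z r * f r j) = (\<Sum>r\<in>A. z r * form p h (f r))"
proof -
  have "form p (\<lambda>j. \<Sum>r\<in>A. z r * f r j) h = (\<Sum>j = 1..n+1. \<Sum>l = 1..n+1. \<Sum>r\<in>A. z r * (f r j * ww j l p * h l))"
    unfolding form_def sum_distrib_right by (simp only: mult.assoc)
  also have "\<dots> = (\<Sum>j = 1..n+1. \<Sum>r\<in>A. \<Sum>l = 1..n+1. z r * (f r j * ww j l p * h l))"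
    by (intro sum.cong refl sum.swap)
  also have "\<dots> = (\<Sum>r\<in>A. \<Sum>j = 1..n+1. \<Sum>l = 1..n+1. z r * (f r j * ww j l p * h l))"
    by (rule sum.swap)
  finally show "form p (\<lambda>j. \<Sum>r\<in>A. z r * f r j) h = (\<Sum>r\<in>A. z r * form p (f r) h)"
    unfolding form_def sum_distrib_left .
  have "form p h (\<lambda>j. \<Sum>r\<in>A. z r * f r j) = (\<Sum>j = 1..n+1. \<Sum>l = 1..n+1. \<Sum>r\<in>A. z r * (h j * ww j l p * f r l))"
    unfolding form_def sum_distrib_left by (simp only: mult_ac)
  also have "\<dots> = (\<Sum>j = 1..n+1. \<Sum>r\<in>A. \<Sum>l = 1..n+1. z r * (h j * ww j l p * f r l))"
    by (intro sum.cong refl sum.swap)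
  also have "\<dots> = (\<Sum>r\<in>A. \<Sum>j = 1..n+1. \<Sum>l = 1..n+1. z r * (h j * ww j l p * f r l))"
    by (rule sum.swap)
  finally show "form p h (\<lambda>j. \<Sum>r\<in>A. z r * f r j) = (\<Sum>r\<in>A. z r * form p h (f r))"
    unfolding form_def sum_distrib_left .
qed

lemma form_ww_deriv:
  "(\<Sum>j = 1..n+1. \<Sum>l = 1..n+1. ss i j p * (\<Sum>r = 1..n+1. Bm w v j r p * ww r l p + ww j r p * Bm w v l r p) * ss k l p)
    = form p (\<lambda>j. SB w v i j p) (\<lambda>l. ss k l p) + form p (\<lambda>j. ss i j p) (\<lambda>l. SB w v k l p)"
proof -
  have "(\<Sum>j = 1..n+1. \<Sum>l = 1..n+1. ss i j p * (\<Sum>r = 1..n+1. Bm w v j r p * ww r l p + ww j r p * Bm w v l r p) * ss k l p)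
     = (\<Sum>j = 1..n+1. \<Sum>l = 1..n+1. \<Sum>r = 1..n+1. ss i j p * Bm w v j r p * ww r l p * ss k l p)
     + (\<Sum>j = 1..n+1. \<Sum>l = 1..n+1. \<Sum>r = 1..n+1. ss i j p * ww j r p * (ss k l p * Bm w v l r p))"
    unfolding sum.distrib[symmetric] sum_distrib_left sum_distrib_right
    by (intro sum.cong refl) (simp only: algebra_simps)
  also have "(\<Sum>j = 1..n+1. \<Sum>l = 1..n+1. \<Sum>r = 1..n+1. ss i j p * Bm w v j r p * ww r l p * ss k l p)
     = (\<Sum>j = 1..n+1. \<Sum>r = 1..n+1. \<Sum>l = 1..n+1. ss i j p * Bm w v j r p * ww r l p * ss k l p)"
    by (intro sum.cong refl sum.swap)
  also have "\<dots> = (\<Sum>r = 1..n+1. \<Sum>j = 1..n+1. \<Sum>l = 1..n+1. ss i j p * Bm w v j r p * ww r l p * ss k l p)"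
    by (rule sum.swap)
  also have "\<dots> = (\<Sum>r = 1..n+1. \<Sum>l = 1..n+1. \<Sum>j = 1..n+1. ss i j p * Bm w v j r p * ww r l p * ss k l p)"
    by (intro sum.cong refl sum.swap)
  also have "\<dots> = form p (\<lambda>j. SB w v i j p) (\<lambda>l. ss k l p)"
    unfolding form_def SB_def sum_distrib_right ..
  also have "(\<Sum>j = 1..n+1. \<Sum>l = 1..n+1. \<Sum>r = 1..n+1. ss i j p * ww j r p * (ss k l p * Bm w v l r p))
     = (\<Sum>j = 1..n+1. \<Sum>r = 1..n+1. \<Sum>l = 1..n+1. ss i j p * ww j r p * (ss k l p * Bm w v l r p))"
    by (intro sum.cong refl sum.swap)
  also have "\<dots> = form p (\<lambda>j. ss i j p) (\<lambda>l. SB w v k l p)"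
    unfolding form_def SB_def sum_distrib_left ..
  finally show ?thesis .
qed

lemma sf_11: "sf 1 1 = cs 1"
  unfolding sf_def cst_def by (rule ext_cong) (rule ss_11)

lemma sf_upper: "i < j \<Longrightarrow> sf i j = 0"
  using ss_upper[of _ i j] by (auto simp: sf_def on_moduli_def)

text \<open>V annihilates the right side of S \<Omega> S^tr = \<Phi>, which is constant. The
  contribution of V(\<Omega>) is moved to the rows of S, where it appears through S B(V).\<close>

lemma form_deriv:
  assumes V: "VF V" and p: "p \<in> M" and b: "base V w v p"
    and i: "1 \<le> i" "i \<le> n + 1" and k: "1 \<le> k" "k \<le> n + 1"
  shows "form p (\<lambda>j. V (sf i j) p) (\<lambda>l. ss k l p) + form p (\<lambda>j. ss i j p) (\<lambda>l. V (sf k l) p)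
    + (form p (\<lambda>j. SB w v i j p) (\<lambda>l. ss k l p) + form p (\<lambda>j. ss i j p) (\<lambda>l. SB w v k l p)) = 0"
proof -
  have W: "ext (ww j l) \<in> RR" if "j \<in> {1..n+1}" "l \<in> {1..n+1}" for j l
    using that by (intro Hm_regular[OF Hm_ww]) auto
  have T: "sf i j * ext (ww j l) * sf k l \<in> RR" if "j \<in> {1..n+1}" "l \<in> {1..n+1}" for j l
    using that by (intro regular.mult sf_regular W)
  let ?F = "\<Sum>j = 1..n+1. \<Sum>l = 1..n+1. sf i j * ext (ww j l) * sf k l"
  have "?F = cs (ph i k)"
  proof (rule regular_eqI)
    show "?F \<in> RR" by (intro regular_sum T) auto
    show "cs (ph i k) \<in> RR" by (rule regular.const)
    fix p assume p: "p \<in> M"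
    have "?F p = (\<Sum>j = 1..n+1. \<Sum>l = 1..n+1. ss i j p * ww j l p * ss k l p)"
      unfolding sum_func_apply using p by (simp del: sum.cl_ivl_Suc)
    also have "\<dots> = ph i k" by (rule quad[OF p i k])
    finally show "?F p = cs (ph i k) p" unfolding cst_in[OF p] .
  qed
  then have "V ?F = 0" using vf_cs[OF V] by simp
  moreover have "V ?F = (\<Sum>j = 1..n+1. \<Sum>l = 1..n+1. V (sf i j * ext (ww j l) * sf k l))"
  proof -
    have "V ?F = (\<Sum>j = 1..n+1. V (\<Sum>l = 1..n+1. sf i j * ext (ww j l) * sf k l))"
      by (rule vf_sum[OF V]) (auto intro!: regular_sum T simp del: sum.cl_ivl_Suc)
    also have "\<dots> = (\<Sum>j = 1..n+1. \<Sum>l = 1..n+1. V (sf i j * ext (ww j l) * sf k l))"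
      by (intro sum.cong refl vf_sum[OF V] T) auto
    finally show ?thesis .
  qed
  ultimately have "(\<Sum>j = 1..n+1. \<Sum>l = 1..n+1. V (sf i j * ext (ww j l) * sf k l)) p = 0"
    by (simp only: zero_fun_apply)
  then have "(\<Sum>j = 1..n+1. \<Sum>l = 1..n+1. V (sf i j * ext (ww j l) * sf k l) p) = 0"
    by (simp only: sum_func_apply)
  also have "(\<Sum>j = 1..n+1. \<Sum>l = 1..n+1. V (sf i j * ext (ww j l) * sf k l) p)
     = (\<Sum>j = 1..n+1. \<Sum>l = 1..n+1. V (sf i j) p * ww j l p * ss k l p + ss i j p * ww j l p * V (sf k l) p
        + ss i j p * (\<Sum>r = 1..n+1. Bm w v j r p * ww r l p + ww j r p * Bm w v l r p) * ss k l p)"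
  proof (intro sum.cong refl)
    fix j l assume jl: "j \<in> {1..n+1}" "l \<in> {1..n+1}"
    have "V (sf i j * ext (ww j l) * sf k l)
       = (V (sf i j) * ext (ww j l) + sf i j * V (ext (ww j l))) * sf k l + sf i j * ext (ww j l) * V (sf k l)"
      using W[OF jl] by (simp only: vf_mult[OF V] regular.mult sf_regular)
    moreover have "V (ext (ww j l)) p = (\<Sum>r = 1..n+1. Bm w v j r p * ww r l p + ww j r p * Bm w v l r p)"
      by (rule vf_ww[OF V p b]) (use jl in auto)
    ultimately show "V (sf i j * ext (ww j l) * sf k l) p
       = V (sf i j) p * ww j l p * ss k l p + ss i j p * ww j l p * V (sf k l) p
        + ss i j p * (\<Sum>r = 1..n+1. Bm w v j r p * ww r l p + ww j r p * Bm w v l r p) * ss k l p"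
      using p by (simp only: plus_fun_apply times_fun_apply sf_in ext_in) (simp only: algebra_simps)
  qed
  also have "\<dots> = form p (\<lambda>j. V (sf i j) p) (\<lambda>l. ss k l p) + form p (\<lambda>j. ss i j p) (\<lambda>l. V (sf k l) p)
    + (form p (\<lambda>j. SB w v i j p) (\<lambda>l. ss k l p) + form p (\<lambda>j. ss i j p) (\<lambda>l. SB w v k l p))"
    unfolding form_ww_deriv[symmetric] by (simp only: form_def sum.distrib)
  finally show ?thesis .
qed

lemma form_ss: "p \<in> M \<Longrightarrow> 1 \<le> i \<Longrightarrow> i \<le> n + 1 \<Longrightarrow> 1 \<le> k \<Longrightarrow> k \<le> n + 1 \<Longrightarrow>
    form p (\<lambda>j. ss i j p) (\<lambda>l. ss k l p) = ph i k"
  unfolding form_def by (rule quad)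

text \<open>Entry (i, j) of A S - S B(E), the value that E takes on s_ij if A is its Gauss-Manin
  matrix.\<close>

definition TT :: "(nat \<Rightarrow> nat \<Rightarrow> complex) \<Rightarrow> complex \<Rightarrow> complex \<Rightarrow> nat \<Rightarrow> nat \<Rightarrow> point \<Rightarrow> complex" where
  "TT A w v i j p = (\<Sum>k = 1..n+1. A i k * ss k j p) - SB w v i j p"

text \<open>The difference of the actual and the expected derivative of S solves the homogeneous
  linearised equation: the terms with B cancel by \<open>form_deriv\<close>, those with A because A
  is infinitesimally orthogonal or symplectic for \<Phi>. It vanishes on the free entries, at (1, 1)
  and above the diagonal, hence everywhere.\<close>

lemma tangent:
  assumes V: "VF V" and p: "p \<in> M" and b: "base V w v p" and A: "lieA A"
    and up: "\<And>i j. \<lbrakk>1 \<le> i; i < j; j \<le> n + 1\<rbrakk> \<Longrightarrow> TT A w v i j p = 0" and T11: "TT A w v 1 1 p = 0"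
    and fr: "\<And>i j. free n i j \<Longrightarrow> V (sf i j) p = TT A w v i j p"
    and ij: "1 \<le> i" "i \<le> n + 1" "1 \<le> j" "j \<le> n + 1"
  shows "V (sf i j) p = TT A w v i j p"
proof -
  \<comment> \<open>Cut off outside the matrix, since \<open>tangent_zero\<close> asks for zeros at
    all i < j while \<open>up\<close> speaks of matrix positions only.\<close>
  define x where "x i j = (if 1 \<le> i \<and> j \<le> n + 1 then V (sf i j) p - TT A w v i j p else 0)" for i j
  have z: "V 0 = 0" by (rule vf_zero[OF V])
  have "x i j = 0"
  proof (rule tangent_zero[OF p _ _ _ _ ij(1,2,3)])
    show "x i j = 0" if "i < j" for i j
      using that up[of i j] sf_upper[OF that] z by (simp add: x_def)
    show "x 1 1 = 0" using T11 vf_cs[OF V] sf_11 by (simp add: x_def)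
    show "x i j = 0" if "free n i j" for i j using fr[OF that] by (simp add: x_def)
    fix i k assume i: "1 \<le> i" "i \<le> n + 1" and k: "1 \<le> k" "k \<le> n + 1"
    let ?s = "\<lambda>i j. ss i j p"
    have xf: "form p (x i) g = form p (\<lambda>j. V (sf i j) p - TT A w v i j p) g"
       "form p g (x i) = form p g (\<lambda>j. V (sf i j) p - TT A w v i j p)" if "1 \<le> i" for g i
      unfolding form_def using that by (intro sum.cong refl; simp add: x_def)+
    have T1: "form p (\<lambda>j. TT A w v i j p) (?s k)
        = (\<Sum>r = 1..n+1. A i r * ph r k) - form p (\<lambda>j. SB w v i j p) (?s k)"
      unfolding TT_def form_diff form_sum using form_ss[OF p _ _ k] by (simp del: sum.cl_ivl_Suc)
    have T2: "form p (?s i) (\<lambda>j. TT A w v k j p)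
        = (\<Sum>r = 1..n+1. A k r * ph i r) - form p (?s i) (\<lambda>j. SB w v k j p)"
      unfolding TT_def form_diff form_sum using form_ss[OF p i] by (simp del: sum.cl_ivl_Suc)
    have lie: "(\<Sum>r = 1..n+1. A i r * ph r k) + (\<Sum>r = 1..n+1. A k r * ph i r) = 0"
      using A i k unfolding lieA_def by (simp add: sum.distrib mult.commute del: sum.cl_ivl_Suc)
    have arith: "e - (f - g) + (f' - (h - g')) = 0" if "e + f' + (g + g') = 0" "f + h = 0"
      for e f g f' h g' :: complex
    proof -
      have "e - (f - g) + (f' - (h - g')) = (e + f' + (g + g')) - (f + h)" by simp
      then show ?thesis using that by simp
    qed
    have "form p (x i) (?s k) + form p (?s i) (x k) = 0"
      unfolding xf[OF i(1)] xf[OF k(1)] form_diff T1 T2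
      by (rule arith[OF form_deriv[OF V p b i k] lie])
    then show "(\<Sum>j = 1..n+1. \<Sum>l = 1..n+1. x i j * ww j l p * ss k l p)
      + (\<Sum>j = 1..n+1. \<Sum>l = 1..n+1. ss i j p * ww j l p * x k l) = 0"
      unfolding form_def .
  qed
  then show ?thesis using ij by (simp add: x_def)
qed

lemma GM_iff:
  assumes V: "VF V" and A: "A \<in> carrier_mat (n + 1) (n + 1)" and AR: "elements_mat A \<subseteq> RR"
    and b: "\<And>p. p \<in> M \<Longrightarrow> base V (w p) (v p) p"
  shows "has_GM_matrix n \<Omega> V A \<longleftrightarrow> (\<forall>i\<in>{1..n+1}. \<forall>j\<in>{1..n+1}. \<forall>p\<in>M.
     V (sf i j) p = TT (\<lambda>i k. entry A i k p) (w p) (v p) i j p)"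
proof -
  have Sc: "Smat n \<Omega> \<in> carrier_mat (n + 1) (n + 1)" and Bc: "B_at n \<Omega> V \<in> carrier_mat (n + 1) (n + 1)"
    by (simp_all add: Smat_def B_at_def)
  have S: "entry (Smat n \<Omega>) i j = sf i j" if "1 \<le> i" "i \<le> n + 1" "1 \<le> j" "j \<le> n + 1" for i j
    using that unfolding Smat_def entry_mat1[OF that] sf_def by (intro ext_cong) (simp add: ss_def split_beta)
  have Ar: "entry A i j \<in> RR" if "1 \<le> i" "i \<le> n + 1" "1 \<le> j" "j \<le> n + 1" for i j
    unfolding entry_def by (rule subsetD[OF AR], rule elements_matI[OF A, of "i - 1" "j - 1"]) (use that in auto)
  have eq: "entry (A * Smat n \<Omega> - Smat n \<Omega> * B_at n \<Omega> V) i j p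
      = (if p \<in> M then TT (\<lambda>i k. entry A i k p) (w p) (v p) i j p else 0)"
    if ij: "1 \<le> i" "i \<le> n + 1" "1 \<le> j" "j \<le> n + 1" for i j p
  proof -
    have c: "Smat n \<Omega> * B_at n \<Omega> V \<in> carrier_mat (n + 1) (n + 1)" using Sc Bc by simp
    have "entry (A * Smat n \<Omega> - Smat n \<Omega> * B_at n \<Omega> V) i j p
        = (\<Sum>k = 1..n+1. entry A i k p * entry (Smat n \<Omega>) k j p)
          - (\<Sum>k = 1..n+1. entry (Smat n \<Omega>) i k p * entry (B_at n \<Omega> V) k j p)"
      unfolding entry_diff[OF c ij] entry_mult[OF A Sc ij] entry_mult[OF Sc Bc ij]
      by (simp add: sum_func_apply del: sum.cl_ivl_Suc)
    also have "(\<Sum>k = 1..n+1. entry A i k p * entry (Smat n \<Omega>) k j p)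
        = (\<Sum>k = 1..n+1. entry A i k p * sf k j p)"
      using ij S by (intro sum.cong refl) auto
    also have "(\<Sum>k = 1..n+1. entry (Smat n \<Omega>) i k p * entry (B_at n \<Omega> V) k j p)
        = (\<Sum>k = 1..n+1. sf i k p * entry (B_at n \<Omega> V) k j p)"
      using ij S by (intro sum.cong refl) auto
    also have "(\<Sum>k = 1..n+1. entry A i k p * sf k j p) - (\<Sum>k = 1..n+1. sf i k p * entry (B_at n \<Omega> V) k j p)
        = (if p \<in> M then TT (\<lambda>i k. entry A i k p) (w p) (v p) i j p else 0)"
    proof (cases "p \<in> M")
      case True
      have "entry (B_at n \<Omega> V) k j p = Bm (w p) (v p) k j p" if "k \<in> {1..n+1}" for k
      proof -
        have k: "1 \<le> k" "k \<le> n + 1" using that by auto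
        show ?thesis
          using B_contract[OF True b[OF True] k ij(3,4)] True
          unfolding B_at_def entry_mat1[OF k ij(3,4)] by (simp add: split_beta aa_def bb_def)
      qed
      then show ?thesis using True unfolding TT_def SB_def by (simp del: sum.cl_ivl_Suc)
    next
      case False
      then show ?thesis by (simp add: sf_def del: sum.cl_ivl_Suc)
    qed
    finally show ?thesis .
  qed
  have "has_GM_matrix n \<Omega> V A \<longleftrightarrow> (map_mat V (Smat n \<Omega>) = A * Smat n \<Omega> - Smat n \<Omega> * B_at n \<Omega> V)"
    using A AR by (simp add: has_GM_matrix_def)
  also have "\<dots> \<longleftrightarrow> (\<forall>i\<in>{1..n+1}. \<forall>j\<in>{1..n+1}. V (sf i j) = entry (A * Smat n \<Omega> - Smat n \<Omega> * B_at n \<Omega> V) i j)"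
  proof
    assume m: "map_mat V (Smat n \<Omega>) = A * Smat n \<Omega> - Smat n \<Omega> * B_at n \<Omega> V"
    show "\<forall>i\<in>{1..n+1}. \<forall>j\<in>{1..n+1}. V (sf i j) = entry (A * Smat n \<Omega> - Smat n \<Omega> * B_at n \<Omega> V) i j"
      unfolding m[symmetric] using entry_map[OF Sc] S by (metis atLeastAtMost_iff)
  next
    assume e: "\<forall>i\<in>{1..n+1}. \<forall>j\<in>{1..n+1}. V (sf i j) = entry (A * Smat n \<Omega> - Smat n \<Omega> * B_at n \<Omega> V) i j"
    show "map_mat V (Smat n \<Omega>) = A * Smat n \<Omega> - Smat n \<Omega> * B_at n \<Omega> V"
    proof (rule eq_mat_entryI)
      fix i j assume ij: "1 \<le> i" "i \<le> n + 1" "1 \<le> j" "j \<le> n + 1"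
      show "entry (map_mat V (Smat n \<Omega>)) i j = entry (A * Smat n \<Omega> - Smat n \<Omega> * B_at n \<Omega> V) i j"
        unfolding entry_map[OF Sc ij] S[OF ij] using e ij by simp
    qed (use A Sc Bc in auto)
  qed
  also have "\<dots> \<longleftrightarrow> (\<forall>i\<in>{1..n+1}. \<forall>j\<in>{1..n+1}. \<forall>p\<in>M.
     V (sf i j) p = TT (\<lambda>i k. entry A i k p) (w p) (v p) i j p)"
  proof (intro ball_cong refl)
    fix i j assume "i \<in> {1..n+1}" "j \<in> {1..n+1}"
    then have ij: "1 \<le> i" "i \<le> n + 1" "1 \<le> j" "j \<le> n + 1" by auto
    show "V (sf i j) = entry (A * Smat n \<Omega> - Smat n \<Omega> * B_at n \<Omega> V) i j
      \<longleftrightarrow> (\<forall>p\<in>M. V (sf i j) p = TT (\<lambda>i k. entry A i k p) (w p) (v p) i j p)"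
    proof
      assume e: "V (sf i j) = entry (A * Smat n \<Omega> - Smat n \<Omega> * B_at n \<Omega> V) i j"
      show "\<forall>p\<in>M. V (sf i j) p = TT (\<lambda>i k. entry A i k p) (w p) (v p) i j p"
        unfolding e eq[OF ij] by simp
    next
      assume e: "\<forall>p\<in>M. V (sf i j) p = TT (\<lambda>i k. entry A i k p) (w p) (v p) i j p"
      show "V (sf i j) = entry (A * Smat n \<Omega> - Smat n \<Omega> * B_at n \<Omega> V) i j"
      proof
        fix p show "V (sf i j) p = entry (A * Smat n \<Omega> - Smat n \<Omega> * B_at n \<Omega> V) i j p"
          unfolding eq[OF ij] using e regular_outside[OF vf_regular[OF V sf_regular], of p] by simp
      qed
    qed
  qed
  finally show ?thesis .
qed

subsection \<open>The vector fields of the Lie algebra and the modular vector field\<close>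

lemma TT_cong: "(\<And>k. k \<in> {1..n+1} \<Longrightarrow> A i k = B i k) \<Longrightarrow> TT A w v i j p = TT B w v i j p"
  unfolding TT_def by (intro arg_cong2[where f = "(-)"] sum.cong refl) simp

lemma base_exists_fun: "\<exists>w v. \<forall>p\<in>M. base V (w p) (v p) p"
proof -
  have "\<forall>p\<in>M. \<exists>x. base V (fst x) (snd x) p" using base_exists by fastforce
  then obtain f where "\<forall>p\<in>M. base V (fst (f p)) (snd (f p)) p" by (metis bchoice)
  then show ?thesis by (intro exI)
qed

text \<open>The first row of S is (1, 0, ..., 0) and V annihilates it, so the equations at (1, 1)
  and (1, 2) determine the base components of V from the first row of A.\<close>

lemma row1_base:
  assumes p: "p \<in> M" and V: "VF V" and T: "\<And>j. j \<in> {1, 2} \<Longrightarrow> V (sf 1 j) p = TT A w v 1 j p"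
  shows "w = (\<Sum>k = 1..n+1. A 1 k * ss k 1 p)" "v = (\<Sum>k = 1..n+1. A 1 k * ss k 2 p)"
proof -
  have s: "ss 1 1 p = 1" "ss 1 2 p = 0" "ss 1 (n + 1) p = 0" "ss 1 0 p = 0"
    using ss_11[OF p] ss_upper[OF p, of 1 2] ss_upper[OF p, of 1 "n + 1"] n1 ss_out[of 1 0 p] by auto
  have "V (sf 1 1) p = 0" "V (sf 1 2) p = 0"
    using vf_cs[OF V] vf_zero[OF V] sf_11 sf_upper[of 1 2] by auto
  moreover have "SB w v 1 1 p = w" "SB w v 1 2 p = v"
    using SB_eq[of 1 w v 1 p] SB_eq[of 2 w v 1 p] s n1 by simp_all
  ultimately show "w = (\<Sum>k = 1..n+1. A 1 k * ss k 1 p)" "v = (\<Sum>k = 1..n+1. A 1 k * ss k 2 p)"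
    using T[of 1] T[of 2] unfolding TT_def by simp_all
qed

lemma vf_eq_on_moduli:
  assumes V: "VF V" and W: "VF W" and b: "\<And>p. p \<in> M \<Longrightarrow> base V (w p) (v p) p \<and> base W (w p) (v p) p"
    and sf: "\<And>i j p. \<lbrakk>i \<in> {1..n+1}; j \<in> {1..n+1}; p \<in> M\<rbrakk> \<Longrightarrow> V (sf i j) p = W (sf i j) p"
  shows "V = W"
proof (rule vf_unique_free[OF V W])
  have I: "1 \<in> II" "n + 2 \<in> II" using I_index_cases[OF n1] by auto
  show "V (tc 1) = W (tc 1)" "V (tc (n + 2)) = W (tc (n + 2))"
    using b I by (auto intro!: regular_eqI vf_regular[OF V] vf_regular[OF W] tc_regular simp: base_def)
  show "V (sf i j) = W (sf i j)" if "free n i j" for i j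
    using free_range[OF that] by (intro regular_eqI vf_regular[OF V] vf_regular[OF W] sf_regular sf) auto
qed

text \<open>For a lower triangular constant matrix A, \<open>row1_base\<close> yields w = A_11 and v
  = 0. This explicit form takes the place of the definite description of
  \<open>R_lie\<close>.\<close>

definition is_lie :: "(nat \<Rightarrow> nat \<Rightarrow> complex) \<Rightarrow> vfield \<Rightarrow> bool" where
  "is_lie A V \<longleftrightarrow> VF V \<and> (\<forall>p\<in>M. base V (A 1 1) 0 p \<and> (\<forall>i\<in>{1..n+1}. \<forall>j\<in>{1..n+1}.
     V (sf i j) p = (\<Sum>k = 1..n+1. A i k * ss k j p) - A 1 1 * of_nat j * ss i j p))"

lemma is_lie_unique: "is_lie A V \<Longrightarrow> is_lie A W \<Longrightarrow> V = W"
  by (rule vf_eq_on_moduli[where w = "\<lambda>_. A 1 1" and v = "\<lambda>_. 0"]) (simp_all add: is_lie_def del: sum.cl_ivl_Suc)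

lemma TT_lie: "1 \<le> j \<Longrightarrow> j \<le> n + 1 \<Longrightarrow> TT A w 0 i j p = (\<Sum>k = 1..n+1. A i k * ss k j p) - w * of_nat j * ss i j p"
  unfolding TT_def SB_eq by simp

lemma is_lie_exists:
  assumes A: "lieA A" and low: "\<And>i k. i < k \<Longrightarrow> k \<le> n + 1 \<Longrightarrow> 1 \<le> i \<Longrightarrow> A i k = 0"
  shows "\<exists>V. is_lie A V"
proof -
  define G where "G i j = (\<Sum>k = 1..n+1. cs (A i k) * sf k j) - cs (A 1 1 * of_nat j) * sf i j" for i j
  have G: "G i j \<in> RR" for i j
    unfolding G_def by (intro regular_diff regular_sum regular_cmult sf_regular) auto
  have I: "1 \<in> II" "n + 2 \<in> II" using I_index_cases[OF n1] by auto
  obtain V where V: "VF V" "V (tc 1) = cs (- A 1 1) * tc 1"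
    "V (tc (n + 2)) = cs (- of_nat (n + 2) * A 1 1) * tc (n + 2)" "\<And>i j. free n i j \<Longrightarrow> V (sf i j) = G i j"
    by (rule vf_exists_free[of "cs (- A 1 1) * tc 1" "cs (- of_nat (n + 2) * A 1 1) * tc (n + 2)" G])
      (use G I tc_regular regular_cmult in blast)+
  have b: "base V (A 1 1) 0 p" if p: "p \<in> M" for p
    using p n1 unfolding base_def V(2,3) by (simp add: t_coord_in algebra_simps)
  have "V (sf i j) p = TT A (A 1 1) 0 i j p"
    if p: "p \<in> M" and ij: "1 \<le> i" "i \<le> n + 1" "1 \<le> j" "j \<le> n + 1" for p i j
  proof (rule tangent[OF V(1) p b[OF p] A _ _ _ ij])
    show "TT A (A 1 1) 0 i j p = 0" if "1 \<le> i" "i < j" "j \<le> n + 1" for i j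
    proof -
      have "A i k * ss k j p = 0" if "k \<in> {1..n+1}" for k
        using that \<open>1 \<le> i\<close> \<open>i < j\<close> low[of i k] ss_upper[OF p, of k j] by (cases "i < k") auto
      then have "(\<Sum>k = 1..n+1. A i k * ss k j p) = 0" by (intro sum.neutral) blast
      then show ?thesis using that ss_upper[OF p, of i j] by (subst TT_lie) auto
    qed
    have "(\<Sum>k = 1..n+1. A 1 k * ss k 1 p) = (\<Sum>k\<in>{1}. A 1 k * ss k 1 p)"
      by (rule sum.mono_neutral_right) (use low in auto)
    then show "TT A (A 1 1) 0 1 1 p = 0" using ss_11[OF p] by (subst TT_lie) auto
    show "V (sf i j) p = TT A (A 1 1) 0 i j p" if f: "free n i j" for i j
      unfolding V(4)[OF f] G_def using free_range[OF f] p by (subst TT_lie) (auto simp: sum_func_apply simp del: sum.cl_ivl_Suc)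
  qed
  then have "is_lie A V" unfolding is_lie_def using V(1) b by (auto simp: TT_lie simp del: sum.cl_ivl_Suc)
  then show ?thesis by blast
qed

lemma lie_alg_iff:
  assumes gc: "g \<in> carrier_mat (n + 1) (n + 1)"
  shows "g \<in> lie_alg n \<longleftrightarrow> lieA (\<lambda>i k. entry g k i) \<and>
    (\<forall>i k. 1 \<le> i \<longrightarrow> i < k \<longrightarrow> k \<le> n + 1 \<longrightarrow> entry g k i = 0)"
proof -
  have gt: "transpose_mat g \<in> carrier_mat (n + 1) (n + 1)" using gc by simp
  have c: "Phi n * g \<in> carrier_mat (n + 1) (n + 1)" using gc Phi_carrier by auto
  have e: "entry (transpose_mat g * Phi n + Phi n * g) i k = (\<Sum>j = 1..n+1. entry g j i * ph j k + ph i j * entry g j k)"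
    if ik: "1 \<le> i" "i \<le> n + 1" "1 \<le> k" "k \<le> n + 1" for i k
  proof -
    have "entry (transpose_mat g * Phi n + Phi n * g) i k
        = (\<Sum>j = 1..n+1. entry (transpose_mat g) i j * entry (Phi n) j k)
        + (\<Sum>j = 1..n+1. entry (Phi n) i j * entry g j k)"
      unfolding entry_add[OF c ik] entry_mult[OF gt Phi_carrier ik] entry_mult[OF Phi_carrier gc ik] ..
    also have "\<dots> = (\<Sum>j = 1..n+1. entry g j i * ph j k + ph i j * entry g j k)"
      unfolding sum.distrib[symmetric] using ik
      by (intro sum.cong refl) (auto simp: entry_transpose[OF gc] entry_Phi)
    finally show ?thesis .
  qed
  have z: "entry (0\<^sub>m (n + 1) (n + 1)) i k = (0 :: complex)" if "1 \<le> i" "i \<le> n + 1" "1 \<le> k" "k \<le> n + 1" for i k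
    using that by (simp add: entry_def)
  have "transpose_mat g * Phi n + Phi n * g = 0\<^sub>m (n + 1) (n + 1) \<longleftrightarrow> lieA (\<lambda>i k. entry g k i)"
  proof
    assume *: "transpose_mat g * Phi n + Phi n * g = 0\<^sub>m (n + 1) (n + 1)"
    show "lieA (\<lambda>i k. entry g k i)"
      unfolding lieA_def
    proof (intro ballI)
      fix i k assume "i \<in> {1..n+1}" "k \<in> {1..n+1}"
      then have ik: "1 \<le> i" "i \<le> n + 1" "1 \<le> k" "k \<le> n + 1" by auto
      show "(\<Sum>j = 1..n+1. entry g j i * ph j k + ph i j * entry g j k) = 0"
        unfolding e[OF ik, symmetric] * by (rule z[OF ik])
    qed
  next
    assume *: "lieA (\<lambda>i k. entry g k i)"
    show "transpose_mat g * Phi n + Phi n * g = 0\<^sub>m (n + 1) (n + 1)"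
    proof (rule eq_mat_entryI)
      fix i k assume ik: "1 \<le> i" "i \<le> n + 1" "1 \<le> k" "k \<le> n + 1"
      show "entry (transpose_mat g * Phi n + Phi n * g) i k = entry (0\<^sub>m (n + 1) (n + 1)) i k"
        unfolding e[OF ik] z[OF ik] using * ik by (simp add: lieA_def del: sum.cl_ivl_Suc)
    qed (use c in auto)
  qed
  moreover have "upper_triangular g \<longleftrightarrow> (\<forall>i k. 1 \<le> i \<longrightarrow> i < k \<longrightarrow> k \<le> n + 1 \<longrightarrow> entry g k i = 0)"
  proof
    assume u: "upper_triangular g"
    show "\<forall>i k. 1 \<le> i \<longrightarrow> i < k \<longrightarrow> k \<le> n + 1 \<longrightarrow> entry g k i = 0"
      unfolding entry_def using gc by (auto intro!: upper_triangularD[OF u])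
  next
    assume u: "\<forall>i k. 1 \<le> i \<longrightarrow> i < k \<longrightarrow> k \<le> n + 1 \<longrightarrow> entry g k i = 0"
    show "upper_triangular g"
    proof (rule upper_triangularI)
      fix i j assume "j < i" "i < dim_row g"
      then show "g $$ (i, j) = 0" using u[rule_format, of "j + 1" "i + 1"] gc by (simp add: entry_def)
    qed
  qed
  ultimately show ?thesis using gc by (auto simp: lie_alg_def)
qed

text \<open>The transpose of g is lower triangular, and with v = 0 so is S B(E); the choice w = A_11
  clears the entry (1, 1). This gives existence through \<open>tangent\<close>, while the first row
  excludes any other base components.\<close>

lemma R_lie_spec:
  assumes g: "g \<in> lie_alg n" shows "is_lie (\<lambda>i k. entry g k i) (R_lie n \<Omega> g)"
proof -
  let ?A = "\<lambda>i k. entry g k i"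
  let ?G = "map_mat (cst n \<Omega>) (transpose_mat g)"
  have gc: "g \<in> carrier_mat (n + 1) (n + 1)" using g by (simp add: lie_alg_def)
  have lA: "lieA ?A" "\<And>i k. \<lbrakk>i < k; k \<le> n + 1; 1 \<le> i\<rbrakk> \<Longrightarrow> ?A i k = 0"
    using g unfolding lie_alg_iff[OF gc] by blast+
  have Gc: "?G \<in> carrier_mat (n + 1) (n + 1)" and GR: "elements_mat ?G \<subseteq> RR"
    using gc by (auto simp: elements_mat_def intro: regular.const)
  have Ge: "entry ?G i k p = ?A i k" if "p \<in> M" "1 \<le> i" "i \<le> n + 1" "1 \<le> k" "k \<le> n + 1" for p i k
    using that gc by (simp add: entry_def)
  have iff: "VF V \<and> has_GM_matrix n \<Omega> V ?G \<longleftrightarrow> is_lie ?A V" for V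
  proof (cases "VF V")
    case True
    show ?thesis
    proof
      assume "is_lie ?A V"
      then have "has_GM_matrix n \<Omega> V ?G"
        using Ge TT_cong[where B = ?A] 
        by (subst GM_iff[OF True Gc GR, where w = "\<lambda>_. ?A 1 1" and v = "\<lambda>_. 0"])
          (auto simp: is_lie_def TT_def SB_eq simp del: sum.cl_ivl_Suc)
      then show "VF V \<and> has_GM_matrix n \<Omega> V ?G" using True by blast
    next
      assume GM: "VF V \<and> has_GM_matrix n \<Omega> V ?G"
      obtain w v where b: "\<And>p. p \<in> M \<Longrightarrow> base V (w p) (v p) p" using base_exists_fun by blast
      have T: "V (sf i j) p = TT ?A (w p) (v p) i j p"
        if "p \<in> M" "1 \<le> i" "i \<le> n + 1" "1 \<le> j" "j \<le> n + 1" for p i j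
      proof -
        have "V (sf i j) p = TT (\<lambda>i k. entry ?G i k p) (w p) (v p) i j p"
          using GM GM_iff[OF True Gc GR b] that by auto
        also have "\<dots> = TT ?A (w p) (v p) i j p" using Ge that by (intro TT_cong) auto
        finally show ?thesis .
      qed
      have wv: "w p = ?A 1 1 \<and> v p = 0" if p: "p \<in> M" for p
      proof -
        have "V (sf 1 j) p = TT ?A (w p) (v p) 1 j p" if "j \<in> {1, 2}" for j
          using T[OF p, of 1 j] that n1 by auto
        note r = row1_base[OF p True this]
        have "(\<Sum>k = 1..n+1. ?A 1 k * ss k j p) = (\<Sum>k\<in>{1}. ?A 1 k * ss k j p)" for j
          by (rule sum.mono_neutral_right) (use lA(2)[of 1] in auto)
        then show ?thesis using r ss_11[OF p] ss_upper[OF p, of 1 2] by simp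
      qed
      show "is_lie ?A V" unfolding is_lie_def
        using True b T wv by (auto simp: TT_lie simp del: sum.cl_ivl_Suc)
    qed
  qed (simp add: is_lie_def)
  obtain V where V: "is_lie ?A V" using is_lie_exists[OF lA] by blast
  have "R_lie n \<Omega> g = V"
    unfolding R_lie_def iff using V is_lie_unique by (intro the_equality) auto
  then show ?thesis using V by simp
qed

section \<open>The modular vector field: formulas, weights and symmetry of Y\<close>

definition Yf :: "nat \<Rightarrow> point \<Rightarrow> complex" where
  "Yf i p = (if 1 \<le> i \<and> i \<le> n then ss 2 2 p * ss i i p * (1 / ss (i + 1) (i + 1) p) else 0)"

definition YA :: "point \<Rightarrow> nat \<Rightarrow> nat \<Rightarrow> complex" where
  "YA p i k = (if k = i + 1 then Yf i p else 0)"

definition Rc :: "nat \<Rightarrow> nat \<Rightarrow> point \<Rightarrow> complex" where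
  "Rc i j p = Yf i p * ss (i + 1) j p
     - (of_nat j * ss 2 1 p * ss i j p + ss 2 2 p * (ss i (j - 1) p + ss i (n + 1) p * cc j p))"

lemma TT_Y:
  assumes "1 \<le> i" "1 \<le> j" "j \<le> n + 1"
  shows "TT (YA p) (ss 2 1 p) (ss 2 2 p) i j p = Rc i j p"
proof -
  have "(\<Sum>k = 1..n+1. YA p i k * ss k j p) = (\<Sum>k = 1..n+1. if k = i + 1 then Yf i p * ss (i + 1) j p else 0)"
    by (intro sum.cong refl) (simp add: YA_def)
  also have "\<dots> = Yf i p * ss (i + 1) j p"
    by (auto simp: sum.delta Yf_def simp del: sum.cl_ivl_Suc)
  finally show ?thesis unfolding TT_def SB_eq[OF assms(2,3)] Rc_def by simp
qed

lemma hw_2: "hw 2 = 2 - int q"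
  using n1 unfolding hw_def q_def by auto

lemma Hm_Yf: "Hm (2 + hw i - hw (i + 1)) (Yf i)"
proof (cases "1 \<le> i \<and> i \<le> n")
  case True
  then have "Hm ((hw 2 + int q * int 2) + (hw i + int q * int i) + - (hw (i + 1) + int q * int (i + 1)))
    (\<lambda>p. ss 2 2 p * ss i i p * (1 / ss (i + 1) (i + 1) p))"
    by (intro Hm_mult Hm_ss Hm_inv_diag) auto
  then show ?thesis by (rule Hm_eq) (use True hw_2 in \<open>simp_all add: Yf_def algebra_simps\<close>)
next
  case False
  then show ?thesis by (intro Hm_eq[OF Hm_zero[of "2 + hw i - hw (i + 1)"]]) (auto simp: Yf_def)
qed

lemma Hm_cc: "Hm (int q * (int j - (int n + 2))) (cc j)"
  using Hm_weighted[OF weighted_ctail, of j] by (simp add: cc_def[abs_def])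

text \<open>The degree 2 is the weight of s_21. In the term with s_22 the excess weight q is
  compensated by the column j - 1, and equally by \<open>cc\<close> in the last column.\<close>

lemma Hm_Rc:
  assumes "1 \<le> j" shows "Hm (hw i + int q * int j + 2) (Rc i j)"
proof -
  have 1: "Hm (hw i + int q * int j + 2) (\<lambda>p. Yf i p * ss (i + 1) j p)"
    by (rule Hm_eq[OF Hm_mult[OF Hm_Yf Hm_ss]]) auto
  have 2: "Hm (hw i + int q * int j + 2) (\<lambda>p. of_nat j * ss 2 1 p * ss i j p)"
    by (rule Hm_eq[OF Hm_mult[OF Hm_cmult[OF Hm_ss] Hm_ss]]) (use hw_2 in auto)
  have 3: "Hm (hw i + int q * int j - int q) (ss i (j - 1))"
    by (rule Hm_eq[OF Hm_ss]) (use assms in \<open>auto simp: of_nat_diff algebra_simps\<close>)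
  have 4: "Hm (hw i + int q * int j - int q) (\<lambda>p. ss i (n + 1) p * cc j p)"
    by (rule Hm_eq[OF Hm_mult[OF Hm_ss Hm_cc]]) (auto simp: algebra_simps)
  have 5: "Hm (hw i + int q * int j + 2) (\<lambda>p. ss 2 2 p * (ss i (j - 1) p + ss i (n + 1) p * cc j p))"
    by (rule Hm_eq[OF Hm_mult[OF Hm_ss Hm_add[OF 3 4]]]) (use hw_2 in auto)
  show ?thesis unfolding Rc_def[abs_def] by (intro Hm_diff Hm_add 1 2 5)
qed

context
  fixes p assumes p: "p \<in> M"
begin

text \<open>\<open>diag_rel\<close> at i and at i + 1 expresses both signs through diagonal entries;
  the alternating signs along the antidiagonal of \<Omega> produce the minus sign that makes Y skew
  for \<Phi>.\<close>

lemma Yf_dual: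
  assumes "1 \<le> i" "i \<le> n" shows "Yf i p * eps (i + 1) + eps i * Yf (n + 1 - i) p = 0"
proof -
  define k where "k = n + 1 - i"
  have k: "1 \<le> k" "k \<le> n" "n + 2 - i = k + 1" "n + 2 - (i + 1) = k" "i + k = n + 1"
    using assms by (auto simp: k_def)
  define o1 where "o1 = ww i (k + 1) p"
  have o2: "ww (i + 1) k p = - o1"
    using ww_antidiag[OF p, of i] ww_antidiag[OF p, of "i + 1"] assms k
    unfolding o1_def by (cases i) auto
  have nz: "ss (i + 1) (i + 1) p \<noteq> 0" "ss (k + 1) (k + 1) p \<noteq> 0"
    using ss_diag_nz[OF p] assms k by auto
  have e1: "eps i = ss i i p * o1 * ss (k + 1) (k + 1) p"
    using diag_rel[OF p, of i] assms k by (simp add: o1_def)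
  have e2: "eps (i + 1) = ss (i + 1) (i + 1) p * (- o1) * ss k k p"
    using diag_rel[OF p, of "i + 1"] assms k o2 by simp
  have Y: "Yf i p = ss 2 2 p * ss i i p / ss (i + 1) (i + 1) p" "Yf k p = ss 2 2 p * ss k k p / ss (k + 1) (k + 1) p"
    using assms k by (simp_all add: Yf_def)
  show ?thesis unfolding k_def[symmetric] Y e1 e2 using nz by (simp add: field_simps)
qed

lemma Yf_1: "Yf 1 p = 1"
  using ss_diag_nz[OF p, of 2] ss_11[OF p] n1 by (simp add: Yf_def numeral_2_eq_2)

text \<open>Skewness at i = 1 transports the first superdiagonal entry 1 to the last one, in
  agreement with the normalisation in \<open>Y_matrix\<close>.\<close>

lemma Yf_n: "n \<ge> 2 \<Longrightarrow> Yf n p = - 1"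
proof -
  assume n: "n \<ge> 2"
  have "eps 2 = 1" "eps 1 = 1" using n m_odd m_bounds by (auto simp: eps_def)
  moreover have "Yf 1 p * eps (1 + 1) + eps 1 * Yf (n + 1 - 1) p = 0" by (rule Yf_dual) (use n in auto)
  ultimately show ?thesis unfolding Yf_1 by (simp add: add_eq_0_iff numeral_2_eq_2)
qed

lemma lieA_YA: "lieA (YA p)"
  unfolding lieA_def
proof (intro ballI)
  fix i k assume "i \<in> {1..n+1}" "k \<in> {1..n+1}"
  then have ik: "1 \<le> i" "i \<le> n + 1" "1 \<le> k" "k \<le> n + 1" by auto
  have "(\<Sum>j = 1..n+1. YA p i j * ph j k) = (\<Sum>j = 1..n+1. if j = i + 1 then Yf i p * ph (i + 1) k else 0)"
    by (intro sum.cong refl) (simp add: YA_def)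
  also have "\<dots> = Yf i p * ph (i + 1) k" by (auto simp: sum.delta Yf_def simp del: sum.cl_ivl_Suc)
  finally have 1: "(\<Sum>j = 1..n+1. YA p i j * ph j k) = Yf i p * ph (i + 1) k" .
  have "(\<Sum>j = 1..n+1. ph i j * YA p k j) = (\<Sum>j = 1..n+1. if j = k + 1 then ph i (k + 1) * Yf k p else 0)"
    by (intro sum.cong refl) (simp add: YA_def)
  also have "\<dots> = ph i (k + 1) * Yf k p" by (auto simp: sum.delta Yf_def simp del: sum.cl_ivl_Suc)
  finally have 2: "(\<Sum>j = 1..n+1. ph i j * YA p k j) = ph i (k + 1) * Yf k p" .
  have "Yf i p * ph (i + 1) k + ph i (k + 1) * Yf k p = 0"
  proof (cases "i + k = n + 1")
    case True
    then have "k = n + 1 - i" "i \<le> n" using ik by auto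
    then show ?thesis using Yf_dual[of i] ik True by (simp add: ph_def)
  qed (simp add: ph_def)
  then show "(\<Sum>j = 1..n+1. YA p i j * ph j k + ph i j * YA p k j) = 0"
    unfolding sum.distrib 1 2 .
qed

text \<open>Above the diagonal only (i, i + 1) needs care: there Y S has \<open>Yf i\<close> times
  s_{i+1,i+1} and S B has s_22 s_ii. \<open>Yf\<close> is chosen to make them equal.\<close>

lemma Rc_upper: "1 \<le> i \<Longrightarrow> i < j \<Longrightarrow> j \<le> n + 1 \<Longrightarrow> Rc i j p = 0"
proof -
  assume i: "1 \<le> i" "i < j" "j \<le> n + 1"
  have z: "ss i j p = 0" "ss i (n + 1) p = 0" using i ss_upper[OF p] by auto
  show ?thesis
  proof (cases "j = i + 1")
    case True
    have "ss (i + 1) (i + 1) p \<noteq> 0" using ss_diag_nz[OF p, of "i + 1"] i by simp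
    then show ?thesis using z i True unfolding Rc_def by (simp add: Yf_def)
  next
    case False
    then have "ss (i + 1) j p = 0" "ss i (j - 1) p = 0" using i ss_upper[OF p] by auto
    then show ?thesis using z unfolding Rc_def by simp
  qed
qed

lemma Rc_11: "Rc 1 1 p = 0"
  using Yf_1 ss_11[OF p] ss_upper[OF p, of 1 "n + 1"] n1 ss_out[of 1 0 p] unfolding Rc_def
  by (simp add: numeral_2_eq_2)

end

definition is_mod :: "vfield \<Rightarrow> bool" where
  "is_mod V \<longleftrightarrow> VF V \<and> (\<forall>p\<in>M. base V (ss 2 1 p) (ss 2 2 p) p \<and>
     (\<forall>i\<in>{1..n+1}. \<forall>j\<in>{1..n+1}. V (sf i j) p = Rc i j p))"

lemma is_mod_unique: "is_mod V \<Longrightarrow> is_mod W \<Longrightarrow> V = W"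
  by (rule vf_eq_on_moduli[where w = "ss 2 1" and v = "ss 2 2"]) (simp_all add: is_mod_def del: sum.cl_ivl_Suc)

lemma is_mod_exists: "\<exists>V. is_mod V"
proof -
  have I: "1 \<in> II" "n + 2 \<in> II" using I_index_cases[OF n1] by auto
  have E: "sf 2 2 - tc 1 * sf 2 1 \<in> RR" "cs (- of_nat (n + 2)) * (tc (n + 2) * sf 2 1) \<in> RR"
    by (intro regular_diff regular_cmult regular.mult sf_regular tc_regular I)+
  have E3: "ext (Rc i j) \<in> RR" if "free n i j" for i j
    using free_range[OF that] by (intro Hm_regular[OF Hm_Rc]) simp
  obtain V where V: "VF V" "V (tc 1) = sf 2 2 - tc 1 * sf 2 1"
    "V (tc (n + 2)) = cs (- of_nat (n + 2)) * (tc (n + 2) * sf 2 1)" "\<And>i j. free n i j \<Longrightarrow> V (sf i j) = ext (Rc i j)"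
    by (rule vf_exists_free[OF E(1,2), of "\<lambda>i j. ext (Rc i j)", OF E3]) blast+
  have b: "base V (ss 2 1 p) (ss 2 2 p) p" if p: "p \<in> M" for p
    using p n1 unfolding base_def V(2,3) by (simp add: t_coord_in algebra_simps)
  have "V (sf i j) p = Rc i j p"
    if p: "p \<in> M" and ij: "1 \<le> i" "i \<le> n + 1" "1 \<le> j" "j \<le> n + 1" for p i j
    unfolding TT_Y[OF ij(1,3,4), symmetric]
  proof (rule tangent[OF V(1) p b[OF p] lieA_YA[OF p] _ _ _ ij])
    show "TT (YA p) (ss 2 1 p) (ss 2 2 p) i j p = 0" if "1 \<le> i" "i < j" "j \<le> n + 1" for i j
      using Rc_upper[OF p that] that by (subst TT_Y) auto
    show "TT (YA p) (ss 2 1 p) (ss 2 2 p) 1 1 p = 0"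
      using Rc_11[OF p] by (subst TT_Y) auto
    show "V (sf i j) p = TT (YA p) (ss 2 1 p) (ss 2 2 p) i j p" if f: "free n i j" for i j
      unfolding V(4)[OF f] using free_range[OF f] p by (subst TT_Y) auto
  qed
  then have "is_mod V" unfolding is_mod_def using V(1) b by auto
  then show ?thesis by blast
qed

lemma Y_matrix_props:
  assumes "\<forall>k\<in>{1..n-2}. y k \<in> RR"
  shows "Y_matrix n \<Omega> y \<in> carrier_mat (n + 1) (n + 1)" "elements_mat (Y_matrix n \<Omega> y) \<subseteq> RR"
    and "\<And>i k. \<lbrakk>1 \<le> i; i \<le> n + 1; 1 \<le> k; k \<le> n + 1\<rbrakk> \<Longrightarrow> entry (Y_matrix n \<Omega> y) i k =
      (if k = i + 1 then if i = 1 then cs 1 else if i = n then cs (- 1) else y (i - 1) else 0)"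
proof -
  show c: "Y_matrix n \<Omega> y \<in> carrier_mat (n + 1) (n + 1)" by (simp add: Y_matrix_def)
  show e: "entry (Y_matrix n \<Omega> y) i k =
      (if k = i + 1 then if i = 1 then cs 1 else if i = n then cs (- 1) else y (i - 1) else 0)"
    if "1 \<le> i" "i \<le> n + 1" "1 \<le> k" "k \<le> n + 1" for i k
    unfolding Y_matrix_def entry_mat1[OF that] ..
  show "elements_mat (Y_matrix n \<Omega> y) \<subseteq> RR"
  proof
    fix f assume "f \<in> elements_mat (Y_matrix n \<Omega> y)"
    from elements_matD[OF this] obtain i j where ij: "i < n + 1" "j < n + 1" "f = Y_matrix n \<Omega> y $$ (i, j)"
      unfolding carrier_matD[OF c] by blast
    then have "f = entry (Y_matrix n \<Omega> y) (i + 1) (j + 1)" by (simp add: entry_def)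
    also have "\<dots> \<in> RR"
    proof -
      have "0 \<in> RR" by (rule zero_regular)
      moreover have "y i \<in> RR" if "i \<noteq> 0" "i + 1 \<noteq> n" "j = i + 1"
        using that ij assms by auto
      ultimately show ?thesis using ij by (subst e) (auto intro: regular.const)
    qed
    finally show "f \<in> RR" .
  qed
qed

text \<open>Uniqueness: the first row of any candidate gives w = s_21 and v = s_22, and the
  vanishing of S above the diagonal then forces the whole superdiagonal of its matrix.\<close>

lemma modular_spec: "is_mod (modular_vf n \<Omega>)"
proof -
  obtain V where V: "is_mod V" using is_mod_exists by blast
  then have VV: "VF V" by (simp add: is_mod_def)
  have "modular_vf n \<Omega> = V"
    unfolding modular_vf_def
  proof (rule the_equality)
    define y where "y k = ext (Yf (k + 1))" for k
    have y: "\<forall>k\<in>{1..n-2}. y k \<in> RR" unfolding y_def using Hm_regular[OF Hm_Yf] by blast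
    let ?Y = "Y_matrix n \<Omega> y"
    note Y = Y_matrix_props[of y, OF y]
    have Ye: "entry ?Y i k p = (if p \<in> M then YA p i k else 0)"
      if "1 \<le> i" "i \<le> n + 1" "1 \<le> k" "k \<le> n + 1" for p i k
      unfolding Y(3)[OF that] using that Yf_1[of p] Yf_n[of p] by (cases "p \<in> M") (auto simp: YA_def y_def)
    have GM: "has_GM_matrix n \<Omega> V ?Y"
    proof (subst GM_iff[OF VV Y(1,2), where w = "ss 2 1" and v = "ss 2 2"], (intro ballI)?)
      show "base V (ss 2 1 p) (ss 2 2 p) p" if "p \<in> M" for p using V that by (simp add: is_mod_def)
      show "\<forall>i\<in>{1..n+1}. \<forall>j\<in>{1..n+1}. \<forall>p\<in>M. V (sf i j) p = TT (\<lambda>i k. entry ?Y i k p) (ss 2 1 p) (ss 2 2 p) i j p"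
      proof (intro ballI)
        fix i j p assume a: "i \<in> {1..n+1}" "j \<in> {1..n+1}" "p \<in> M"
        have "TT (\<lambda>i k. entry ?Y i k p) (ss 2 1 p) (ss 2 2 p) i j p = TT (YA p) (ss 2 1 p) (ss 2 2 p) i j p"
          by (rule TT_cong) (use a Ye in auto)
        also have "\<dots> = Rc i j p" by (rule TT_Y) (use a in auto)
        finally show "V (sf i j) p = TT (\<lambda>i k. entry ?Y i k p) (ss 2 1 p) (ss 2 2 p) i j p"
          using V a by (simp add: is_mod_def)
      qed
    qed
    let ?P = "map_mat (cst n \<Omega>) (Phi n)"
    have Pc: "?P \<in> carrier_mat (n + 1) (n + 1)" using Phi_carrier by simp
    have Pe: "entry ?P i k = cs (ph i k)" if "1 \<le> i" "i \<le> n + 1" "1 \<le> k" "k \<le> n + 1" for i k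
      unfolding entry_map[OF Phi_carrier that] entry_Phi[OF that] ..
    have Yt: "transpose_mat ?Y \<in> carrier_mat (n + 1) (n + 1)" using Y(1) by simp
    have PY: "?P * transpose_mat ?Y \<in> carrier_mat (n + 1) (n + 1)" using Pc Yt by simp
    have skew: "?Y * ?P + ?P * transpose_mat ?Y = 0\<^sub>m (n + 1) (n + 1)"
    proof (rule eq_mat_entryI)
      fix i k assume ik: "1 \<le> i" "i \<le> n + 1" "1 \<le> k" "k \<le> n + 1"
      show "entry (?Y * ?P + ?P * transpose_mat ?Y) i k = entry (0\<^sub>m (n + 1) (n + 1)) i k"
      proof
        fix p
        have "entry (?Y * ?P + ?P * transpose_mat ?Y) i k p
            = (\<Sum>j = 1..n+1. entry ?Y i j p * entry ?P j k p + entry ?P i j p * entry (transpose_mat ?Y) j k p)"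
          unfolding entry_add[OF PY ik] entry_mult[OF Y(1) Pc ik] entry_mult[OF Pc Yt ik]
          by (simp add: sum_func_apply sum.distrib del: sum.cl_ivl_Suc)
        also have "\<dots> = (\<Sum>j = 1..n+1. if p \<in> M then YA p i j * ph j k + ph i j * YA p k j else 0)"
          using ik by (intro sum.cong refl) (auto simp: entry_transpose[OF Y(1)] Ye Pe)
        also have "\<dots> = 0"
          using lieA_YA[of p] ik unfolding lieA_def by (cases "p \<in> M") (auto simp del: sum.cl_ivl_Suc)
        finally show "entry (?Y * ?P + ?P * transpose_mat ?Y) i k p = entry (0\<^sub>m (n + 1) (n + 1)) i k p"
          using ik by (simp add: entry_def)
      qed
    qed (use Y(1) Pc PY in auto)
    show "VF V \<and> (\<exists>y. (\<forall>k\<in>{1..n-2}. y k \<in> RR) \<and> has_GM_matrix n \<Omega> V (Y_matrix n \<Omega> y) \<and>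
        Y_matrix n \<Omega> y * ?P + ?P * transpose_mat (Y_matrix n \<Omega> y) = 0\<^sub>m (n + 1) (n + 1))"
      using VV y GM skew by blast
  next
    fix W assume "VF W \<and> (\<exists>y. (\<forall>k\<in>{1..n-2}. y k \<in> RR) \<and> has_GM_matrix n \<Omega> W (Y_matrix n \<Omega> y) \<and>
        Y_matrix n \<Omega> y * map_mat (cst n \<Omega>) (Phi n)
          + map_mat (cst n \<Omega>) (Phi n) * transpose_mat (Y_matrix n \<Omega> y) = 0\<^sub>m (n + 1) (n + 1))"
    then obtain y where W: "VF W" and y: "\<forall>k\<in>{1..n-2}. y k \<in> RR"
      and GM: "has_GM_matrix n \<Omega> W (Y_matrix n \<Omega> y)" by blast
    let ?Y = "Y_matrix n \<Omega> y"
    note Y = Y_matrix_props[of y, OF y]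
    obtain w v where b: "\<And>p. p \<in> M \<Longrightarrow> base W (w p) (v p) p" using base_exists_fun by blast
    have "base W (ss 2 1 p) (ss 2 2 p) p \<and> (\<forall>i\<in>{1..n+1}. \<forall>j\<in>{1..n+1}. W (sf i j) p = Rc i j p)"
      if p: "p \<in> M" for p
    proof -
      define z where "z i = (if i = 1 then 1 else if i = n then - 1 else y (i - 1) p)" for i
      define A where "A i k = (if k = i + 1 then z i else 0)" for i k
      have Ae: "entry ?Y i k p = A i k" if "1 \<le> i" "i \<le> n + 1" "1 \<le> k" "k \<le> n + 1" for i k
        unfolding Y(3)[OF that] using p by (simp add: A_def z_def)
      have T: "W (sf i j) p = TT A (w p) (v p) i j p" if "1 \<le> i" "i \<le> n + 1" "1 \<le> j" "j \<le> n + 1" for i j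
      proof -
        have "W (sf i j) p = TT (\<lambda>i k. entry ?Y i k p) (w p) (v p) i j p"
          using GM GM_iff[OF W Y(1,2) b] that p by auto
        also have "\<dots> = TT A (w p) (v p) i j p" using Ae that by (intro TT_cong) auto
        finally show ?thesis .
      qed
      have As: "(\<Sum>k = 1..n+1. A i k * ss k j p) = z i * ss (i + 1) j p" for i j
      proof -
        have "(\<Sum>k = 1..n+1. A i k * ss k j p) = (\<Sum>k = 1..n+1. if k = i + 1 then z i * ss (i + 1) j p else 0)"
          by (intro sum.cong refl) (simp add: A_def)
        then show ?thesis using ss_out[of "i + 1" j p] by (auto simp: sum.delta simp del: sum.cl_ivl_Suc)
      qed
      have "W (sf 1 j) p = TT A (w p) (v p) 1 j p" if "j \<in> {1, 2}" for j
        using T[of 1 j] that n1 by auto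
      from row1_base[OF p W this] have wv: "w p = ss 2 1 p" "v p = ss 2 2 p"
        unfolding As by (simp_all add: z_def numeral_2_eq_2)
      have "z i = Yf i p" if i: "1 \<le> i" "i \<le> n" for i
      proof -
        have "W (sf i (i + 1)) p = 0" using sf_upper[of i "i + 1"] vf_zero[OF W] by simp
        moreover have "SB (w p) (v p) i (i + 1) p = ss 2 2 p * ss i i p"
          using SB_eq[of "i + 1" "w p" "v p" i p] ss_upper[OF p, of i] i by (simp add: wv)
        ultimately have "z i * ss (i + 1) (i + 1) p = ss 2 2 p * ss i i p"
          using T[of i "i + 1"] i unfolding TT_def As by simp
        then show ?thesis using ss_diag_nz[OF p, of "i + 1"] i by (simp add: Yf_def field_simps)
      qed
      then have "TT A (w p) (v p) i j p = TT (YA p) (w p) (v p) i j p" if "1 \<le> i" for i j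
        using that by (intro TT_cong) (auto simp: A_def YA_def)
      then have "W (sf i j) p = Rc i j p" if "1 \<le> i" "i \<le> n + 1" "1 \<le> j" "j \<le> n + 1" for i j
        using T[OF that] TT_Y[of i j p] that by (simp add: wv)
      then show ?thesis using b[OF p] by (simp add: wv)
    qed
    then have "is_mod W" using W unfolding is_mod_def by blast
    then show "W = V" using V by (rule is_mod_unique)
  qed
  then show ?thesis using V by simp
qed

subsection \<open>Brackets with the modular vector field\<close>

lemma VF_zero: "VF 0"
  unfolding vector_field_def using zero_regular by auto

lemma VF_add: "VF V \<Longrightarrow> VF W \<Longrightarrow> VF (V + W)"
proof -
  assume V: "VF V" and W: "VF W"
  show ?thesis
    unfolding vector_field_def plus_fun_apply[where ?'a = func]
    using vf_outside[OF V] vf_outside[OF W]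
    by (auto simp: regular.add vf_regular[OF V] vf_regular[OF W] vf_add[OF V] vf_add[OF W]
      regular.const vf_cs[OF V] vf_cs[OF W] vf_mult[OF V] vf_mult[OF W] algebra_simps simp del: plus_fun_apply times_fun_apply)
qed

lemma VF_scale: "h \<in> RR \<Longrightarrow> VF V \<Longrightarrow> VF (scale_vf h V)"
proof -
  assume h: "h \<in> RR" and V: "VF V"
  show ?thesis
    unfolding vector_field_def scale_vf_def
    using vf_outside[OF V]
    by (auto simp: regular.mult h vf_regular[OF V] vf_add[OF V]
      regular.const vf_cs[OF V] vf_mult[OF V] algebra_simps simp del: plus_fun_apply times_fun_apply)
qed

lemma scale_uminus: "VF V \<Longrightarrow> scale_vf (cs (- 1)) V = - V"
proof
  fix f assume V: "VF V"
  have e: "(- V) f = - V f" by (rule uminus_apply)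
  show "scale_vf (cs (- 1)) V f = (- V) f"
    unfolding e scale_vf_def
    by (cases "f \<in> RR") (simp_all only: cs_uminus[OF V vf_regular[OF V]] vf_outside[OF V] mult_zero_right minus_zero simp_thms)
qed

lemma VF_bracket: "VF V \<Longrightarrow> VF W \<Longrightarrow> VF (bracket V W)"
proof -
  assume V: "VF V" and W: "VF W"
  note simps = regular_diff regular.mult vf_regular[OF V] vf_regular[OF W] vf_add[OF V] vf_add[OF W]
      regular.const vf_cs[OF V] vf_cs[OF W] vf_mult[OF V] vf_mult[OF W] vf_zero[OF V] vf_zero[OF W] regular.add
  show ?thesis
    unfolding vector_field_def bracket_def
    using vf_outside[OF V] vf_outside[OF W]
    by (auto simp: simps algebra_simps simp del: plus_fun_apply times_fun_apply minus_apply)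
qed

lemma is_lie_VF: "is_lie A V \<Longrightarrow> VF V" and is_mod_VF: "is_mod V \<Longrightarrow> VF V"
  by (simp_all add: is_lie_def is_mod_def)

abbreviation RM :: vfield where "RM \<equiv> modular_vf n \<Omega>"

lemma RM_VF: "VF RM"
  by (rule is_mod_VF[OF modular_spec])

lemma AMSY_VF: "V \<in> AMSY n \<Omega> \<Longrightarrow> VF V"
  by (induction rule: AMSY.induct)
    (rule VF_zero RM_VF is_lie_VF[OF R_lie_spec] VF_add VF_scale; assumption?)+

lemma tc_t2: "tc 2 = sf 2 1"
  by (rule tc_sf) (use t_pos_2[OF n1] I_index_cases(4)[OF n1] n1 in auto)

lemma lieA_I:
  assumes "\<And>i k. \<lbrakk>1 \<le> i; i \<le> n + 1; 1 \<le> k; k \<le> n + 1\<rbrakk> \<Longrightarrow>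
    A i (n + 2 - k) * eps (n + 2 - k) + eps i * A k (n + 2 - i) = 0"
  shows "lieA A"
  unfolding lieA_def
proof (intro ballI)
  fix i k assume "i \<in> {1..n+1}" "k \<in> {1..n+1}"
  then have ik: "1 \<le> i" "i \<le> n + 1" "1 \<le> k" "k \<le> n + 1" by auto
  have "(\<Sum>j = 1..n+1. A i j * ph j k + ph i j * A k j)
     = (\<Sum>j = 1..n+1. (if j = n + 2 - k then A i (n + 2 - k) * eps (n + 2 - k) else 0)
        + (if j = n + 2 - i then eps i * A k (n + 2 - i) else 0))"
    using ik by (intro sum.cong refl arg_cong2[where f = "(+)"]) (auto simp: ph_def)
  also have "\<dots> = A i (n + 2 - k) * eps (n + 2 - k) + eps i * A k (n + 2 - i)"
    unfolding sum.distrib using ik by (auto simp: sum.delta simp del: sum.cl_ivl_Suc)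
  finally show "(\<Sum>j = 1..n+1. A i j * ph j k + ph i j * A k j) = 0" using assms[OF ik] by simp
qed

lemma lieA_cong:
  assumes "\<And>i k. \<lbrakk>1 \<le> i; i \<le> n + 1; 1 \<le> k; k \<le> n + 1\<rbrakk> \<Longrightarrow> A i k = B i k" "lieA A"
  shows "lieA B"
  unfolding lieA_def
proof (intro ballI)
  fix i k assume ik: "i \<in> {1..n+1}" "k \<in> {1..n+1}"
  then have "(\<Sum>j = 1..n+1. B i j * ph j k + ph i j * B k j) = (\<Sum>j = 1..n+1. A i j * ph j k + ph i j * A k j)"
    using assms(1) by (intro sum.cong refl) auto
  then show "(\<Sum>j = 1..n+1. B i j * ph j k + ph i j * B k j) = 0"
    using assms(2) ik unfolding lieA_def by simp
qed

lemma is_lie_cong: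
  assumes "\<And>i k. \<lbrakk>1 \<le> i; i \<le> n + 1; 1 \<le> k; k \<le> n + 1\<rbrakk> \<Longrightarrow> A i k = B i k" "is_lie A V"
  shows "is_lie B V"
proof -
  have "A 1 1 = B 1 1" using assms(1) n1 by simp
  moreover have "(\<Sum>k = 1..n+1. A i k * ss k j p) = (\<Sum>k = 1..n+1. B i k * ss k j p)" if "i \<in> {1..n+1}" for i j p
    using assms(1) that by (intro sum.cong refl) auto
  ultimately show ?thesis using assms(2) unfolding is_lie_def by (auto simp del: sum.cl_ivl_Suc)
qed

lemma is_lie_scale:
  assumes "is_lie A V" shows "is_lie (\<lambda>i k. z * A i k) (scale_vf (cs z) V)"
proof -
  have "base (scale_vf (cs z) V) (z * A 1 1) 0 p" if "p \<in> M" for p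
  proof -
    have "V (tc 1) p = 0 - aa p * A 1 1" "V (tc (n + 2)) p = - of_nat (n + 2) * bb p * A 1 1"
      using assms that unfolding is_lie_def base_def by blast+
    then show ?thesis
      unfolding base_def scale_vf_def times_fun_apply cst_in[OF that] by (simp only:) (simp add: algebra_simps)
  qed
  moreover have "scale_vf (cs z) V (sf i j) p = (\<Sum>k = 1..n+1. z * A i k * ss k j p) - z * A 1 1 * of_nat j * ss i j p"
    if "p \<in> M" "i \<in> {1..n+1}" "j \<in> {1..n+1}" for i j p
  proof -
    have "scale_vf (cs z) V (sf i j) p = z * ((\<Sum>k = 1..n+1. A i k * ss k j p) - A 1 1 * of_nat j * ss i j p)"
      using assms that unfolding is_lie_def scale_vf_def by (simp del: sum.cl_ivl_Suc)
    then show ?thesis by (simp add: right_diff_distrib sum_distrib_left mult.assoc del: sum.cl_ivl_Suc)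
  qed
  ultimately show ?thesis
    unfolding is_lie_def using VF_scale[OF regular.const is_lie_VF[OF assms]] by blast
qed

lemma is_lie_add:
  assumes "is_lie A V" "is_lie B W" shows "is_lie (\<lambda>i k. A i k + B i k) (V + W)"
proof -
  have P: "(V + W) f p = V f p + W f p" for f p by simp
  have "base (V + W) (A 1 1 + B 1 1) 0 p" if "p \<in> M" for p
  proof -
    have "base V (A 1 1) 0 p" "base W (B 1 1) 0 p" using assms that by (simp_all add: is_lie_def)
    then show ?thesis unfolding base_def P by (simp add: algebra_simps)
  qed
  moreover have "(V + W) (sf i j) p
      = (\<Sum>k = 1..n+1. (A i k + B i k) * ss k j p) - (A 1 1 + B 1 1) * of_nat j * ss i j p"
    if "p \<in> M" "i \<in> {1..n+1}" "j \<in> {1..n+1}" for i j p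
    unfolding P using assms that unfolding is_lie_def
    by (simp add: distrib_right sum.distrib del: sum.cl_ivl_Suc)
  ultimately show ?thesis
    unfolding is_lie_def using VF_add is_lie_VF[OF assms(1)] is_lie_VF[OF assms(2)] by blast
qed

definition lie_field :: "(nat \<Rightarrow> nat \<Rightarrow> complex) \<Rightarrow> vfield" where
  "lie_field A = R_lie n \<Omega> (mat1 (n + 1) (\<lambda>i j. A j i))"

lemma lie_field:
  assumes "lieA A" "\<And>i k. 1 \<le> i \<Longrightarrow> i < k \<Longrightarrow> k \<le> n + 1 \<Longrightarrow> A i k = 0"
  shows "is_lie A (lie_field A)" "lie_field A \<in> AMSY n \<Omega>"
proof -
  let ?g = "mat1 (n + 1) (\<lambda>i j. A j i)"
  have "lieA (\<lambda>i k. entry ?g k i)"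
    by (rule lieA_cong[OF _ assms(1)]) (simp add: entry_mat1)
  then have g: "?g \<in> lie_alg n"
    using assms(2) by (auto simp: lie_alg_iff entry_mat1)
  show "is_lie A (lie_field A)" unfolding lie_field_def
    by (rule is_lie_cong[OF _ R_lie_spec[OF g]]) (simp add: entry_mat1)
  show "lie_field A \<in> AMSY n \<Omega>" unfolding lie_field_def by (rule AMSY.lie[OF g])
qed

definition diag :: "(nat \<Rightarrow> complex) \<Rightarrow> nat \<Rightarrow> nat \<Rightarrow> complex" where
  "diag d i k = (if i = k then d i else 0)"

lemma R_lie_unit:
  assumes k: "1 \<le> k" "k \<le> n + 1" and g: "g = matrix_unit n k k - matrix_unit n (n + 2 - k) (n + 2 - k)"
  shows "is_lie (diag (\<lambda>i. of_bool (i = k) - of_bool (i = n + 2 - k))) (R_lie n \<Omega> g)" (is "is_lie ?A _")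
proof -
  have c: "matrix_unit n l l \<in> carrier_mat (n + 1) (n + 1)" for l by (simp add: matrix_unit_def)
  have gc: "g \<in> carrier_mat (n + 1) (n + 1)" unfolding g using c by (intro minus_carrier_mat)
  have e: "entry g i j = ?A j i" if ij: "1 \<le> i" "i \<le> n + 1" "1 \<le> j" "j \<le> n + 1" for i j
    unfolding g entry_diff[OF c ij] unfolding matrix_unit_def entry_mat1[OF ij] by (auto simp: diag_def)
  have "lieA ?A"
    by (rule lieA_I) (use k in \<open>auto simp: diag_def\<close>)
  then have "lieA (\<lambda>i k. entry g k i)"
    by (rule lieA_cong[rotated]) (simp add: e)
  then have "g \<in> lie_alg n" unfolding lie_alg_iff[OF gc] by (simp add: e diag_def)
  from is_lie_cong[OF _ R_lie_spec[OF this], of ?A] show ?thesis by (simp add: e)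
qed

definition hw_diag :: "nat \<Rightarrow> nat \<Rightarrow> complex" where "hw_diag = diag (\<lambda>i. of_int (hw i))"

text \<open>Since hw_1 = -q, this unfolds to multiplication of s_ij by hw_i + q j, of t_1 by q and
  of t_{n+2} by q(n + 2): H is the Euler field of the grading.\<close>

lemma radial_spec: "is_lie hw_diag (radial_vf n \<Omega>)"
proof -
  let ?d = "\<lambda>k. diag (\<lambda>i. of_bool (i = k) - of_bool (i = n + 2 - k))"
  have g: "is_lie (?d 1) (R_lie n \<Omega> (g11 n))" "is_lie (?d 2) (R_lie n \<Omega> (g22 n))"
    using n1 by (intro R_lie_unit; simp add: g11_def g22_def)+
  have m: "scale_vf (cs (- 1)) (R_lie n \<Omega> (g11 n)) = - R_lie n \<Omega> (g11 n)"
    by (rule scale_uminus[OF is_lie_VF[OF g(1)]])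
  have hw: "hw_diag i k = (if i = k then of_int (hw i) else 0)" for i k
    by (simp add: hw_diag_def diag_def)
  consider "n = 1" | "n = 2" | "n \<ge> 3" using n1 by linarith
  then show ?thesis
  proof cases
    case 1
    have r: "radial_vf n \<Omega> = scale_vf (cs (- 1)) (R_lie n \<Omega> (g11 n))"
      unfolding m radial_vf_def using 1 by simp
    show ?thesis unfolding r
    proof (rule is_lie_cong[OF _ is_lie_scale[OF g(1), of "- 1"]])
      fix i k assume "1 \<le> i" "i \<le> n + 1" "1 \<le> k" "k \<le> n + 1"
      then show "- 1 * ?d 1 i k = hw_diag i k" unfolding hw hw_def q_def diag_def using 1 by auto
    qed
  next
    case 2
    have r: "radial_vf n \<Omega> = scale_vf (cs (- 2)) (R_lie n \<Omega> (g11 n))"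
      unfolding radial_vf_def using 2 by simp
    show ?thesis unfolding r
    proof (rule is_lie_cong[OF _ is_lie_scale[OF g(1), of "- 2"]])
      fix i k assume "1 \<le> i" "i \<le> n + 1" "1 \<le> k" "k \<le> n + 1"
      then show "- 2 * ?d 1 i k = hw_diag i k" unfolding hw hw_def q_def diag_def using 2 by auto
    qed
  next
    case 3
    have r: "radial_vf n \<Omega> = R_lie n \<Omega> (g22 n) + scale_vf (cs (- 1)) (R_lie n \<Omega> (g11 n))"
      unfolding m radial_vf_def using 3 by simp
    show ?thesis unfolding r
    proof (rule is_lie_cong[OF _ is_lie_add[OF g(2) is_lie_scale[OF g(1), of "- 1"]]])
      fix i k assume "1 \<le> i" "i \<le> n + 1" "1 \<le> k" "k \<le> n + 1"
      then show "?d 2 i k + - 1 * ?d 1 i k = hw_diag i k" unfolding hw hw_def q_def diag_def using 3 by auto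
    qed
  qed
qed

section \<open>Brackets of R with strictly lower triangular Lie algebra fields\<close>

definition strict :: "(nat \<Rightarrow> nat \<Rightarrow> complex) \<Rightarrow> bool" where
  "strict A \<longleftrightarrow> (\<forall>i k. i \<le> k \<longrightarrow> A i k = 0)"

lemma RM_tc: "RM (tc 1) = sf 2 2 - tc 1 * sf 2 1" "RM (tc (n + 2)) = cs (- of_nat (n + 2)) * (tc (n + 2) * sf 2 1)"
proof -
  have I: "1 \<in> II" "n + 2 \<in> II" using I_index_cases[OF n1] by auto
  have b: "base RM (ss 2 1 p) (ss 2 2 p) p" if "p \<in> M" for p
    using modular_spec that by (simp add: is_mod_def)
  show "RM (tc 1) = sf 2 2 - tc 1 * sf 2 1"
    by (rule regular_eqI) (use b n1 I in \<open>auto simp: base_def t_coord_in intro!: vf_regular[OF RM_VF]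
      regular_diff regular.mult sf_regular tc_regular simp del: times_fun_apply minus_apply\<close>,
      use b n1 in \<open>simp add: base_def t_coord_in\<close>)
  show "RM (tc (n + 2)) = cs (- of_nat (n + 2)) * (tc (n + 2) * sf 2 1)"
  proof (rule regular_eqI)
    show "RM (tc (n + 2)) \<in> RR" by (rule vf_regular[OF RM_VF tc_regular[OF I(2)]])
    show "cs (- of_nat (n + 2)) * (tc (n + 2) * sf 2 1) \<in> RR"
      by (intro regular_cmult regular.mult sf_regular tc_regular I)
    show "RM (tc (n + 2)) p = (cs (- of_nat (n + 2)) * (tc (n + 2) * sf 2 1)) p" if "p \<in> M" for p
      using b[OF that] that n1 by (simp add: base_def t_coord_in del: of_nat_add)
  qed
qed

definition yf :: "nat \<Rightarrow> func" where "yf i = ext (Yf i)"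
definition cf :: "nat \<Rightarrow> func" where "cf j = ext (cc j)"

lemma yf_regular: "yf i \<in> RR" and cf_regular: "cf j \<in> RR"
  unfolding yf_def cf_def by (rule Hm_regular[OF Hm_Yf], rule Hm_regular[OF Hm_cc])

text \<open>The pointwise formula \<open>Rc\<close> becomes an identity in the ring, so that a
  derivation can be applied to it.\<close>

lemma RM_sf:
  assumes "1 \<le> i" "i \<le> n + 1" "1 \<le> j" "j \<le> n + 1"
  shows "RM (sf i j) = yf i * sf (i + 1) j - (cs (of_nat j) * (sf 2 1 * sf i j) + sf 2 2 * (sf i (j - 1) + sf i (n + 1) * cf j))"
    (is "_ = ?r")
proof (rule regular_eqI)
  show "RM (sf i j) \<in> RR" by (rule vf_regular[OF RM_VF sf_regular])
  show "?r \<in> RR"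
    by (intro regular_diff regular.mult regular.add regular.const sf_regular yf_regular cf_regular)
  show "RM (sf i j) p = ?r p" if "p \<in> M" for p
    using modular_spec assms that by (simp add: is_mod_def Rc_def yf_def cf_def)
qed

context
  fixes A W assumes W: "is_lie A W" and A: "strict A"
begin

lemma W_VF: "VF W"
  by (rule is_lie_VF[OF W])

text \<open>With A_11 = 0 both base parameters vanish, so W is tangent to the fibres over (t_1,
  t_{n+2}).\<close>

lemma W_tc: "W (tc 1) = 0" "W (tc (n + 2)) = 0"
proof -
  have I: "1 \<in> II" "n + 2 \<in> II" using I_index_cases[OF n1] by auto
  have z: "0 \<in> RR" by (rule zero_regular)
  show "W (tc 1) = 0" "W (tc (n + 2)) = 0"
    using W A I by (auto intro!: regular_eqI[OF _ z] vf_regular[OF W_VF] tc_regular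
      simp: is_lie_def base_def strict_def simp del: of_nat_add)
qed

lemma W_sf: "p \<in> M \<Longrightarrow> 1 \<le> i \<Longrightarrow> i \<le> n + 1 \<Longrightarrow> W (sf i j) p = (\<Sum>k = 1..n+1. A i k * ss k j p)"
proof (cases "1 \<le> j \<and> j \<le> n + 1")
  case True
  assume "p \<in> M" "1 \<le> i" "i \<le> n + 1"
  moreover have "A 1 1 = 0" using A by (simp add: strict_def)
  ultimately show ?thesis using W True unfolding is_lie_def by (simp del: sum.cl_ivl_Suc)
next
  case False
  then have "ss k j = (\<lambda>_. 0)" for k by (intro HOL.ext ss_out) auto
  then show ?thesis using vf_cs[OF W_VF, of 0] by (simp add: sf_def cst_def[symmetric] del: sum.cl_ivl_Suc)
qed

lemma W_diag: "1 \<le> i \<Longrightarrow> i \<le> n + 1 \<Longrightarrow> W (sf i i) = 0"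
proof (rule regular_eqI)
  assume i: "1 \<le> i" "i \<le> n + 1"
  show "0 \<in> RR" by (rule zero_regular)
  show "W (sf i i) \<in> RR" by (rule vf_regular[OF W_VF sf_regular])
  fix p assume p: "p \<in> M"
  have z: "A i k * ss k i p = 0" for k
    using A ss_upper[OF p, of k i] by (cases "i \<le> k") (auto simp: strict_def)
  show "W (sf i i) p = 0 p" unfolding W_sf[OF p i] by (simp only: z sum.neutral_const zero_fun_apply)
qed

lemma W_cf: "W (cf j) = 0"
proof -
  have I: "1 \<in> II" "n + 2 \<in> II" using I_index_cases[OF n1] by auto
  have ab: "ext aa \<in> RR" "W (ext aa) = 0" "ext bb \<in> RR" "W (ext bb) = 0"
    using W_tc[unfolded tc_1 tc_2] tc_regular[OF I(1), unfolded tc_1] tc_regular[OF I(2), unfolded tc_2] by blast+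
  have pw: "ext (\<lambda>p. aa p ^ k) \<in> RR \<and> W (ext (\<lambda>p. aa p ^ k)) = 0" for k
  proof (induction k)
    case 0
    show ?case using vf_cs[OF W_VF, of 1] regular.const[of n \<Omega> 1] by (simp add: cst_def)
  next
    case (Suc k)
    have e: "ext (\<lambda>p. aa p ^ Suc k) = ext aa * ext (\<lambda>p. aa p ^ k)" by (simp add: ext_mult)
    have "W (ext aa * ext (\<lambda>p. aa p ^ k)) = 0"
      unfolding vf_mult[OF W_VF ab(1) conjunct1[OF Suc]] ab(2) conjunct2[OF Suc]
      by (simp only: mult_zero_left mult_zero_right add_0_left)
    then show ?case unfolding e using Suc ab(1) by (blast intro: regular.mult)
  qed
  have e: "ext dd = ext (\<lambda>p. aa p ^ (n + 2)) - ext bb" by (auto simp: on_moduli_def dd_def)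
  have d: "ext dd \<in> RR" "W (ext dd) = 0"
    unfolding e using vf_diff[OF W_VF conjunct1[OF pw] ab(3)] conjunct2[OF pw] ab(4)
    by (simp_all only: regular_diff conjunct1[OF pw] ab(3) diff_self)
  have i: "ext (\<lambda>p. 1 / dd p) \<in> RR" by (rule Hm_regular[OF Hm_inv_dd])
  have "ext dd * ext (\<lambda>p. 1 / dd p) = cs 1"
    unfolding ext_mult cst_def by (rule ext_cong) (simp add: dd_nz)
  then have "W (ext dd * ext (\<lambda>p. 1 / dd p)) = 0" using vf_cs[OF W_VF] by simp
  then have z: "ext dd * W (ext (\<lambda>p. 1 / dd p)) = 0"
    unfolding vf_mult[OF W_VF d(1) i] d(2) by (simp del: times_fun_apply)
  have Wi: "W (ext (\<lambda>p. 1 / dd p)) = 0"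
  proof (rule regular_eqI)
    show "0 \<in> RR" by (rule zero_regular)
    show "W (ext (\<lambda>p. 1 / dd p)) \<in> RR" by (rule vf_regular[OF W_VF i])
    fix p assume p: "p \<in> M"
    then show "W (ext (\<lambda>p. 1 / dd p)) p = 0 p" using fun_cong[OF z, of p] dd_nz[OF p] by simp
  qed
  have c: "cf j = cs (- of_nat (Stirling (n + 2) j)) * (ext (\<lambda>p. aa p ^ j) * ext (\<lambda>p. 1 / dd p))"
    unfolding cf_def cst_def ext_mult by (rule ext_cong) (simp add: cc_def ctail_def dd_def)
  show ?thesis
    unfolding c using pw[of j] i Wi
    by (simp add: vf_cmult[OF W_VF] vf_mult[OF W_VF] regular.mult del: times_fun_apply)
qed

text \<open>W is applied to the relation of \<open>yf i\<close> times s_{i+1,i+1} with s_22 s_ii: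
  diagonal entries are annihilated, and s_{i+1,i+1} has no zero.\<close>

lemma W_yf: "1 \<le> i \<Longrightarrow> i \<le> n + 1 \<Longrightarrow> W (yf i) = 0"
proof (cases "i \<le> n")
  case True
  assume i: "1 \<le> i" "i \<le> n + 1"
  have e: "yf i * sf (i + 1) (i + 1) = sf 2 2 * sf i i"
    unfolding yf_def sf_def ext_mult
    by (rule ext_cong) (use True i ss_diag_nz[of _ "i + 1"] in \<open>simp add: Yf_def\<close>)
  have "W (sf 2 2 * sf i i) = 0"
    unfolding vf_mult[OF W_VF sf_regular sf_regular] using W_diag[of i] W_diag[of 2] i n1 by simp
  then have z: "W (yf i) * sf (i + 1) (i + 1) = 0"
    unfolding e[symmetric] vf_mult[OF W_VF yf_regular sf_regular] using W_diag[of "i + 1"] True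
    by (simp del: times_fun_apply)
  show ?thesis
  proof (rule regular_eqI)
    show "0 \<in> RR" by (rule zero_regular)
    show "W (yf i) \<in> RR" by (rule vf_regular[OF W_VF yf_regular])
    fix p assume p: "p \<in> M"
    then show "W (yf i) p = 0 p" using fun_cong[OF z, of p] ss_diag_nz[OF p, of "i + 1"] True by simp
  qed
next
  case False
  then have "yf i = 0" unfolding yf_def Yf_def[abs_def] by (auto simp: on_moduli_def)
  then show ?thesis using vf_zero[OF W_VF] by simp
qed

lemma bracket_tc:
  assumes p: "p \<in> M"
  shows "bracket RM W (tc 1) p = A 2 1 * aa p" "bracket RM W (tc (n + 2)) p = A 2 1 * of_nat (n + 2) * bb p"
proof -
  have I: "1 \<in> II" "n + 2 \<in> II" using I_index_cases[OF n1] by auto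
  have W22: "W (sf 2 2) = 0" using W_diag[of 2] n1 by simp
  have "(\<Sum>k = 1..n+1. A 2 k * ss k 1 p) = (\<Sum>k\<in>{1}. A 2 k * ss k 1 p)"
    by (rule sum.mono_neutral_right) (use A in \<open>auto simp: strict_def\<close>)
  then have W21: "W (sf 2 1) p = A 2 1" using W_sf[OF p, of 2 1] n1 ss_11[OF p] by simp
  have "W (RM (tc 1)) p = - (aa p * A 2 1)"
    unfolding RM_tc using p n1 W21 W22 W_tc I
    by (simp add: vf_diff[OF W_VF] vf_mult[OF W_VF] sf_regular tc_regular regular.mult t_coord_in)
  then show "bracket RM W (tc 1) p = A 2 1 * aa p"
    unfolding bracket_def W_tc vf_zero[OF RM_VF] by simp
  have e: "W (RM (tc (n + 2))) p = - (of_nat (n + 2) * (bb p * A 2 1))"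
  proof -
    have X: "W (cs z * (tc (n + 2) * sf 2 1)) = cs z * (W (tc (n + 2)) * sf 2 1 + tc (n + 2) * W (sf 2 1))" for z
      by (simp only: vf_cmult[OF W_VF] vf_mult[OF W_VF] regular.mult tc_regular[OF I(2)] sf_regular)
    show ?thesis unfolding RM_tc X W_tc using p n1 W21 by (simp add: t_coord_in algebra_simps)
  qed
  show "bracket RM W (tc (n + 2)) p = A 2 1 * of_nat (n + 2) * bb p"
    unfolding bracket_def W_tc vf_zero[OF RM_VF] minus_apply zero_fun_apply e
    by (simp only: diff_0 minus_minus mult_ac)
qed

text \<open>W annihilates Y, s_22 and the companion matrix, and W(s_21) = A_21. The terms with B(R)
  cancel up to this change of w, and what is left is (A Y - Y A) S + A_21 S diag(1, ..., n +
  1).\<close>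

lemma bracket_sf:
  assumes p: "p \<in> M" and i: "1 \<le> i" "i \<le> n + 1" and j: "1 \<le> j" "j \<le> n + 1"
  shows "bracket RM W (sf i j) p = (\<Sum>k = 1..n+1. A i k * (Yf k p * ss (k + 1) j p))
    - Yf i p * (\<Sum>k = 1..n+1. A (i + 1) k * ss k j p) + A 2 1 * of_nat j * ss i j p"
proof -
  have "(\<Sum>k = 1..n+1. A 2 k * ss k 1 p) = (\<Sum>k\<in>{1}. A 2 k * ss k 1 p)"
    by (rule sum.mono_neutral_right) (use A in \<open>auto simp: strict_def\<close>)
  then have W21: "W (sf 2 1) p = A 2 1" using W_sf[OF p, of 2 1] n1 ss_11[OF p] by simp
  have W22: "W (sf 2 2) = 0" using W_diag[of 2] n1 by simp
  have WRM: "W (RM (sf i j)) p = Yf i p * W (sf (i + 1) j) p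
     - (of_nat j * (A 2 1 * ss i j p + ss 2 1 p * W (sf i j) p)
        + ss 2 2 p * (W (sf i (j - 1)) p + W (sf i (n + 1)) p * cc j p))"
    unfolding RM_sf[OF i j]
    by (simp only: vf_diff[OF W_VF] vf_add[OF W_VF] vf_mult[OF W_VF] vf_cs[OF W_VF] sf_regular yf_regular
      cf_regular regular.add regular.mult regular.const regular_diff W_yf[OF i] W_cf[of j] W22)
      (simp add: p W21[simplified] yf_def cf_def)
  have "W (sf i j) = (\<Sum>k = 1..n+1. cs (A i k) * sf k j)"
  proof (rule regular_eqI)
    show "W (sf i j) \<in> RR" by (rule vf_regular[OF W_VF sf_regular])
    show "(\<Sum>k = 1..n+1. cs (A i k) * sf k j) \<in> RR" by (intro regular_sum regular_cmult sf_regular) auto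
    show "W (sf i j) p = (\<Sum>k = 1..n+1. cs (A i k) * sf k j) p" if "p \<in> M" for p
      unfolding W_sf[OF that i] sum_func_apply using that by (simp del: sum.cl_ivl_Suc)
  qed
  then have "RM (W (sf i j)) = (\<Sum>k = 1..n+1. cs (A i k) * RM (sf k j))"
    using vf_sum[OF RM_VF, of "{1..n+1}" "\<lambda>k. cs (A i k) * sf k j"]
    by (simp add: vf_cmult[OF RM_VF] sf_regular regular_cmult del: sum.cl_ivl_Suc)
  then have "RM (W (sf i j)) p = (\<Sum>k = 1..n+1. A i k * RM (sf k j) p)"
    using p by (simp add: sum_func_apply del: sum.cl_ivl_Suc)
  also have "\<dots> = (\<Sum>k = 1..n+1. A i k * Rc k j p)"
    using modular_spec p j by (intro sum.cong refl) (auto simp: is_mod_def)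
  also have "\<dots> = (\<Sum>k = 1..n+1. A i k * (Yf k p * ss (k + 1) j p)) - (of_nat j * ss 2 1 p * W (sf i j) p
        + ss 2 2 p * (W (sf i (j - 1)) p + W (sf i (n + 1)) p * cc j p))"
    unfolding W_sf[OF p i] Rc_def sum_distrib_left sum_distrib_right sum.distrib[symmetric] sum_subtractf[symmetric]
    by (intro sum.cong refl) (simp add: algebra_simps)
  finally have RMW: "RM (W (sf i j)) p = (\<Sum>k = 1..n+1. A i k * (Yf k p * ss (k + 1) j p))
      - (of_nat j * ss 2 1 p * W (sf i j) p + ss 2 2 p * (W (sf i (j - 1)) p + W (sf i (n + 1)) p * cc j p))" .
  have YW: "Yf i p * W (sf (i + 1) j) p = Yf i p * (\<Sum>k = 1..n+1. A (i + 1) k * ss k j p)"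
  proof (cases "i \<le> n")
    case True
    then show ?thesis using W_sf[OF p, of "i + 1" j] by (simp only: le_add2 add_le_mono1)
  qed (simp add: Yf_def)
  show ?thesis
    unfolding bracket_def minus_apply RMW WRM YW by (simp add: algebra_simps del: sum.cl_ivl_Suc)
qed

end

subsection \<open>The two constructions\<close>

lemma t_pos_inj: "t \<in> II - {1, n + 2} \<Longrightarrow> s \<in> II - {1, n + 2} \<Longrightarrow> t_pos n t = t_pos n s \<Longrightarrow> t = s"
  using bij_betw_imp_inj_on[OF bij_betw_t_pos[OF n1]] by (rule inj_onD)

lemma two_in: "2 \<in> II - {1, n + 2}"
  using I_index_cases(4)[OF n1] n1 by auto

lemma tc_cases:
  assumes "t \<in> II"
  obtains "t = 1" | "t = n + 2" | i j where "t \<in> II - {1, n + 2}" "t_pos n t = (i, j)" "free n i j" "tc t = sf i j"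
proof (cases "t \<in> {1, n + 2}")
  case False
  obtain i j where "t_pos n t = (i, j)" by (cases "t_pos n t")
  then show ?thesis using that(3)[of i j] False assms tc_sf t_pos_free by blast
qed (use that in blast)

lemma homogeneous_RM_tc:
  assumes t: "t \<in> II" shows "homogeneous n \<Omega> (wt n t + 2) (RM (tc t))"
  using t
proof (cases rule: tc_cases)
  case 1
  have "Hm (int q + 2) (\<lambda>p. ss 2 2 p - aa p * ss 2 1 p)"
    by (rule Hm_diff[OF Hm_eq[OF Hm_ss[of 2 2]] Hm_eq[OF Hm_mult[OF Hm_aa Hm_ss[of 2 1]]]])
      (simp_all add: hw_2)
  moreover have "ext (\<lambda>p. ss 2 2 p - aa p * ss 2 1 p) = RM (tc 1)"
    unfolding RM_tc unfolding tc_1 by (auto simp: on_moduli_def sf_def)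
  ultimately show ?thesis using 1 wt_1 by (simp add: Hm_def)
next
  case 2
  have "Hm (int q * (int n + 2) + 2) (\<lambda>p. - of_nat (n + 2) * (bb p * ss 2 1 p))"
    by (rule Hm_cmult[OF Hm_eq[OF Hm_mult[OF Hm_bb Hm_ss[of 2 1]]]]) (simp_all add: hw_2)
  moreover have "ext (\<lambda>p. - of_nat (n + 2) * (bb p * ss 2 1 p)) = RM (tc (n + 2))"
    unfolding RM_tc unfolding tc_2 by (auto simp: on_moduli_def sf_def cst_def)
  ultimately show ?thesis using 2 wt_2 by (simp add: Hm_def)
next
  case (3 i j)
  note r = free_range[OF 3(3)]
  have "RM (sf i j) = ext (Rc i j)"
  proof (rule regular_eqI[OF vf_regular[OF RM_VF sf_regular] Hm_regular[OF Hm_Rc]])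
    show "RM (sf i j) p = ext (Rc i j) p" if "p \<in> M" for p
      using modular_spec that r by (simp add: is_mod_def)
  qed (use r in simp)
  then show ?thesis using Hm_Rc[of j i] r unfolding 3(4) wt_t[OF 3(1,2)] Hm_def by simp
qed

text \<open>Two positions are filled for n \<ge> 2. For n = 1 they coincide, and the order of the
  clauses leaves E_21 alone.\<close>

definition A1 :: "nat \<Rightarrow> nat \<Rightarrow> complex" where
  "A1 i k = (if i = 2 \<and> k = 1 then 1 else if i = n + 1 \<and> k = n then - 1 else 0)"

lemma strict_A1: "strict A1" and lower_A1: "i < k \<Longrightarrow> A1 i k = 0"
  by (auto simp: strict_def A1_def)

lemma eps_facts: "n \<ge> 2 \<Longrightarrow> eps 2 = 1" "eps 1 = 1" "n \<ge> 2 \<Longrightarrow> eps n = eps (n + 1)" "odd n \<Longrightarrow> eps (n + 1) = - 1"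
  using m_odd m_bounds n1 by (auto simp: eps_def)

lemma lieA_A1: "lieA A1"
proof (rule lieA_I)
  fix i k assume ik: "1 \<le> i" "i \<le> n + 1" "1 \<le> k" "k \<le> n + 1"
  show "A1 i (n + 2 - k) * eps (n + 2 - k) + eps i * A1 k (n + 2 - i) = 0"
  proof (cases "n = 1")
    case True
    have "(1::nat) \<le> m" "2 * m \<le> 2" using m_bounds True by auto
    then have "m = 1" by simp
    then show ?thesis using True ik unfolding A1_def eps_def by auto
  next
    case False
    then have n: "n \<ge> 2" using n1 by simp
    consider "i = 2" "k = n + 1" | "i = n + 1" "k = 2" | "\<not> (i = 2 \<and> k = n + 1)" "\<not> (i = n + 1 \<and> k = 2)" by blast
    then show ?thesis
    proof cases
      case 1
      then show ?thesis using n eps_facts by (simp add: A1_def)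
    next
      case 2
      then show ?thesis using n eps_facts by (simp add: A1_def)
    next
      case 3
      then have "A1 i (n + 2 - k) = 0" "A1 k (n + 2 - i) = 0" using ik n by (auto simp: A1_def)
      then show ?thesis by simp
    qed
  qed
qed

lemma sum_A1: "1 \<le> i \<Longrightarrow> i \<le> n + 1 \<Longrightarrow>
  (\<Sum>k = 1..n+1. A1 i k * f k) = (if i = 2 then f 1 else if i = n + 1 then - f n else 0)"
proof -
  assume i: "1 \<le> i" "i \<le> n + 1"
  have "(\<Sum>k = 1..n+1. A1 i k * f k) = (\<Sum>k = 1..n+1. if k = (if i = 2 then 1 else n)
      then (if i = 2 then f 1 else if i = n + 1 then - f n else 0) else 0)"
    using n1 by (intro sum.cong refl) (auto simp: A1_def)
  then show ?thesis using n1 by (simp add: sum.delta del: sum.cl_ivl_Suc)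
qed

text \<open>\<open>W1\<close> is \<open>\<partial>/\<partial>t\<^sub>2\<close> in the chart of Option 1, \<open>partial2\<close> below in that of Option 2.\<close>

definition W1 :: vfield where "W1 = lie_field A1"

lemma W1: "is_lie A1 W1" "W1 \<in> AMSY n \<Omega>"
  unfolding W1_def by (rule lie_field[OF lieA_A1 lower_A1]; assumption)+

text \<open>The commutator A Y - Y A of \<open>A1\<close> involves only Y_1 = 1 and, for n \<ge> 2,
  Y_n = -1, so it is constant and diagonal. For n = 2 the contributions to row 2 cancel. In each
  case q times the result is diag(hw), and q A_21 = -hw_1.\<close>

lemma bracket_W1: "is_lie hw_diag (bracket RM (scale_vf (cs (of_nat q)) W1))"
proof -
  let ?A = "\<lambda>i k. of_nat q * A1 i k"
  let ?W = "scale_vf (cs (of_nat q)) W1"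
  have W: "is_lie ?A ?W" by (rule is_lie_scale[OF W1(1)])
  have s: "strict ?A" using strict_A1 by (simp add: strict_def)
  have A21: "?A 2 1 = of_nat q" by (simp add: A1_def)
  have h11: "hw_diag 1 1 = - of_nat q" by (simp add: hw_diag_def diag_def hw_def)
  show ?thesis
    unfolding is_lie_def h11
  proof (intro conjI ballI)
    show "VF (bracket RM ?W)" by (rule VF_bracket[OF RM_VF is_lie_VF[OF W]])
    fix p assume p: "p \<in> M"
    show "base (bracket RM ?W) (- of_nat q) 0 p"
      unfolding base_def bracket_tc[OF W s p] A21 by (simp add: algebra_simps)
    fix i j assume "i \<in> {1..n+1}" "j \<in> {1..n+1}"
    then have i: "1 \<le> i" "i \<le> n + 1" "1 \<le> j" "j \<le> n + 1" by auto
    have S1: "(\<Sum>k = 1..n+1. ?A i k * (Yf k p * ss (k + 1) j p))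
        = of_nat q * (if i = 2 then ss 2 j p else if i = n + 1 then - (Yf n p * ss (n + 1) j p) else 0)"
      using sum_A1[OF i(1,2), of "\<lambda>k. Yf k p * ss (k + 1) j p"] Yf_1[OF p]
      by (simp add: mult.assoc numeral_2_eq_2 flip: sum_distrib_left del: sum.cl_ivl_Suc)
    have S2: "Yf i p * (\<Sum>k = 1..n+1. ?A (i + 1) k * ss k j p)
        = (if i = 1 then of_nat q * ss 1 j p else if i = n then - of_nat q * Yf n p * ss n j p else 0)"
    proof (cases "i \<le> n")
      case True
      then show ?thesis using sum_A1[of "i + 1" "\<lambda>k. ss k j p"] Yf_1[OF p] i
        by (simp add: mult.assoc flip: sum_distrib_left del: sum.cl_ivl_Suc)
    qed (use n1 in \<open>auto simp: Yf_def\<close>)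
    have "of_nat q * (if i = 2 then ss 2 j p else if i = n + 1 then - (Yf n p * ss (n + 1) j p) else 0)
        - (if i = 1 then of_nat q * ss 1 j p else if i = n then - of_nat q * Yf n p * ss n j p else 0) = of_int (hw i) * ss i j p"
    proof -
      consider "i = 1" | "n = 1" "i = 2" | "n = 2" "i = 2" | "n \<ge> 2" "i = n + 1" | "n \<ge> 3" "i = 2" | "n \<ge> 3" "i = n"
        | "n \<ge> 3" "i \<notin> {1, 2, n, n + 1}" using i n1 by force
      then show ?thesis
      proof cases
        case 1
        then have "hw i = - int q" by (simp add: hw_def)
        then show ?thesis using 1 n1 by simp
      next
        case 2
        then have "hw i = int q" unfolding hw_def by simp
        then show ?thesis using 2 by simp
      next
        case 3
        then have "hw i = 2 - int q" "q = 2" unfolding hw_def q_def by auto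
        then show ?thesis using 3 Yf_n[OF p] by simp
      next
        case 4
        then have "hw i = int q" unfolding hw_def by simp
        then show ?thesis using 4 Yf_n[OF p] by simp
      next
        case 5
        then have "hw i = 2 - int q" "q = 1" unfolding hw_def q_def by auto
        then show ?thesis using 5 by simp
      next
        case 6
        then have "hw i = int q - 2" "q = 1" unfolding hw_def q_def by auto
        then show ?thesis using 6 Yf_n[OF p] by simp
      next
        case 7
        then have "hw i = 0" unfolding hw_def by auto
        then show ?thesis using 7 by auto
      qed
    qed
    moreover have "(\<Sum>k = 1..n+1. hw_diag i k * ss k j p) = of_int (hw i) * ss i j p"
    proof -
      have "(\<Sum>k = 1..n+1. hw_diag i k * ss k j p) = (\<Sum>k = 1..n+1. if k = i then of_int (hw i) * ss i j p else 0)"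
        by (intro sum.cong refl) (simp add: hw_diag_def diag_def)
      then show ?thesis using i by (simp add: sum.delta del: sum.cl_ivl_Suc)
    qed
    ultimately show "bracket RM ?W (sf i j) p
        = (\<Sum>k = 1..n+1. hw_diag i k * ss k j p) - - of_nat q * of_nat j * ss i j p"
      unfolding bracket_sf[OF W s p i] S1 S2 A21 by (simp only: minus_mult_left[symmetric] diff_minus_eq_add)
  qed
qed

definition dx :: nat where "dx = d_index n"
text \<open>For odd n \<ge> 3 this is the index of s_{n1}, and \<open>dx\<close> is that of
  s_{n+1,1}.\<close>

definition ex :: nat where "ex = (if n = 3 then 4 else d_index n - 2)"

lemma chart_1: "chart Option1 n \<Omega> j = (if odd n \<and> n \<ge> 3 \<and> j = dx then tc j + tc 2 * tc ex else tc j)"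
  by (auto simp: dx_def ex_def)

context
  assumes on: "odd n" "n \<ge> 3"
begin

lemma dx_ex: "dx \<in> II - {1, 2, n + 2}" "ex \<in> II - {1, 2, n + 2, dx}" "t_pos n dx = (n + 1, 1)" "t_pos n ex = (n, 1)"
  using t_pos_last[OF on] unfolding dx_def ex_def by auto

lemma tc_dx: "tc dx = sf (n + 1) 1" and tc_ex: "tc ex = sf n 1"
  using dx_ex by (auto intro: tc_sf)

lemma q1: "q = 1"
  using on unfolding q_def by auto

end

text \<open>The modified coordinate determines t_d as well: once the values on t_2 and
  \<open>tc ex\<close> agree, the product rule recovers the value on t_d.\<close>

lemma partial_deriv_eq:
  assumes V: "VF V" and eq: "\<And>i. i \<in> II \<Longrightarrow> V (chart opt n \<Omega> i) = cs (if i = 2 then 1 else 0)"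
  shows "partial_deriv n \<Omega> (chart opt n \<Omega>) 2 = V"
  unfolding partial_deriv_def
proof (rule the_equality)
  show "VF V \<and> (\<forall>i\<in>II. V (chart opt n \<Omega> i) = cs (if i = 2 then 1 else 0))" using V eq by blast
  fix W assume "VF W \<and> (\<forall>i\<in>II. W (chart opt n \<Omega> i) = cs (if i = 2 then 1 else 0))"
  then have W: "VF W" and "\<And>i. i \<in> II \<Longrightarrow> W (chart opt n \<Omega> i) = cs (if i = 2 then 1 else 0)" by auto
  then have E: "W (chart opt n \<Omega> i) = V (chart opt n \<Omega> i)" if "i \<in> II" for i using that eq by simp
  show "W = V"
  proof (rule vf_unique[OF W V])
    fix s assume s: "s \<in> II"
    show "W (tc s) = V (tc s)"
    proof (cases "opt = Option1 \<and> odd n \<and> n \<ge> 3 \<and> s = dx")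
      case False
      then have "chart opt n \<Omega> s = tc s" using chart_1[of s] by (cases opt) auto
      then show ?thesis using E[OF s] by simp
    next
      case True
      then have on: "odd n" "n \<ge> 3" by auto
      note D = dx_ex[OF on]
      have t: "tc 2 \<in> RR" "tc ex \<in> RR" "tc dx \<in> RR" "tc 2 * tc ex \<in> RR"
        using D two_in by (auto intro!: tc_regular regular.mult)
      have "chart opt n \<Omega> 2 = tc 2" "chart opt n \<Omega> ex = tc ex"
        using chart_1[of 2] chart_1[of ex] D True by auto
      then have e2: "W (tc 2) = V (tc 2)" "W (tc ex) = V (tc ex)" using E[of 2] E[of ex] D two_in by auto
      have "W (tc dx + tc 2 * tc ex) = V (tc dx + tc 2 * tc ex)"
        using E[of dx] chart_1[of dx] D True by auto
      then show ?thesis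
        unfolding vf_add[OF W t(3,4)] vf_add[OF V t(3,4)] vf_mult[OF W t(1,2)] vf_mult[OF V t(1,2)] e2
        using True by simp
    qed
  qed
qed

lemma lie_tc:
  assumes "is_lie A V" "strict A"
  shows "V (tc 1) = 0" "V (tc (n + 2)) = 0"
    and "\<lbrakk>t \<in> II - {1, n + 2}; t_pos n t = (i, j); p \<in> M\<rbrakk> \<Longrightarrow> V (tc t) p = (\<Sum>k = 1..n+1. A i k * ss k j p)"
proof -
  show "V (tc 1) = 0" "V (tc (n + 2)) = 0" by (rule W_tc[OF assms])+
  assume t: "t \<in> II - {1, n + 2}" "t_pos n t = (i, j)" and p: "p \<in> M"
  show "V (tc t) p = (\<Sum>k = 1..n+1. A i k * ss k j p)"
    unfolding tc_sf[OF t] using free_range[OF t_pos_free[OF t]] by (intro W_sf[OF assms p]) auto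
qed

lemma W1_tc:
  assumes t: "t \<in> II" "\<not> (odd n \<and> n \<ge> 3 \<and> t = dx)"
  shows "W1 (tc t) = cs (if t = 2 then 1 else 0)"
  using t(1)
proof (cases rule: tc_cases)
  case 1
  then show ?thesis using lie_tc(1)[OF W1(1) strict_A1] cs_0 by simp
next
  case 2
  then show ?thesis using lie_tc(2)[OF W1(1) strict_A1] cs_0 n1 by simp
next
  case (3 i j)
  note r = free_range[OF 3(3)]
  show ?thesis
  proof (rule regular_eqI[OF vf_regular[OF is_lie_VF[OF W1(1)] tc_regular[OF t(1)]] regular.const])
    fix p assume p: "p \<in> M"
    have e: "W1 (tc t) p = (if i = 2 then ss 1 j p else if i = n + 1 then - ss n j p else 0)"
      using lie_tc(3)[OF W1(1) strict_A1 3(1,2) p] sum_A1[of i "\<lambda>k. ss k j p"] r by simp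
    show "W1 (tc t) p = cs (if t = 2 then 1 else 0) p"
    proof (cases "i = 2")
      case True
      then consider "j = 1" | "j = 2" using r by linarith
      then show ?thesis
      proof cases
        case 1
        then have "t = 2" using t_pos_inj[OF 3(1) two_in] 3(2) t_pos_2[OF n1] True by simp
        then show ?thesis using e True 1 ss_11[OF p] p by simp
      next
        case 2
        then have "t \<noteq> 2" using 3(2) t_pos_2[OF n1] by auto
        then show ?thesis using e True 2 ss_upper[OF p, of 1 2] p by simp
      qed
    next
      case False
      then have t2: "t \<noteq> 2" using 3(2) t_pos_2[OF n1] by auto
      have "i \<noteq> n + 1"
      proof
        assume i: "i = n + 1"
        then have "n \<ge> 2" using False r by auto
        \<comment> \<open>For even n the last row has no free entry, for odd n only the one in
          column 1, which has the excluded index \<open>dx\<close>.\<close>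
        have "n + 1 + j \<le> 2 * m + 1" using 3(3) i by (simp add: free_iff)
        then have "odd n" "j = 1" using m_even m_odd r by (cases "even n"; simp)+
        then have on: "odd n" "n \<ge> 3" using \<open>n \<ge> 2\<close> by (auto elim!: oddE)
        have "t = dx" using t_pos_inj[OF 3(1), of dx] dx_ex[OF on] 3(2) i \<open>j = 1\<close> by auto
        then show False using t(2) on by simp
      qed
      then show ?thesis using e False t2 p by simp
    qed
  qed
qed

lemma W1_dx:
  assumes on: "odd n" "n \<ge> 3" shows "W1 (tc dx) = - tc ex"
proof (rule regular_eqI)
  note D = dx_ex[OF on]
  have d: "dx \<in> II - {1, n + 2}" using D by auto
  show "W1 (tc dx) \<in> RR" "- tc ex \<in> RR"
    using D by (auto intro!: vf_regular[OF is_lie_VF[OF W1(1)]] regular_uminus tc_regular)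
  fix p assume p: "p \<in> M"
  have "W1 (tc dx) p = - ss n 1 p"
    using lie_tc(3)[OF W1(1) strict_A1 d D(3) p] sum_A1[of "n + 1" "\<lambda>k. ss k 1 p"] on by simp
  then show "W1 (tc dx) p = (- tc ex) p" unfolding tc_ex[OF on] using p by simp
qed

text \<open>\<open>W1\<close> sends s_{n+1,1} to -s_{n1}, and the product t_2 s_{n1} contributes
  s_{n1}; this cancellation is the reason for the modified coordinate.\<close>

lemma W1_chart: "i \<in> II \<Longrightarrow> W1 (chart Option1 n \<Omega> i) = cs (if i = 2 then 1 else 0)"
proof (cases "odd n \<and> n \<ge> 3 \<and> i = dx")
  case True
  then have on: "odd n" "n \<ge> 3" by auto
  note D = dx_ex[OF on]
  have t: "tc 2 \<in> RR" "tc ex \<in> RR" "tc dx \<in> RR" "tc 2 * tc ex \<in> RR"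
    using D two_in by (auto intro!: tc_regular regular.mult)
  have V: "VF W1" by (rule is_lie_VF[OF W1(1)])
  have "W1 (tc 2) = cs 1" "W1 (tc ex) = cs 0" using W1_tc[of 2] W1_tc[of ex] D two_in by auto
  then have "W1 (tc dx + tc 2 * tc ex) = - tc ex + (cs 1 * tc ex + tc 2 * cs 0)"
    unfolding vf_add[OF V t(3,4)] vf_mult[OF V t(1,2)] W1_dx[OF on] by simp
  also have "\<dots> = cs 0" unfolding cs_mult_regular[OF t(2)] cs_0 by (simp only: mult_zero_right add_0_right left_minus)
  finally have "W1 (chart Option1 n \<Omega> i) = cs 0" unfolding chart_1 using True by simp
  moreover have "i \<noteq> 2" using True D by auto
  ultimately show ?thesis by simp
next
  case False
  assume "i \<in> II"
  then show ?thesis unfolding chart_1 using W1_tc[of i] False by auto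
qed

lemma delta_1: "delta_partial2 Option1 n \<Omega> = scale_vf (cs (of_nat q)) W1"
proof -
  have "(1 + of_bool (n = 2) :: complex) = of_nat q" by (simp add: q_def)
  then show ?thesis unfolding delta_partial2_def
    using partial_deriv_eq[OF is_lie_VF[OF W1(1)] W1_chart] by simp
qed

lemma bracket_delta_1: "bracket RM (delta_partial2 Option1 n \<Omega>) = radial_vf n \<Omega>"
  unfolding delta_1 by (rule is_lie_unique[OF bracket_W1 radial_spec])

lemma homogeneous_tc: "t \<in> II \<Longrightarrow> homogeneous n \<Omega> (wt n t) (tc t)"
  by (rule homogeneous.coord)

text \<open>Because s_{n1} has weight 0, adding t_2 s_{n1} to t_d leaves its weight 2
  unchanged.\<close>

lemma wt_dx_ex:
  assumes on: "odd n" "n \<ge> 3"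
  shows "wt n 2 = 2" "wt n dx = 2" "wt n ex = 0"
proof -
  note D = dx_ex[OF on]
  have q: "q = 1" by (rule q1[OF on])
  have h: "hw 2 = 1" "hw n = - 1" "hw (n + 1) = 1" using on q by (auto simp: hw_def)
  show "wt n 2 = 2" using wt_t[OF two_in t_pos_2[OF n1]] h q by simp
  show "wt n dx = 2" using wt_t[OF _ D(3)] D(1) h q by simp
  show "wt n ex = 0" using wt_t[OF _ D(4)] D(2) h q by simp
qed

lemma option1:
  "quasi_homogeneous n \<Omega> (chart Option1 n \<Omega>) 2 (D_vf Option1 n \<Omega>)
    \<and> D_vf Option1 n \<Omega> \<in> AMSY n \<Omega>
    \<and> bracket (D_vf Option1 n \<Omega>) (delta_partial2 Option1 n \<Omega>) = radial_vf n \<Omega>"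
proof (intro conjI)
  show "D_vf Option1 n \<Omega> \<in> AMSY n \<Omega>" by (simp add: AMSY.modular)
  show "bracket (D_vf Option1 n \<Omega>) (delta_partial2 Option1 n \<Omega>) = radial_vf n \<Omega>"
    using bracket_delta_1 by simp
  have "homogeneous n \<Omega> (wt n j + 2) (RM (chart Option1 n \<Omega> j))" if j: "j \<in> II" for j
  proof (cases "odd n \<and> n \<ge> 3 \<and> j = dx")
    case True
    then have on: "odd n" "n \<ge> 3" by auto
    note D = dx_ex[OF on] and w = wt_dx_ex[OF on]
    have I: "2 \<in> II" "dx \<in> II" "ex \<in> II" using D two_in by auto
    have t: "tc 2 \<in> RR" "tc ex \<in> RR" "tc dx \<in> RR" "tc 2 * tc ex \<in> RR"
      using I by (auto intro!: tc_regular regular.mult)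
    have "homogeneous n \<Omega> (2 + 2) (RM (tc dx))" "homogeneous n \<Omega> ((2 + 2) + 0) (RM (tc 2) * tc ex)"
      "homogeneous n \<Omega> (2 + (0 + 2)) (tc 2 * RM (tc ex))"
      using homogeneous_RM_tc[OF I(1)] homogeneous_RM_tc[OF I(2)] homogeneous_RM_tc[OF I(3)]
        homogeneous_tc[OF I(1)] homogeneous_tc[OF I(3)] unfolding w by (blast intro: homogeneous.mult)+
    then have "homogeneous n \<Omega> 4 (RM (tc dx) + (RM (tc 2) * tc ex + tc 2 * RM (tc ex)))"
      by (intro homogeneous.add) simp_all
    then have "homogeneous n \<Omega> 4 (RM (tc dx + tc 2 * tc ex))"
      unfolding vf_add[OF RM_VF t(3,4)] vf_mult[OF RM_VF t(1,2)] .
    then show ?thesis unfolding chart_1 using True w by simp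
  next
    case False
    then show ?thesis unfolding chart_1 using homogeneous_RM_tc[OF j] by auto
  qed
  then show "quasi_homogeneous n \<Omega> (chart Option1 n \<Omega>) 2 (D_vf Option1 n \<Omega>)"
    using RM_VF by (simp add: quasi_homogeneous_def del: chart.simps)
qed

lemma scale_zero: "scale_vf h 0 = 0"
  unfolding scale_vf_def by (intro HOL.ext) simp

text \<open>The two charts coincide, so the bracket of R with the scaled partial derivative is
  already H and the correction term of Option 2 is zero.\<close>

lemma option2_unchanged_chart:
  assumes "\<not> (odd n \<and> n \<ge> 3)"
  shows "quasi_homogeneous n \<Omega> (chart Option2 n \<Omega>) 2 (D_vf Option2 n \<Omega>)
    \<and> D_vf Option2 n \<Omega> \<in> AMSY n \<Omega>
    \<and> bracket (D_vf Option2 n \<Omega>) (delta_partial2 Option2 n \<Omega>) = radial_vf n \<Omega>"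
proof -
  have c: "chart Option2 n \<Omega> = chart Option1 n \<Omega>"
    using assms by (intro HOL.ext) auto
  then have d: "delta_partial2 Option2 n \<Omega> = delta_partial2 Option1 n \<Omega>"
    unfolding delta_partial2_def by (simp only:)
  have "D_vf Option2 n \<Omega> = RM + scale_vf (tc 2) 0"
    unfolding D_vf.simps d bracket_delta_1 by (simp only: diff_self)
  then have "D_vf Option2 n \<Omega> = D_vf Option1 n \<Omega>"
    unfolding scale_zero by (simp only: add_0_right D_vf.simps)
  then show ?thesis using option1 unfolding c d by (simp only:)
qed

section \<open>Option 2 for odd n \<ge> 3: the correction by the field of E_{n+1,1}\<close>

context
  assumes on: "odd n" "n \<ge> 3"
begin

definition AZ :: "nat \<Rightarrow> nat \<Rightarrow> complex" where "AZ i k = (if i = n + 1 \<and> k = 1 then 1 else 0)"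
text \<open>The commutator A Y - Y A for A = E_{n+1,1}: Y_1 = 1 gives E_{n+1,2}, and -Y_n = 1 gives
  E_{n1}.\<close>

definition AX :: "nat \<Rightarrow> nat \<Rightarrow> complex" where
  "AX i k = (if i = n + 1 \<and> k = 2 then 1 else if i = n \<and> k = 1 then 1 else 0)"
definition ZZ :: vfield where "ZZ = lie_field AZ"
definition XX :: vfield where "XX = lie_field AX"

lemma strict_AZ: "strict AZ" and strict_AX: "strict AX"
  using on by (auto simp: strict_def AZ_def AX_def)

lemma eps_on: "eps 1 = 1" "eps 2 = 1" "eps n = - 1" "eps (n + 1) = - 1"
  using eps_facts on by auto

lemma lieA_AZ: "lieA AZ" and lieA_AX: "lieA AX"
proof -
  show "lieA AZ"
    by (rule lieA_I) (use eps_on in \<open>auto simp: AZ_def\<close>)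
  show "lieA AX"
  proof (rule lieA_I)
    fix i k assume ik: "1 \<le> i" "i \<le> n + 1" "1 \<le> k" "k \<le> n + 1"
    consider "i = n + 1" "k = n" | "i = n" "k = n + 1"
      | "\<not> (i = n + 1 \<and> k = n)" "\<not> (i = n \<and> k = n + 1)" by blast
    then show "AX i (n + 2 - k) * eps (n + 2 - k) + eps i * AX k (n + 2 - i) = 0"
    proof cases
      case 3
      then have "AX i (n + 2 - k) = 0" "AX k (n + 2 - i) = 0" using ik by (auto simp: AX_def)
      then show ?thesis by simp
    qed (use eps_on on in \<open>simp_all add: AX_def\<close>)
  qed
qed

lemma ZZ: "is_lie AZ ZZ" "ZZ \<in> AMSY n \<Omega>" and XX: "is_lie AX XX" "XX \<in> AMSY n \<Omega>"
  unfolding ZZ_def XX_def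
  using lie_field[OF lieA_AZ] lie_field[OF lieA_AX] strict_AZ strict_AX by (auto simp: strict_def)

lemma sum_AZ: "(\<Sum>k = 1..n+1. AZ i k * f k) = (if i = n + 1 then f 1 else 0)"
proof -
  have "(\<Sum>k = 1..n+1. AZ i k * f k) = (\<Sum>k = 1..n+1. if k = 1 then (if i = n + 1 then f 1 else 0) else 0)"
    by (intro sum.cong refl) (auto simp: AZ_def)
  then show ?thesis by (simp add: sum.delta del: sum.cl_ivl_Suc)
qed

lemma sum_AX: "(\<Sum>k = 1..n+1. AX i k * f k) = (if i = n + 1 then f 2 else if i = n then f 1 else 0)"
proof -
  have "(\<Sum>k = 1..n+1. AX i k * f k) = (\<Sum>k = 1..n+1. (if k = 2 then (if i = n + 1 then f 2 else 0) else 0)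
      + (if k = 1 then (if i = n then f 1 else 0) else 0))"
    by (intro sum.cong refl) (auto simp: AX_def)
  then show ?thesis using on by (simp add: sum.distrib sum.delta del: sum.cl_ivl_Suc)
qed

lemma bracket_Z: "bracket RM ZZ = XX"
proof (rule is_lie_unique[OF _ XX(1)])
  have V: "VF (bracket RM ZZ)" by (rule VF_bracket[OF RM_VF is_lie_VF[OF ZZ(1)]])
  have z: "AX 1 1 = 0" "AZ 2 1 = 0" using on by (auto simp: AX_def AZ_def)
  show "is_lie AX (bracket RM ZZ)"
    unfolding is_lie_def
  proof (intro conjI ballI V)
    fix p assume p: "p \<in> M"
    show "base (bracket RM ZZ) (AX 1 1) 0 p"
      unfolding base_def bracket_tc[OF ZZ(1) strict_AZ p] z by simp
    fix i j assume "i \<in> {1..n+1}" "j \<in> {1..n+1}"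
    then have ij: "1 \<le> i" "i \<le> n + 1" "1 \<le> j" "j \<le> n + 1" by auto
    show "bracket RM ZZ (sf i j) p = (\<Sum>k = 1..n+1. AX i k * ss k j p) - AX 1 1 * of_nat j * ss i j p"
      unfolding bracket_sf[OF ZZ(1) strict_AZ p ij] sum_AZ sum_AX z
      using Yf_1[OF p] Yf_n[OF p] on by (auto simp: numeral_2_eq_2)
  qed
qed

text \<open>In the original chart \<open>W1\<close> still moves s_{n+1,1}, by -s_{n1};
  \<open>ZZ\<close> moves this coordinate alone and with speed 1, so the added multiple cancels the
  motion.\<close>

definition partial2 :: vfield where "partial2 = W1 + scale_vf (tc ex) ZZ"

lemma ex_regular: "tc ex \<in> RR"
  using dx_ex[OF on] by (auto intro: tc_regular)

lemma partial2_VF: "VF partial2"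
  unfolding partial2_def by (intro VF_add VF_scale ex_regular is_lie_VF[OF W1(1)] is_lie_VF[OF ZZ(1)])

text \<open>Serves \<open>ZZ\<close> and \<open>XX\<close>: s_{n+1,1} is the only coordinate in row
  n + 1, and outside that row these fields move at most s_{n1}.\<close>

lemma field_on:
  assumes V: "is_lie A V" "strict A" and t: "t \<in> II"
    and d: "\<And>p. p \<in> M \<Longrightarrow> (\<Sum>k = 1..n+1. A (n + 1) k * ss k 1 p) = f p" "f \<in> RR"
    and e: "\<And>p. p \<in> M \<Longrightarrow> (\<Sum>k = 1..n+1. A n k * ss k 1 p) = g p" "g \<in> RR"
    and z: "\<And>i j p. p \<in> M \<Longrightarrow> i \<noteq> n + 1 \<Longrightarrow> (i, j) \<noteq> (n, 1) \<Longrightarrow> (\<Sum>k = 1..n+1. A i k * ss k j p) = 0"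
  shows "V (tc t) = (if t = dx then f else if t = ex then g else 0)"
proof -
  note D = dx_ex[OF on] and VV = is_lie_VF[OF V(1)]
  have R: "V (tc t) \<in> RR" by (rule vf_regular[OF VV tc_regular[OF t]])
  show ?thesis
    using t
  proof (cases rule: tc_cases)
    case 1
    then show ?thesis using lie_tc(1)[OF V] D by auto
  next
    case 2
    then show ?thesis using lie_tc(2)[OF V] D by auto
  next
    case (3 i j)
    note E = lie_tc(3)[OF V 3(1,2)]
    consider "i = n + 1" | "(i, j) = (n, 1)" | "i \<noteq> n + 1" "(i, j) \<noteq> (n, 1)" by blast
    then show ?thesis
    proof cases
      case 1
      have "j = 1" using 3(3) 1 m_odd[OF on(1)] by (simp add: free_iff)
      then have "t = dx" using t_pos_inj[OF 3(1), of dx] D 3(2) 1 by auto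
      then show ?thesis using regular_eqI[OF R d(2)] E d(1) 1 \<open>j = 1\<close> by simp
    next
      case 2
      then have "t = ex" using t_pos_inj[OF 3(1), of ex] D 3(2) by auto
      moreover have "ex \<noteq> dx" using D by auto
      ultimately show ?thesis using regular_eqI[OF R e(2)] E e(1) 2 by simp
    next
      case 3
      have "t \<noteq> dx" "t \<noteq> ex" using \<open>t_pos n t = (i, j)\<close> D(3,4) 3 by auto
      then show ?thesis using regular_eqI[OF R zero_regular] E z 3 by simp
    qed
  qed
qed

lemma ZZ_tc: "t \<in> II \<Longrightarrow> ZZ (tc t) = (if t = dx then cs 1 else if t = ex then 0 else 0)"
proof (rule field_on[OF ZZ(1) strict_AZ])
  show "cs 1 \<in> RR" "0 \<in> RR" by (rule regular.const, rule zero_regular)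
  show "(\<Sum>k = 1..n+1. AZ (n + 1) k * ss k 1 p) = cs 1 p" if "p \<in> M" for p
    unfolding sum_AZ using that ss_11[OF that] by simp
  show "(\<Sum>k = 1..n+1. AZ n k * ss k 1 p) = 0 p" if "p \<in> M" for p
    unfolding sum_AZ by simp
  show "(\<Sum>k = 1..n+1. AZ i k * ss k j p) = 0" if "i \<noteq> n + 1" for i j p
    unfolding sum_AZ using that by simp
qed

lemma XX_tc: "t \<in> II \<Longrightarrow> XX (tc t) = (if t = dx then tc 2 else if t = ex then cs 1 else 0)"
proof (rule field_on[OF XX(1) strict_AX])
  show "tc 2 \<in> RR" "cs 1 \<in> RR" using two_in by (auto intro: tc_regular regular.const)
  show "(\<Sum>k = 1..n+1. AX (n + 1) k * ss k 1 p) = tc 2 p" if "p \<in> M" for p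
    unfolding sum_AX tc_t2 using that by simp
  show "(\<Sum>k = 1..n+1. AX n k * ss k 1 p) = cs 1 p" if "p \<in> M" for p
    unfolding sum_AX using that ss_11[OF that] by simp
  show "(\<Sum>k = 1..n+1. AX i k * ss k j p) = 0" if "p \<in> M" "i \<noteq> n + 1" "(i, j) \<noteq> (n, 1)" for i j p
    unfolding sum_AX using that ss_upper[OF that(1), of 1 j] ss_out[of 1 j p] by (cases "j = 0"; cases "j = 1") auto
qed

lemma partial2_tc: "t \<in> II \<Longrightarrow> partial2 (tc t) = cs (if t = 2 then 1 else 0)"
proof (cases "t = dx")
  case True
  assume "t \<in> II"
  have "partial2 (tc t) = - tc ex + tc ex * cs 1"
    unfolding partial2_def scale_vf_def plus_fun_apply[of W1] True W1_dx[OF on]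
    using ZZ_tc[of dx] \<open>t \<in> II\<close> True by simp
  also have "\<dots> = cs 0"
    using cs_mult_regular[OF ex_regular] unfolding cs_0 by (simp only: mult.commute left_minus)
  finally show ?thesis using True dx_ex[OF on] by auto
next
  case False
  assume t: "t \<in> II"
  have "partial2 (tc t) = cs (if t = 2 then 1 else 0) + tc ex * 0"
    unfolding partial2_def scale_vf_def plus_fun_apply[of W1]
    using ZZ_tc[OF t] W1_tc[OF t] False by simp
  then show ?thesis by (simp only: mult_zero_right add_0_right)
qed

lemma delta_2: "delta_partial2 Option2 n \<Omega> = partial2"
proof -
  have "partial_deriv n \<Omega> (chart Option2 n \<Omega>) 2 = partial2"
    by (rule partial_deriv_eq[OF partial2_VF]) (simp add: partial2_tc)
  then have "delta_partial2 Option2 n \<Omega> = scale_vf (cs 1) partial2"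
    unfolding delta_partial2_def using on by simp
  also have "scale_vf (cs 1) partial2 = partial2"
  proof
    fix f show "scale_vf (cs 1) partial2 f = partial2 f"
      unfolding scale_vf_def using cs_mult_regular[OF vf_regular[OF partial2_VF]] vf_outside[OF partial2_VF, of f]
      by (cases "f \<in> RR") simp_all
  qed
  finally show ?thesis .
qed

text \<open>The Leibniz rule for [R, s_{n1} Z] gives R(s_{n1}) Z + s_{n1} [R, Z], and [R, Z] is
  \<open>XX\<close>.\<close>

definition FF :: vfield where "FF = scale_vf (RM (tc ex)) ZZ + scale_vf (tc ex) XX"

lemma RM_ex_regular: "RM (tc ex) \<in> RR"
  by (rule vf_regular[OF RM_VF ex_regular])

lemma FF_AMSY: "FF \<in> AMSY n \<Omega>"
  unfolding FF_def by (intro AMSY.add AMSY.scale RM_ex_regular ex_regular ZZ XX)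

lemma bracket_P2: "bracket RM partial2 = radial_vf n \<Omega> + FF"
proof -
  have H: "bracket RM W1 = radial_vf n \<Omega>"
  proof -
    have "scale_vf (cs 1) W1 = W1"
    proof
      fix f show "scale_vf (cs 1) W1 f = W1 f"
        unfolding scale_vf_def using cs_mult_regular[OF vf_regular[OF is_lie_VF[OF W1(1)]]]
          vf_outside[OF is_lie_VF[OF W1(1)], of f] by (cases "f \<in> RR") simp_all
    qed
    then show ?thesis using bracket_delta_1 unfolding delta_1 q1[OF on] by simp
  qed
  show ?thesis
  proof
    fix f
    have P: "partial2 g = W1 g + tc ex * ZZ g" for g unfolding partial2_def scale_vf_def by (rule plus_fun_apply)
    have W: "VF W1" and Z: "VF ZZ" by (rule is_lie_VF[OF W1(1)], rule is_lie_VF[OF ZZ(1)])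
    have F: "(radial_vf n \<Omega> + FF) f = radial_vf n \<Omega> f + (RM (tc ex) * ZZ f + tc ex * XX f)"
      unfolding FF_def scale_vf_def by (simp only: plus_fun_apply[of _ _ f])
    show "bracket RM partial2 f = (radial_vf n \<Omega> + FF) f"
    proof (cases "f \<in> RR")
      case True
      have RP: "RM (partial2 f) = RM (W1 f) + (RM (tc ex) * ZZ f + tc ex * RM (ZZ f))"
        unfolding P by (simp only: vf_add[OF RM_VF] vf_mult[OF RM_VF] vf_regular[OF W True] vf_regular[OF Z True]
          ex_regular regular.mult)
      show ?thesis
        unfolding F unfolding H[symmetric] bracket_Z[symmetric] unfolding bracket_def RP unfolding P
        by (simp only: algebra_simps)
    next
      case False
      have "VF (bracket RM partial2)" "VF (radial_vf n \<Omega> + FF)"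
        using VF_bracket[OF RM_VF partial2_VF] VF_add[OF _ AMSY_VF[OF FF_AMSY]] is_lie_VF[OF radial_spec] by auto
      then show ?thesis using vf_outside False by metis
    qed
  qed
qed

lemma RM_ex: "RM (tc ex) = - tc dx - tc 2 * tc ex"
proof (rule regular_eqI[OF RM_ex_regular])
  have I: "2 \<in> II" "dx \<in> II" "ex \<in> II" using dx_ex[OF on] two_in by auto
  show "- tc dx - tc 2 * tc ex \<in> RR"
    using I by (intro regular_diff regular_uminus regular.mult tc_regular)
  fix p assume p: "p \<in> M"
  have "RM (tc ex) p = Rc n 1 p"
    unfolding tc_ex[OF on] using modular_spec p on by (simp add: is_mod_def)
  also have "\<dots> = - ss (n + 1) 1 p - ss 2 1 p * ss n 1 p"
    unfolding Rc_def using Yf_n[OF p] on ss_out[of n 0 p] ss_upper[OF p, of n "n + 1"] by simp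
  finally show "RM (tc ex) p = (- tc dx - tc 2 * tc ex) p"
    unfolding tc_ex[OF on] tc_dx[OF on] tc_t2 using p by simp
qed

text \<open>On s_{n+1,1} the value is R(s_{n1}) + s_{n1} s_21, and the quadratic term of R(s_{n1}) =
  -s_{n+1,1} - s_21 s_{n1} cancels.\<close>

lemma FF_tc: "t \<in> II \<Longrightarrow> FF (tc t) = (if t = dx then - tc dx else if t = ex then tc ex else 0)"
proof -
  assume t: "t \<in> II"
  have F: "FF (tc t) = RM (tc ex) * ZZ (tc t) + tc ex * XX (tc t)"
    unfolding FF_def scale_vf_def by (rule plus_fun_apply)
  have ne: "ex \<noteq> dx" using dx_ex[OF on] by auto
  have c: "g * cs 1 = g" if "g \<in> RR" for g
    using cs_mult_regular[OF that] by (simp only: mult.commute)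
  consider "t = dx" | "t = ex" | "t \<noteq> dx" "t \<noteq> ex" by blast
  then show ?thesis
  proof cases
    case 1
    then have "ZZ (tc t) = cs 1" "XX (tc t) = tc 2" using ZZ_tc[OF t] XX_tc[OF t] by simp_all
    then have "FF (tc t) = (- tc dx - tc 2 * tc ex) + tc 2 * tc ex"
      unfolding F RM_ex[symmetric] by (simp only: c[OF RM_ex_regular] mult.commute[of "tc ex"])
    then show ?thesis using 1 by (simp only: diff_add_cancel if_True simp_thms)
  next
    case 2
    then have "ZZ (tc t) = 0" "XX (tc t) = cs 1" using ZZ_tc[OF t] XX_tc[OF t] ne by simp_all
    then have "FF (tc t) = tc ex" unfolding F by (simp only: c[OF ex_regular] mult_zero_right add_0_left)
    then show ?thesis using 2 ne by simp
  next
    case 3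
    then show ?thesis unfolding F using ZZ_tc[OF t] XX_tc[OF t]
      by (simp only: if_False mult_zero_right add_0_left)
  qed
qed

lemma D_2: "D_vf Option2 n \<Omega> = RM + scale_vf (tc 2) FF"
  unfolding D_vf.simps delta_2 bracket_P2 by (simp only: add_diff_cancel_left')

lemma option2_changed_chart:
  "quasi_homogeneous n \<Omega> (chart Option2 n \<Omega>) 2 (D_vf Option2 n \<Omega>)
    \<and> D_vf Option2 n \<Omega> \<in> AMSY n \<Omega>
    \<and> bracket (D_vf Option2 n \<Omega>) (delta_partial2 Option2 n \<Omega>) = radial_vf n \<Omega>"
proof (intro conjI)
  note D = dx_ex[OF on] and w = wt_dx_ex[OF on]
  let ?D = "D_vf Option2 n \<Omega>"
  have I: "2 \<in> II" "dx \<in> II" "ex \<in> II" using D two_in by auto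
  show am: "?D \<in> AMSY n \<Omega>"
    unfolding D_2 using I by (intro AMSY.add AMSY.scale AMSY.modular FF_AMSY tc_regular)
  have VD: "VF ?D" by (rule AMSY_VF[OF am])
  have Dtc: "?D f = RM f + tc 2 * FF f" for f
    unfolding D_2 scale_vf_def by (rule plus_fun_apply)
  \<comment> \<open>\<open>FF\<close> multiplies each coordinate by a constant and so has degree 0;
    the factor t_2 brings the degree to 2.\<close>
  have hF: "homogeneous n \<Omega> (wt n j) (FF (tc j))" if "j \<in> II" for j
  proof -
    have "homogeneous n \<Omega> (0 + wt n dx) (cs (- 1) * tc dx)"
      by (intro homogeneous.mult homogeneous.const homogeneous.coord I)
    then have "homogeneous n \<Omega> (wt n dx) (- tc dx)"
      unfolding cs_uminus[OF RM_VF tc_regular[OF I(2)]] by simp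
    then show ?thesis unfolding FF_tc[OF that]
      using homogeneous_tc[OF I(3)] homogeneous.zero[of n \<Omega> "wt n j"] by (simp split: if_split)
  qed
  have "homogeneous n \<Omega> (wt n j + 2) (?D (tc j))" if j: "j \<in> II" for j
  proof -
    have "homogeneous n \<Omega> (2 + wt n j) (tc 2 * FF (tc j))"
      using homogeneous.mult[OF homogeneous_tc[OF I(1)] hF[OF j]] unfolding w .
    then show ?thesis unfolding Dtc using homogeneous_RM_tc[OF j]
      by (intro homogeneous.add) (simp_all add: add.commute)
  qed
  then show "quasi_homogeneous n \<Omega> (chart Option2 n \<Omega>) 2 ?D"
    unfolding quasi_homogeneous_def using VD by (simp del: D_vf.simps)
  show "bracket ?D (delta_partial2 Option2 n \<Omega>) = radial_vf n \<Omega>"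
    unfolding delta_2
  proof (rule vf_unique)
    show "VF (bracket ?D partial2)" by (rule VF_bracket[OF VD partial2_VF])
    show "VF (radial_vf n \<Omega>)" by (rule is_lie_VF[OF radial_spec])
    fix s assume s: "s \<in> II"
    have FR: "FF (tc s) \<in> RR" by (rule vf_regular[OF AMSY_VF[OF FF_AMSY] tc_regular[OF s]])
    have "partial2 (tc dx) = 0" "partial2 (tc ex) = 0" using partial2_tc[OF I(2)] partial2_tc[OF I(3)] D cs_0 by auto
    then have PF: "partial2 (FF (tc s)) = 0"
      unfolding FF_tc[OF s] using vf_uminus[OF partial2_VF tc_regular[OF I(2)]] vf_zero[OF partial2_VF] by simp
    have P22: "partial2 (tc 2) = cs 1" using partial2_tc[OF I(1)] by simp
    have c: "V (partial2 (tc s)) = 0" if "VF V" for V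
      unfolding partial2_tc[OF s] by (rule vf_cs[OF that])
    have "partial2 (?D (tc s)) = partial2 (RM (tc s)) + (cs 1 * FF (tc s) + tc 2 * 0)"
      unfolding Dtc using P22 PF
      by (simp only: vf_add[OF partial2_VF] vf_mult[OF partial2_VF] vf_regular[OF RM_VF tc_regular[OF s]] tc_regular[OF I(1)]
        FR regular.mult if_True)
    then have "partial2 (?D (tc s)) = partial2 (RM (tc s)) + FF (tc s)"
      by (simp only: cs_mult_regular[OF FR] mult_zero_right add_0_right)
    then have "bracket ?D partial2 (tc s) = bracket RM partial2 (tc s) - FF (tc s)"
      unfolding bracket_def c[OF VD] c[OF RM_VF] by (simp only: diff_diff_eq)
    also have "bracket RM partial2 (tc s) = radial_vf n \<Omega> (tc s) + FF (tc s)"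
      unfolding bracket_P2 by (rule plus_fun_apply)
    finally show "bracket ?D partial2 (tc s) = radial_vf n \<Omega> (tc s)" by (simp only: add_diff_cancel_right')
  qed
qed

end

end

theorem lemma4p1:
  fixes n :: nat and c :: complex and \<Omega> :: "complex \<Rightarrow> complex \<Rightarrow> complex mat"
    and opt :: construction
  assumes "n \<ge> 1"
    and "c \<noteq> 0"
    and "intersection_matrix n c \<Omega>"
  shows "quasi_homogeneous n \<Omega> (chart opt n \<Omega>) 2 (D_vf opt n \<Omega>)
    \<and> D_vf opt n \<Omega> \<in> AMSY n \<Omega>
    \<and> bracket (D_vf opt n \<Omega>) (delta_partial2 opt n \<Omega>) = radial_vf n \<Omega>"
proof -
  interpret dwork n c \<Omega> using assms by unfold_locales
  show ?thesis
  proof (cases opt)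
    case Option1
    then show ?thesis using option1 by (simp only:)
  next
    case Option2
    show ?thesis
    proof (cases "odd n \<and> n \<ge> 3")
      case True
      then show ?thesis unfolding Option2 by (intro option2_changed_chart) simp_all
    next
      case False
      then show ?thesis unfolding Option2 by (rule option2_unchanged_chart)
    qed
  qed
qed

end
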